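(* Let $(\mathcal X,d,\mu)$ be a space of homogeneous type. Let $\{Q_k\}_{k=0}^\infty$ and $\{P_k\}_{k=0}^\infty$ be two exp-IATIs, $\beta,\gamma\in(0,\eta)$, $s\in(-(\beta\wedge\gamma),\beta\wedge\gamma)$ and $q\in(p(s,\beta\wedge\gamma),\infty]$. Let $N,N'\in\mathbb N$ be the integers of the inhomogeneous discrete Calderón reproducing formula (see context) associated with $\{Q_k\}_{k=0}^\infty$ and $\{P_k\}_{k=0}^\infty$, respectively. Then, for any $f\in(\mathcal G^\eta_0(\beta,\gamma))'$, $$\max\Big\{\sup_{k\in\{0,\dots,N\}}\sup_{\alpha\in\mathcal A_k}\sup_{m\in\{1,\dots,N(k,\alpha)\}}m_{Q^{k,m}_\alpha}(|Q_k(f)|),\ \sup_{l\in\mathbb N,\,l>N}\sup_{\alpha\in\mathcal A_l}\Big[\frac1{\mu(Q^l_\alpha)}\int_{Q^l_\alpha}\sum_{k=l}^\infty\delta^{-ksq}|Q_k(f)(x)|^q\,d\mu(x)\Big]^{1/q}\Big\}$$ $$\sim\max\Big\{\sup_{k'\in\{0,\dots,N'\}}\sup_{\alpha'\in\mathcal A_{k'}}\sup_{m'\in\{1,\dots,N(k',\alpha')\}}m_{Q^{k',m'}_{\alpha'}}(|P_{k'}(f)|),\ \sup_{l'\in\mathbb N,\,l'>N'}\sup_{\alpha'\in\mathcal A_{l'}}\Big[\frac1{\mu(Q^{l'}_{\alpha'})}\int_{Q^{l'}_{\alpha'}}\sum_{k'=l'}^\infty\delta^{-k'sq}|P_{k'}(f)(x)|^q\,d\mu(x)\Big]^{1/q}\Big\}$$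 (with the usual modification when $q=\infty$), where the positive equivalence constants are independent of $f$.
   Context: Space. $d$ is a quasi-metric on $\mathcal X$: $d\ge0$, $d(x,y)=0$ iff $x=y$, $d$ symmetric, $d(x,z)\le A_0[d(x,y)+d(y,z)]$ for some $A_0\in[1,\infty)$. $B(x,r):=\{y:d(x,y)<r\}$. $(\mathcal X,d,\mu)$ is a space of homogeneous type: $\mu$ is a measure for which balls are measurable with $0<\mu(B)<\infty$, and $\mu(2B)\le C_{(\mu)}\mu(B)$ for every ball $B$; $\omega:=\log_2C_{(\mu)}$. $\mu(\mathcal X)$ may be finite or infinite. $V_r(x):=\mu(B(x,r))$, $V(x,y):=\mu(B(x,d(x,y)))$ ($=0$ if $x=y$). $a\wedge b:=\min\{a,b\}$. $m_E(g):=\frac1{\mu(E)}\int_Eg\,d\mu$. $\mathbb Z_+=\{0,1,2,\dots\}$, $\mathbb N=\{1,2,\dots\}$. Dyadic cubes. Fix $0<c_0\le C_0<\infty$, a small $\delta\in(0,1)$ (e.g. $\delta\le(2A_0)^{-10}$) with $12A_0^3C_0\delta\le c_0$, and points $\{z^k_\alpha:k\in\mathbb Z,\alpha\in\mathcal A_k\}$, nested ($\mathcal A_k\subset\mathcal A_{k+1}$ and $z^{k+1}_\alpha=z^k_\alpha$ for $\alpha\in\mathcal A_k$), with $d(z^k_\alpha,z^k_\beta)\ge c_0\delta^k$ if $\alpha\ne\beta$ and $\min_{\alpha\in\mathcal A_k}d(x,z^k_\alpha)<C_0\delta^k$ for all $x$. $\mathcal Y^k:=\{z^{k+1}_\alpha:\alpha\in\mathcal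 A_{k+1}\setminus\mathcal A_k\}$, $d(x,\mathcal Y^k):=\inf_{y\in\mathcal Y^k}d(x,y)$. $\{Q^k_\alpha\}$ is an associated (Hytönen–Kairema) system of dyadic cubes: for each $k$, $\{Q^k_\alpha\}_{\alpha\in\mathcal A_k}$ is disjoint with union $\mathcal X$; for $k\le l$ each $Q^l_\beta$ is contained in or disjoint from each $Q^k_\alpha$; $B(z^k_\alpha,(3A_0^2)^{-1}c_0\delta^k)\subset Q^k_\alpha\subset B(z^k_\alpha,2A_0C_0\delta^k)$. Fix $j_0\in\mathbb N$ large with $\delta^{j_0}\le(2A_0)^{-3}C_0$; $\{Q^{k,m}_\alpha\}_{m=1}^{N(k,\alpha)}$ enumerates the cubes $Q^{k+j_0}_\tau$ contained in $Q^k_\alpha$. exp-IATI. $\eta\in(0,1)$ is a fixed exponent for which such approximations exist on $\mathcal X$. Put $$E_k(x,y):=\frac{1}{\sqrt{V_{\delta^k}(x)V_{\delta^k}(y)}}\exp\Big\{-\nu\Big[\frac{d(x,y)}{\delta^k}\Big]^a\Big\}\exp\Big\{-\nu\Big[\frac{\max\{d(x,\mathcal Y^k),d(y,\mathcal Y^k)\}}{\delta^k}\Big]^a\Big\}.$$ An exp-IATI is a sequence $\{Q_k\}_{k\in\mathbb Z_+}$ of bounded linear integral operators on $L^2(\mathcal X)$, with kernels $Q_k(x,y)$, with $\sum_{k=0}^\infty Q_k=I$ in $L^2(\mathcal X)$, such that for some constants $C,\nu\in(0,\infty)$, $a\in(0,1]$, for all $k\in\mathbb N$ and all points: (a) $|Q_k(x,y)|\le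 CE_k(x,y)$; (b) if $d(x,x')\le\delta^k$, then $|Q_k(x,y)-Q_k(x',y)|+|Q_k(y,x)-Q_k(y,x')|\le C[d(x,x')/\delta^k]^\eta E_k(x,y)$; (c) if $d(x,x')\le\delta^k$ and $d(y,y')\le\delta^k$, then $|[Q_k(x,y)-Q_k(x',y)]-[Q_k(x,y')-Q_k(x',y')]|\le C[d(x,x')/\delta^k]^\eta[d(y,y')/\delta^k]^\eta E_k(x,y)$; (d) $\int Q_k(x,y)\,d\mu(y)=0=\int Q_k(y,x)\,d\mu(y)$; while $Q_0$ satisfies (a)–(c) with $k=0$ and with the second exponential factor removed from $E_0$, and $\int Q_0(x,y)\,d\mu(y)=1=\int Q_0(y,x)\,d\mu(y)$. Test functions and distributions. Fix $x_0\in\mathcal X$. For $\beta\in(0,1]$, $\gamma\in(0,\infty)$, $\mathcal G(\beta,\gamma)$ is the set of functions $f$ for which there is $C>0$ such that, with $D_\gamma(x):=\frac{1}{V_1(x_0)+V(x_0,x)}[1+d(x_0,x)]^{-\gamma}$: $|f(x)|\le CD_\gamma(x)$ for all $x$, and $|f(x)-f(y)|\le C[\frac{d(x,y)}{1+d(x_0,x)}]^\beta D_\gamma(x)$ whenever $d(x,y)\le(2A_0)^{-1}[1+d(x_0,x)]$; its norm is the infimum of such $C$. For $\beta,\gamma\in(0,\eta]$, $\mathcal G^\eta_0(\beta,\gamma)$ is the completion of $\mathcal G(\eta,\eta)$ in $\mathcal G(\beta,\gamma)$, and $(\mathcal G^\eta_0(\beta,\gamma))'$ is its dual. For $f$ in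 this dual, $Q_k(f)(x)=Q_kf(x):=\langle f,Q_k(x,\cdot)\rangle$. The integer $N$. With an exp-IATI $\{Q_k\}$ one associates a fixed $N\in\mathbb N$ for which the following (known) reproducing formula holds: for $\beta,\gamma\in(0,\eta)$ and arbitrary points $y^{k,m}_\alpha\in Q^{k,m}_\alpha$ there are bounded linear integral operators $\{\widetilde Q_k\}_{k\in\mathbb Z_+}$ on $L^2(\mathcal X)$ with, for all $f\in(\mathcal G^\eta_0(\beta,\gamma))'$, $$f=\sum_{\alpha\in\mathcal A_0}\sum_m\int_{Q^{0,m}_\alpha}\widetilde Q_0(\cdot,y)\,d\mu(y)\,Q^{0,m}_{\alpha,1}(f)+\sum_{k=1}^N\sum_{\alpha,m}\mu(Q^{k,m}_\alpha)\widetilde Q_k(\cdot,y^{k,m}_\alpha)Q^{k,m}_{\alpha,1}(f)+\sum_{k=N+1}^\infty\sum_{\alpha,m}\mu(Q^{k,m}_\alpha)\widetilde Q_k(\cdot,y^{k,m}_\alpha)Q_kf(y^{k,m}_\alpha)$$ in $(\mathcal G^\eta_0(\beta,\gamma))'$, where $Q^{k,m}_{\alpha,1}(f):=m_{Q^{k,m}_\alpha}(Q_kf)$ and, with $R_k(x,y):=\frac{1}{V_{\delta^k}(x)+V(x,y)}[\frac{\delta^k}{\delta^k+d(x,y)}]^\gamma$ and $C$ independent of the points $y^{k,m}_\alpha$: $|\widetilde Q_k(x,y)|\le CR_k(x,y)$; $|\widetilde Q_k(x,y)-\widetilde Q_k(x',y)|\le C[\frac{d(x,x')}{\delta^k+d(x,y)}]^\beta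 R_k(x,y)$ if $d(x,x')\le(2A_0)^{-1}[\delta^k+d(x,y)]$; $\int\widetilde Q_k(x,y)\,d\mu(y)=\int\widetilde Q_k(y,x)\,d\mu(y)$ equals $1$ if $k\le N$ and $0$ if $k>N$. Index. For $|s|<t$, $p(s,t):=\max\{\frac{\omega}{\omega+t},\frac{\omega}{\omega+t+s}\}$. $A\sim B$ means $C^{-1}A\le B\le CA$ for a positive constant $C$. *)

theory Defs
  imports "HOL-Analysis.Analysis" "HOL-Probability.Essential_Supremum"
begin

text \<open>
  The underlying set is the whole type \<open>'a\<close>; all functions and kernels are complex valued.
  Levels of dyadic cubes are integers, levels of operators are natural numbers.
\<close>

section \<open>Spaces of homogeneous type\<close>

definition qball :: "('a \<Rightarrow> 'a \<Rightarrow> real) \<Rightarrow> 'a \<Rightarrow> real \<Rightarrow> 'a set" where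
  "qball d x r = {y. d x y < r}"

locale homogeneous_type =
  fixes M :: "'a measure" and d :: "'a \<Rightarrow> 'a \<Rightarrow> real" and A0 Cmu :: real
  assumes A0_ge_1: "1 \<le> A0"
    and dist_nonneg: "0 \<le> d x y"
    and dist_eq_0_iff: "d x y = 0 \<longleftrightarrow> x = y"
    and dist_sym: "d x y = d y x"
    and quasi_triangle: "d x z \<le> A0 * (d x y + d y z)"
    and space_UNIV: "space M = UNIV"
    and ball_measurable: "0 < r \<Longrightarrow> qball d x r \<in> sets M"
    and ball_pos: "0 < r \<Longrightarrow> 0 < emeasure M (qball d x r)"
    and ball_finite: "0 < r \<Longrightarrow> emeasure M (qball d x r) < \<infinity>"
    and doubling: "0 < r \<Longrightarrow> measure M (qball d x (2 * r)) \<le> Cmu * measure M (qball d x r)"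

text \<open>\<open>vol M d r x\<close> is $V_r(x)$ and \<open>vol2 M d x y\<close> is $V(x,y)$.\<close>

definition vol :: "'a measure \<Rightarrow> ('a \<Rightarrow> 'a \<Rightarrow> real) \<Rightarrow> real \<Rightarrow> 'a \<Rightarrow> real" where
  "vol M d r x = measure M (qball d x r)"

definition vol2 :: "'a measure \<Rightarrow> ('a \<Rightarrow> 'a \<Rightarrow> real) \<Rightarrow> 'a \<Rightarrow> 'a \<Rightarrow> real" where
  "vol2 M d x y = measure M (qball d x (d x y))"

definition mean :: "'a measure \<Rightarrow> 'a set \<Rightarrow> ('a \<Rightarrow> complex) \<Rightarrow> complex" where
  "mean M E g = (LINT x:E|M. g x) / complex_of_real (measure M E)"

section \<open>Dyadic cubes\<close>

text \<open>
  Cubes are required to be measurable, as is implicit in averaging over them.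
  \<open>sub k \<alpha> m\<close>, for \<open>1 \<le> m \<le> cnt k \<alpha>\<close>, is the cube $Q^{k,m}_\alpha$.
\<close>

locale dyadic_system = homogeneous_type M d A0 Cmu
  for M :: "'a measure" and d :: "'a \<Rightarrow> 'a \<Rightarrow> real" and A0 Cmu :: real +
  fixes c0 C0 \<delta> :: real
    and A :: "int \<Rightarrow> 'i set" and z :: "int \<Rightarrow> 'i \<Rightarrow> 'a" and cube :: "int \<Rightarrow> 'i \<Rightarrow> 'a set"
    and j0 :: nat and cnt :: "int \<Rightarrow> 'i \<Rightarrow> nat" and sub :: "int \<Rightarrow> 'i \<Rightarrow> nat \<Rightarrow> 'a set"
  assumes c0_pos: "0 < c0" and c0_le_C0: "c0 \<le> C0"
    and delta_pos: "0 < \<delta>" and delta_less_1: "\<delta> < 1"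
    and delta_small: "12 * A0 ^ 3 * C0 * \<delta> \<le> c0"
    and index_nested: "A k \<subseteq> A (k + 1)"
    and point_nested: "\<alpha> \<in> A k \<Longrightarrow> z (k + 1) \<alpha> = z k \<alpha>"
    and point_separated:
      "\<alpha> \<in> A k \<Longrightarrow> \<beta> \<in> A k \<Longrightarrow> \<alpha> \<noteq> \<beta> \<Longrightarrow> c0 * \<delta> powi k \<le> d (z k \<alpha>) (z k \<beta>)"
    and point_dense: "\<exists>\<alpha>\<in>A k. d x (z k \<alpha>) < C0 * \<delta> powi k"
    and cube_measurable: "\<alpha> \<in> A k \<Longrightarrow> cube k \<alpha> \<in> sets M"
    and cube_disjoint: "disjoint_family_on (cube k) (A k)"
    and cube_cover: "(\<Union>\<alpha>\<in>A k. cube k \<alpha>) = UNIV"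
    and cube_nested:
      "k \<le> l \<Longrightarrow> \<alpha> \<in> A k \<Longrightarrow> \<beta> \<in> A l \<Longrightarrow> cube l \<beta> \<subseteq> cube k \<alpha> \<or> cube l \<beta> \<inter> cube k \<alpha> = {}"
    and cube_inner: "\<alpha> \<in> A k \<Longrightarrow> qball d (z k \<alpha>) (c0 * \<delta> powi k / (3 * A0\<^sup>2)) \<subseteq> cube k \<alpha>"
    and cube_outer: "\<alpha> \<in> A k \<Longrightarrow> cube k \<alpha> \<subseteq> qball d (z k \<alpha>) (2 * A0 * C0 * \<delta> powi k)"
    and j0_pos: "1 \<le> j0"
    and j0_large: "\<delta> ^ j0 \<le> C0 / (2 * A0) ^ 3"
    and sub_enum: "\<alpha> \<in> A k \<Longrightarrow>
      bij_betw (sub k \<alpha>) {1..cnt k \<alpha>}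
        {cube (k + int j0) \<tau> | \<tau>. \<tau> \<in> A (k + int j0) \<and> cube (k + int j0) \<tau> \<subseteq> cube k \<alpha>}"

definition new_points :: "(int \<Rightarrow> 'i set) \<Rightarrow> (int \<Rightarrow> 'i \<Rightarrow> 'a) \<Rightarrow> nat \<Rightarrow> 'a set" where
  "new_points A z k = z (int k + 1) ` (A (int k + 1) - A (int k))"

section \<open>Integral operators and exp-IATIs\<close>

definition L2 :: "'a measure \<Rightarrow> ('a \<Rightarrow> complex) set" where
  "L2 M = {g \<in> borel_measurable M. integrable M (\<lambda>x. (cmod (g x))\<^sup>2)}"

definition L2_nrm :: "'a measure \<Rightarrow> ('a \<Rightarrow> complex) \<Rightarrow> real" where
  "L2_nrm M g = sqrt (\<integral>x. (cmod (g x))\<^sup>2 \<partial>M)"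

definition int_op :: "'a measure \<Rightarrow> ('a \<Rightarrow> 'a \<Rightarrow> complex) \<Rightarrow> ('a \<Rightarrow> complex) \<Rightarrow> 'a \<Rightarrow> complex" where
  "int_op M K g x = (\<integral>y. K x y * g y \<partial>M)"

text \<open>Linearity of the operator is automatic once the defining integrals converge.\<close>

definition L2_integral_operator :: "'a measure \<Rightarrow> ('a \<Rightarrow> 'a \<Rightarrow> complex) \<Rightarrow> bool" where
  "L2_integral_operator M K \<longleftrightarrow>
     (\<lambda>(x, y). K x y) \<in> borel_measurable (M \<Otimes>\<^sub>M M) \<and>
     (\<exists>B. \<forall>g\<in>L2 M. (AE x in M. integrable M (\<lambda>y. K x y * g y)) \<and>
        int_op M K g \<in> L2 M \<and> L2_nrm M (int_op M K g) \<le> B * L2_nrm M g)"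

text \<open>
  The bound $E_k(x,y)$, without its second exponential factor if \<open>k = 0\<close>.  \<open>Y k\<close> may be empty;
  the distance to the empty set is infinite, so that the second factor is then 0.
\<close>

definition iati_bound ::
  "'a measure \<Rightarrow> ('a \<Rightarrow> 'a \<Rightarrow> real) \<Rightarrow> real \<Rightarrow> (nat \<Rightarrow> 'a set) \<Rightarrow> real \<Rightarrow> real \<Rightarrow> nat \<Rightarrow> 'a \<Rightarrow> 'a \<Rightarrow> real"
where
  "iati_bound M d \<delta> Y \<nu> a k x y =
     1 / sqrt (vol M d (\<delta> ^ k) x * vol M d (\<delta> ^ k) y) * exp (- \<nu> * (d x y / \<delta> ^ k) powr a) *
     (if k = 0 then 1
      else if Y k = {} then 0
      else exp (- \<nu> * (max (INF v\<in>Y k. d x v) (INF v\<in>Y k. d y v) / \<delta> ^ k) powr a))"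

definition exp_IATI ::
  "'a measure \<Rightarrow> ('a \<Rightarrow> 'a \<Rightarrow> real) \<Rightarrow> real \<Rightarrow> (nat \<Rightarrow> 'a set) \<Rightarrow> real \<Rightarrow>
    (nat \<Rightarrow> 'a \<Rightarrow> 'a \<Rightarrow> complex) \<Rightarrow> bool"
where
  "exp_IATI M d \<delta> Y \<eta> Q \<longleftrightarrow>
     (\<forall>k. L2_integral_operator M (Q k)) \<and>
     (\<forall>g\<in>L2 M. (\<lambda>n. L2_nrm M (\<lambda>x. (\<Sum>k<n. int_op M (Q k) g x) - g x)) \<longlonglongrightarrow> 0) \<and>
     (\<exists>C \<nu> a. 0 < C \<and> 0 < \<nu> \<and> 0 < a \<and> a \<le> 1 \<and>
       (\<forall>k. let E = iati_bound M d \<delta> Y \<nu> a k in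
         (\<forall>x y. cmod (Q k x y) \<le> C * E x y) \<and>
         (\<forall>x x' y. d x x' \<le> \<delta> ^ k \<longrightarrow>
            cmod (Q k x y - Q k x' y) + cmod (Q k y x - Q k y x')
              \<le> C * (d x x' / \<delta> ^ k) powr \<eta> * E x y) \<and>
         (\<forall>x x' y y'. d x x' \<le> \<delta> ^ k \<longrightarrow> d y y' \<le> \<delta> ^ k \<longrightarrow>
            cmod ((Q k x y - Q k x' y) - (Q k x y' - Q k x' y'))
              \<le> C * (d x x' / \<delta> ^ k) powr \<eta> * (d y y' / \<delta> ^ k) powr \<eta> * E x y))) \<and>
     (\<forall>k x. (\<integral>y. Q k x y \<partial>M) = (if k = 0 then 1 else 0) \<and>
            (\<integral>y. Q k y x \<partial>M) = (if k = 0 then 1 else 0))"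

section \<open>Test functions and distributions\<close>

definition test_bound ::
  "'a measure \<Rightarrow> ('a \<Rightarrow> 'a \<Rightarrow> real) \<Rightarrow> real \<Rightarrow> 'a \<Rightarrow> real \<Rightarrow> real \<Rightarrow> ('a \<Rightarrow> complex) \<Rightarrow> real \<Rightarrow> bool"
where
  "test_bound M d A0 x0 \<beta> \<gamma> g C \<longleftrightarrow>
     (let D = (\<lambda>x. 1 / (vol M d 1 x0 + vol2 M d x0 x) * (1 + d x0 x) powr (- \<gamma>)) in
       (\<forall>x. cmod (g x) \<le> C * D x) \<and>
       (\<forall>x y. d x y \<le> (1 + d x0 x) / (2 * A0) \<longrightarrow>
          cmod (g x - g y) \<le> C * (d x y / (1 + d x0 x)) powr \<beta> * D x))"

definition test_space ::
  "'a measure \<Rightarrow> ('a \<Rightarrow> 'a \<Rightarrow> real) \<Rightarrow> real \<Rightarrow> 'a \<Rightarrow> real \<Rightarrow> real \<Rightarrow> ('a \<Rightarrow> complex) set"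
where
  "test_space M d A0 x0 \<beta> \<gamma> = {g. \<exists>C>0. test_bound M d A0 x0 \<beta> \<gamma> g C}"

definition test_norm ::
  "'a measure \<Rightarrow> ('a \<Rightarrow> 'a \<Rightarrow> real) \<Rightarrow> real \<Rightarrow> 'a \<Rightarrow> real \<Rightarrow> real \<Rightarrow> ('a \<Rightarrow> complex) \<Rightarrow> real"
where
  "test_norm M d A0 x0 \<beta> \<gamma> g = Inf {C. 0 < C \<and> test_bound M d A0 x0 \<beta> \<gamma> g C}"

text \<open>The completion of $\mathcal G(\eta,\eta)$ in $\mathcal G(\beta,\gamma)$ is its norm closure there.\<close>

definition test_space0 ::
  "'a measure \<Rightarrow> ('a \<Rightarrow> 'a \<Rightarrow> real) \<Rightarrow> real \<Rightarrow> 'a \<Rightarrow> real \<Rightarrow> real \<Rightarrow> real \<Rightarrow> ('a \<Rightarrow> complex) set"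
where
  "test_space0 M d A0 x0 \<eta> \<beta> \<gamma> =
     {g \<in> test_space M d A0 x0 \<beta> \<gamma>.
        \<forall>\<epsilon>>0. \<exists>h\<in>test_space M d A0 x0 \<eta> \<eta>. test_norm M d A0 x0 \<beta> \<gamma> (\<lambda>x. g x - h x) < \<epsilon>}"

text \<open>Only the values of a distribution on \<open>test_space0\<close> are relevant.\<close>

definition distributions ::
  "'a measure \<Rightarrow> ('a \<Rightarrow> 'a \<Rightarrow> real) \<Rightarrow> real \<Rightarrow> 'a \<Rightarrow> real \<Rightarrow> real \<Rightarrow> real \<Rightarrow> (('a \<Rightarrow> complex) \<Rightarrow> complex) set"
where
  "distributions M d A0 x0 \<eta> \<beta> \<gamma> =
     (let G = test_space0 M d A0 x0 \<eta> \<beta> \<gamma> in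
      {f. (\<forall>g\<in>G. \<forall>h\<in>G. f (\<lambda>x. g x + h x) = f g + f h) \<and>
          (\<forall>c. \<forall>g\<in>G. f (\<lambda>x. c * g x) = c * f g) \<and>
          (\<exists>B. \<forall>g\<in>G. cmod (f g) \<le> B * test_norm M d A0 x0 \<beta> \<gamma> g)})"

definition dist_op ::
  "(nat \<Rightarrow> 'a \<Rightarrow> 'a \<Rightarrow> complex) \<Rightarrow> (('a \<Rightarrow> complex) \<Rightarrow> complex) \<Rightarrow> nat \<Rightarrow> 'a \<Rightarrow> complex"
where
  "dist_op Q f k x = f (\<lambda>y. Q k x y)"

section \<open>The inhomogeneous discrete reproducing formula\<close>

definition decay_bound ::
  "'a measure \<Rightarrow> ('a \<Rightarrow> 'a \<Rightarrow> real) \<Rightarrow> real \<Rightarrow> real \<Rightarrow> nat \<Rightarrow> 'a \<Rightarrow> 'a \<Rightarrow> real"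
where
  "decay_bound M d \<delta> \<gamma> k x y =
     1 / (vol M d (\<delta> ^ k) x + vol2 M d x y) * (\<delta> ^ k / (\<delta> ^ k + d x y)) powr \<gamma>"

text \<open>
  The summand of the formula with index \<open>(k, \<alpha>, m)\<close>, paired with the test function \<open>\<phi>\<close>;
  \<open>T k\<close> stands for $Q_k f$, \<open>K\<close> for the kernels $\widetilde Q_k$, and \<open>u\<close> for the chosen points
  $y^{k,m}_\alpha$.
\<close>

definition crf_summand ::
  "'a measure \<Rightarrow> (int \<Rightarrow> 'i \<Rightarrow> nat \<Rightarrow> 'a set) \<Rightarrow> (nat \<Rightarrow> 'i \<Rightarrow> nat \<Rightarrow> 'a) \<Rightarrow> nat \<Rightarrow>
    (nat \<Rightarrow> 'a \<Rightarrow> complex) \<Rightarrow> (nat \<Rightarrow> 'a \<Rightarrow> 'a \<Rightarrow> complex) \<Rightarrow> ('a \<Rightarrow> complex) \<Rightarrow>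
    nat \<Rightarrow> 'i \<Rightarrow> nat \<Rightarrow> complex"
where
  "crf_summand M sub u N T K \<phi> k \<alpha> m =
     (let E = sub (int k) \<alpha> m in
      if k = 0 then (\<integral>x. (LINT y:E|M. K 0 x y) * \<phi> x \<partial>M) * mean M E (T 0)
      else complex_of_real (measure M E) * (\<integral>x. K k x (u k \<alpha> m) * \<phi> x \<partial>M) *
             (if k \<le> N then mean M E (T k) else T k (u k \<alpha> m)))"

text \<open>
  \<open>N\<close> is an integer for which the reproducing formula associated with \<open>Q\<close> holds, with exponents
  \<open>\<beta>\<close> and \<open>\<gamma>\<close>; the constant \<open>C\<close> does not depend on the points \<open>u\<close>.  Convergence in the space of distributions is weak-* convergence: unconditional in \<open>(\<alpha>, m)\<close> for each \<open>k\<close>, and of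
  partial sums in \<open>k\<close>.
\<close>

definition crf_integer ::
  "'a measure \<Rightarrow> ('a \<Rightarrow> 'a \<Rightarrow> real) \<Rightarrow> real \<Rightarrow> 'a \<Rightarrow> real \<Rightarrow> (int \<Rightarrow> 'i set) \<Rightarrow> (int \<Rightarrow> 'i \<Rightarrow> nat) \<Rightarrow>
    (int \<Rightarrow> 'i \<Rightarrow> nat \<Rightarrow> 'a set) \<Rightarrow> real \<Rightarrow> real \<Rightarrow> real \<Rightarrow> (nat \<Rightarrow> 'a \<Rightarrow> 'a \<Rightarrow> complex) \<Rightarrow>
    nat \<Rightarrow> bool"
where
  "crf_integer M d A0 x0 \<delta> A cnt sub \<eta> \<beta> \<gamma> Q N \<longleftrightarrow>
     1 \<le> N \<and>
     (\<exists>C>0.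
       \<forall>u. (\<forall>k. \<forall>\<alpha>\<in>A (int k). \<forall>m\<in>{1..cnt (int k) \<alpha>}. u k \<alpha> m \<in> sub (int k) \<alpha> m) \<longrightarrow>
       (\<exists>K.
         (\<forall>k. L2_integral_operator M (K k)) \<and>
         (\<forall>k x y. cmod (K k x y) \<le> C * decay_bound M d \<delta> \<gamma> k x y) \<and>
         (\<forall>k x x' y. d x x' \<le> (\<delta> ^ k + d x y) / (2 * A0) \<longrightarrow>
            cmod (K k x y - K k x' y)
              \<le> C * (d x x' / (\<delta> ^ k + d x y)) powr \<beta> * decay_bound M d \<delta> \<gamma> k x y) \<and>
         (\<forall>k x. (\<integral>y. K k x y \<partial>M) = (if k \<le> N then 1 else 0) \<and>
                (\<integral>y. K k y x \<partial>M) = (if k \<le> N then 1 else 0)) \<and>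
         (\<forall>f\<in>distributions M d A0 x0 \<eta> \<beta> \<gamma>. \<forall>\<phi>\<in>test_space0 M d A0 x0 \<eta> \<beta> \<gamma>.
            let I = (\<lambda>k. SIGMA \<alpha>:A (int k). {1..cnt (int k) \<alpha>});
                t = (\<lambda>k (\<alpha>, m). crf_summand M sub u N (dist_op Q f) K \<phi> k \<alpha> m)
            in (\<forall>k. t k summable_on I k) \<and> (\<lambda>k. infsum (t k) (I k)) sums f \<phi>)))"

section \<open>The quantity to be compared\<close>

definition crit_index :: "real \<Rightarrow> real \<Rightarrow> real \<Rightarrow> real" where
  "crit_index \<omega> s t = max (\<omega> / (\<omega> + t)) (\<omega> / (\<omega> + t + s))"

definition ennreal_powr :: "ennreal \<Rightarrow> real \<Rightarrow> ennreal" where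
  "ennreal_powr x p = (if x = top then top else ennreal (enn2real x powr p))"

text \<open>
  The normalised mixed \<open>L\<^sup>q(\<ell>\<^sup>q)\<close> quasi-norm over \<open>E\<close> of the sequence \<open>\<delta>\<^bsup>-ks\<^esup> T k\<close>, \<open>k \<ge> l\<close>;
  for \<open>q = \<infinity>\<close> both the integral and the sum become (essential) suprema.
\<close>

definition local_norm ::
  "'a measure \<Rightarrow> real \<Rightarrow> real \<Rightarrow> ereal \<Rightarrow> (nat \<Rightarrow> 'a \<Rightarrow> complex) \<Rightarrow> nat \<Rightarrow> 'a set \<Rightarrow> ennreal"
where
  "local_norm M \<delta> s q T l E =
     (if q = \<infinity> then
        esssup (restrict_space M E)
          (\<lambda>x. SUP k\<in>{l..}. ennreal (\<delta> powr (- real k * s) * cmod (T k x)))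
      else let r = real_of_ereal q in
        ennreal_powr
          ((\<integral>\<^sup>+x\<in>E. (\<Sum>i. let k = l + i in
               ennreal (\<delta> powr (- real k * s * r) * cmod (T k x) powr r)) \<partial>M) / emeasure M E)
          (1 / r))"

definition F_infty_norm ::
  "'a measure \<Rightarrow> real \<Rightarrow> (int \<Rightarrow> 'i set) \<Rightarrow> (int \<Rightarrow> 'i \<Rightarrow> 'a set) \<Rightarrow> (int \<Rightarrow> 'i \<Rightarrow> nat) \<Rightarrow>
    (int \<Rightarrow> 'i \<Rightarrow> nat \<Rightarrow> 'a set) \<Rightarrow> real \<Rightarrow> ereal \<Rightarrow> nat \<Rightarrow> (nat \<Rightarrow> 'a \<Rightarrow> complex) \<Rightarrow> ennreal"
where
  "F_infty_norm M \<delta> A cube cnt sub s q N T =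
     max (SUP k\<in>{0..N}. SUP \<alpha>\<in>A (int k). SUP m\<in>{1..cnt (int k) \<alpha>}.
            (\<integral>\<^sup>+x\<in>sub (int k) \<alpha> m. ennreal (cmod (T k x)) \<partial>M) / emeasure M (sub (int k) \<alpha> m))
         (SUP l\<in>{N<..}. SUP \<alpha>\<in>A (int l). local_norm M \<delta> s q T l (cube (int l) \<alpha>))"

end

theory Submission
  imports Defs
begin

text \<open>
  Only the reproducing formula for \<open>P\<close> is needed to bound the norm of \<open>(Q_k f)\<close> by that of
  \<open>(P_k f)\<close>.  Testing the formula with $Q_k(x,\cdot)$ and using the cancellation of $Q_k$ (if
  $k' \le k$) or of $\widetilde P_{k'}$ (if $k' > k$) gives, for every $\sigma < \beta\wedge\gamma$,
  \[ |Q_kf(x)| \le C \sum_{k'} \delta^{|k-k'|\sigma} \sum_{E} \mu(E)\,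
     \frac{1}{V_{\delta^{k\wedge k'}+d(x,u_E)}(x)}
     \Big(\frac{\delta^{k\wedge k'}}{\delta^{k\wedge k'}+d(x,u_E)}\Big)^{\gamma} t_E, \]
  where $E$ runs over the subcubes of level $k'$ and $t_E$ is a mean of $P_{k'}f$ or its modulus at
  a point $u_E$, which is chosen as a near minimiser of $|P_{k'}f|$ on $E$.  The norm of \<open>(P_k f)\<close>
  bounds $\delta^{-k's}t_E$ uniformly; this settles $q = \infty$ and the low levels.
  For $q < \infty$ and a cube of level $l$, the subcubes far from the cube or of level below $l$ are
  again controlled by the uniform bound, with geometric decay in $k - l$.  For the subcubes near it
  one takes the $q$-th power inside the sum (by convexity if $q \ge 1$, by subadditivity if $q < 1$),
  integrates the kernels, and sums over $k$; the remaining sum of $\mu(E)(\delta^{-k's}t_E)^q$ is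
  at most the integral of $\sum_{k'}(\delta^{-k's}|P_{k'}f|)^q$ over the union of neighbouring cubes.
  The condition on $q$ is what makes the kernel integrals and the sum over $k$ converge; being open,
  it survives the passage from $\beta\wedge\gamma$ to $\sigma$.
\<close>


section \<open>Volume growth and polynomial kernels\<close>

context homogeneous_type
begin

text \<open>The order of quantifiers shapes the development. The near minimisers depend on f, hence
  so do the kernels of the reproducing formula; the estimates survive because the constant in
  \<open>crf_integer\<close> is fixed before the points. So every constant stands in front of all
  kernels, points and functions. A near minimiser lets the single value t_E be compared with |P_k'f|
  at every point of E, so that a discrete sum turns back into an integral.

  The strict inequality \<sigma> < \<gamma> comes from k' > k: the share \<sigma> of the spatial
  decay \<gamma> of the reproducing kernel is spent on \<delta>^(\<sigma>(k'-k)), and the rest must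
  still be integrable.

  Inner and outer exponents are both q, so Tonelli's theorem takes the place of maximal functions:
  it is enough to integrate the power min(q,1) of each kernel. The two inequalities behind the
  critical index act separately: the one without s makes this integral converge, the one with s
  keeps the sum over k < k' bounded.\<close>

definition hdim :: real where "hdim = log 2 Cmu"

abbreviation V :: "real \<Rightarrow> 'a \<Rightarrow> real" where "V r x \<equiv> vol M d r x"

lemma d_self [simp]: "d x x = 0"
  by (simp add: dist_eq_0_iff)

section \<open>Balls, doubling and volume growth\<close>

lemma qball_nonpos: "r \<le> 0 \<Longrightarrow> qball d x r = {}"
  using dist_nonneg[of x] by (auto simp: qball_def not_less intro: order_trans)

lemma qball_sets [measurable, simp]: "qball d x r \<in> sets M"
  by (cases "0 < r") (auto simp: ball_measurable qball_nonpos)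

lemma emeasure_qball_finite: "emeasure M (qball d x r) < \<infinity>"
  using ball_finite[of r x] by (cases "0 < r") (auto simp: qball_nonpos)

lemma emeasure_qball: "emeasure M (qball d x r) = ennreal (V r x)"
  unfolding vol_def using emeasure_qball_finite[of x r] by (intro emeasure_eq_ennreal_measure) auto

lemma vol_pos: "0 < r \<Longrightarrow> 0 < V r x"
  using ball_pos[of r x] emeasure_qball[of x r] by (metis ennreal_less_zero_iff)

lemma vol_nonneg [simp]: "0 \<le> V r x"
  by (simp add: vol_def)

lemma vol_subset: "qball d x r \<subseteq> qball d y t \<Longrightarrow> V r x \<le> V t y"
  using emeasure_mono[of "qball d x r" "qball d y t" M] by (simp add: emeasure_qball)

lemma vol_mono: "r \<le> t \<Longrightarrow> V r x \<le> V t x"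
  by (rule vol_subset) (auto simp: qball_def)

lemma A0_pos: "0 < A0"
  using A0_ge_1 by simp

lemma Cmu_ge_1: "1 \<le> Cmu"
proof -
  have "V 1 undefined \<le> V 2 undefined" by (rule vol_mono) simp
  also have "\<dots> \<le> Cmu * V 1 undefined"
    using doubling[of 1 undefined] by (simp add: vol_def)
  finally show ?thesis using vol_pos[of 1 undefined] by simp
qed

lemma hdim_nonneg: "0 \<le> hdim"
  using Cmu_ge_1 by (simp add: hdim_def)

lemma two_powr_hdim: "2 powr hdim = Cmu"
  using Cmu_ge_1 by (simp add: hdim_def)

lemma vol_two_power: "0 < r \<Longrightarrow> V (2 ^ n * r) x \<le> (2 powr hdim) ^ n * V r x"
proof (induction n)
  case (Suc n)
  have "V (2 ^ Suc n * r) x \<le> Cmu * V (2 ^ n * r) x"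
    using doubling[of "2 ^ n * r" x] Suc.prems by (simp add: vol_def mult.assoc)
  also have "\<dots> \<le> Cmu * (Cmu ^ n * V r x)"
    using Suc Cmu_ge_1 by (intro mult_left_mono) (auto simp: two_powr_hdim)
  finally show ?case by (simp add: two_powr_hdim mult.assoc)
qed simp

text \<open>The factor \<open>Cmu\<close> in front pays for rounding log_2 t up to a whole number of
  doublings.\<close>

lemma vol_scale:
  assumes "0 < r" "1 \<le> t"
  shows "V (t * r) x \<le> Cmu * t powr hdim * V r x"
proof -
  define n where "n = nat \<lceil>log 2 t\<rceil>"
  have l: "0 \<le> log 2 t" using assms by simp
  have n1: "log 2 t \<le> real n" and n2: "real n \<le> log 2 t + 1"
    using l unfolding n_def by linarith+
  have "t = 2 powr (log 2 t)" using assms by simp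
  also have "\<dots> \<le> 2 powr real n" using n1 by simp
  finally have "t \<le> 2 ^ n" by (simp add: powr_realpow)
  then have "V (t * r) x \<le> V (2 ^ n * r) x"
    using assms by (intro vol_mono mult_right_mono) auto
  also have "\<dots> \<le> (2 powr hdim) ^ n * V r x" by (rule vol_two_power) fact
  also have "(2 powr hdim) ^ n = 2 powr (hdim * real n)"
    by (simp add: powr_powr flip: powr_realpow)
  also have "\<dots> \<le> 2 powr (hdim * (log 2 t + 1))"
    using n2 hdim_nonneg by (simp add: mult_left_mono)
  also have "\<dots> = Cmu * t powr hdim"
  proof -
    have "t powr hdim = (2 powr log 2 t) powr hdim" using assms by simp
    then show ?thesis
      by (simp add: powr_powr powr_add two_powr_hdim distrib_left mult.commute)
  qed
  finally show ?thesis using assms by (simp add: mult_right_mono)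
qed

lemma vol_le_scale:
  assumes "0 < r" "1 \<le> t" "r' \<le> t * r"
  shows "V r' x \<le> Cmu * t powr hdim * V r x"
  using vol_mono[OF assms(3), of x] vol_scale[OF assms(1,2), of x] by linarith

lemma vol_shift: "V r y \<le> V (A0 * (r + d x y)) x"
proof (rule vol_subset, unfold qball_def, rule subsetI, rule CollectI)
  fix w assume "w \<in> {w. d y w < r}"
  then have "A0 * d y w < A0 * r" using A0_pos by simp
  then show "d x w < A0 * (r + d x y)"
    using quasi_triangle[of x w y] by (simp add: distrib_left)
qed

text \<open>
  Using $V_{\rho + d(x,y)}(x)$ instead of $V_\rho(x) + V(x,y)$ makes the kernel a decreasing
  function of $d(x,y)$.  It is measurable in \<open>y\<close>; since $x \mapsto V_r(x)$ need not be
  measurable, integrals in the first variable always go through \<open>pker_sym\<close>.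
\<close>

definition pker :: "real \<Rightarrow> real \<Rightarrow> 'a \<Rightarrow> 'a \<Rightarrow> real" where
  "pker g \<rho> x y = (\<rho> / (\<rho> + d x y)) powr g / V (\<rho> + d x y) x"

lemma pker_nonneg [simp]: "0 \<le> pker g \<rho> x y"
  by (simp add: pker_def)

section \<open>Measurability and comparison of the polynomial kernels\<close>

lemma borel_measurable_d [measurable]: "(\<lambda>y. d x y) \<in> borel_measurable M"
proof (rule borel_measurableI_less)
  fix a :: real
  show "{w \<in> space M. d x w < a} \<in> sets M"
    using qball_sets[of x a] by (simp add: qball_def space_UNIV)
qed

text \<open>Monotonicity in the radius is the source of measurability: composed with the distance to
  x, it covers the denominator of \<open>pker\<close> as a function of the second variable.\<close>

lemma borel_measurable_vol_comp: "(\<lambda>r. V r x) \<in> borel_measurable borel"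
  by (rule borel_measurable_mono) (auto simp: mono_def vol_mono)

lemma borel_measurable_pker [measurable]: "(\<lambda>y. pker g \<rho> x y) \<in> borel_measurable M"
proof -
  have [measurable]: "(\<lambda>y. V (\<rho> + d x y) x) \<in> borel_measurable M"
    by (rule measurable_compose[OF _ borel_measurable_vol_comp[of x]]) measurable
  show ?thesis unfolding pker_def by measurable
qed

text \<open>\<rho> + d(x,y) is at most twice the larger of the two numbers, so a single doubling
  bounds the volume in \<open>pker\<close> by one of the two volumes in
  \<open>decay_bound\<close>.\<close>

lemma decay_le_pker: "0 < \<delta> \<Longrightarrow> decay_bound M d \<delta> g k x y \<le> Cmu * pker g (\<delta> ^ k) x y"
proof -
  assume "0 < \<delta>"
  define \<rho> where "\<rho> = \<delta> ^ k"
  have \<rho>: "0 < \<rho>" using \<open>0 < \<delta>\<close> by (simp add: \<rho>_def)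
  have v2: "vol2 M d x y = V (d x y) x" by (simp add: vol2_def vol_def)
  have "V (\<rho> + d x y) x \<le> Cmu * (V \<rho> x + V (d x y) x)"
  proof (cases "d x y \<le> \<rho>")
    case True
    then have "V (\<rho> + d x y) x \<le> V (2 * \<rho>) x" by (intro vol_mono) simp
    also have "\<dots> \<le> Cmu * V \<rho> x" using doubling \<rho> by (simp add: vol_def)
    finally show ?thesis using Cmu_ge_1 by (smt (verit) mult_left_mono vol_nonneg)
  next
    case False
    then have "V (\<rho> + d x y) x \<le> V (2 * d x y) x" by (intro vol_mono) simp
    also have "\<dots> \<le> Cmu * V (d x y) x" using doubling False \<rho> by (simp add: vol_def)
    finally show ?thesis using Cmu_ge_1 by (smt (verit) mult_left_mono vol_nonneg)
  qed
  moreover have "0 < V (\<rho> + d x y) x" "0 < V \<rho> x"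
    using \<rho> dist_nonneg[of x y] by (auto intro!: vol_pos add_pos_nonneg)
  ultimately have "1 / (V \<rho> x + V (d x y) x) \<le> Cmu / V (\<rho> + d x y) x"
    using Cmu_ge_1 by (simp add: divide_simps add_pos_nonneg add_nonneg_eq_0_iff mult.commute)
  then have "1 / (V \<rho> x + V (d x y) x) * (\<rho> / (\<rho> + d x y)) powr g
      \<le> Cmu / V (\<rho> + d x y) x * (\<rho> / (\<rho> + d x y)) powr g"
    by (rule mult_right_mono) simp
  then show ?thesis
    by (simp add: decay_bound_def pker_def v2 \<rho>_def)
qed

text \<open>The common source of several comparisons below. If \<rho> + d(x,y) is at least D/t, the
  kernel can be read at radius D: volume growth pays for the denominator, and \<rho>/(\<rho>+d) is
  traded for m/D with a larger numerator m \<le> D. As m/D \<le> 1, the exponent may drop from G to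
  g.\<close>

lemma pker_bound:
  assumes "0 < \<rho>" "\<rho> \<le> m" "m \<le> D" "1 \<le> t" "D \<le> t * (\<rho> + d x y)" "0 \<le> g" "g \<le> G"
  shows "pker G \<rho> x y \<le> Cmu * t powr hdim * t powr G * ((m / D) powr g / V D x)"
proof -
  have pos: "0 < \<rho> + d x y" "0 < D" "0 < m"
    using assms dist_nonneg[of x y] by linarith+
  have vD: "0 < V D x" "0 < V (\<rho> + d x y) x" using pos by (auto intro: vol_pos)
  have "V D x \<le> Cmu * t powr hdim * V (\<rho> + d x y) x"
    by (rule vol_le_scale) (use assms pos in auto)
  then have 1: "1 / V (\<rho> + d x y) x \<le> Cmu * t powr hdim * (1 / V D x)"
    using vD by (simp add: field_simps)
  have "\<rho> / (\<rho> + d x y) \<le> t * (m / D)"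
  proof -
    have "\<rho> * D \<le> m * (t * (\<rho> + d x y))"
      by (rule mult_mono) (use assms pos in auto)
    then show ?thesis using pos by (simp add: field_simps)
  qed
  then have "(\<rho> / (\<rho> + d x y)) powr G \<le> (t * (m / D)) powr G"
    using assms pos by (intro powr_mono2) auto
  also have "\<dots> = t powr G * (m / D) powr G"
    by (rule powr_mult)
  also have "\<dots> \<le> t powr G * (m / D) powr g"
    using assms pos by (intro mult_left_mono powr_mono') auto
  finally have 2: "(\<rho> / (\<rho> + d x y)) powr G \<le> t powr G * (m / D) powr g" .
  have "pker G \<rho> x y = (\<rho> / (\<rho> + d x y)) powr G * (1 / V (\<rho> + d x y) x)"
    by (simp add: pker_def)
  also have "\<dots> \<le> (t powr G * (m / D) powr g) * (Cmu * t powr hdim * (1 / V D x))"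
    by (intro mult_mono 1 2) (use vD in auto)
  finally show ?thesis by (simp add: mult_ac)
qed

text \<open>Mostly used for two points y, y' of one subcube, whose distances to x differ little on
  the scale \<rho>.\<close>

lemma pker_compare:
  assumes "0 < \<rho>" "1 \<le> t" "\<rho> + d x y' \<le> t * (\<rho> + d x y)" "0 \<le> g"
  shows "pker g \<rho> x y \<le> Cmu * t powr hdim * t powr g * pker g \<rho> x y'"
  using pker_bound[of \<rho> \<rho> "\<rho> + d x y'" t x y g g] assms dist_nonneg[of x y']
  by (simp add: pker_def)

lemma pker_mono:
  assumes "0 < \<rho>" "g \<le> G"
  shows "pker G \<rho> x y \<le> pker g \<rho> x y"
  unfolding pker_def using assms dist_nonneg[of x y]
  by (intro divide_right_mono powr_mono') auto

lemma pker_add: "pker (g + h) \<rho> x y = (\<rho> / (\<rho> + d x y)) powr g * pker h \<rho> x y"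
  by (simp add: pker_def powr_add)

text \<open>The ball about x of radius \<rho> + d(x,y) lies in the ball about y of 2 A0 times that
  radius.\<close>

lemma vol_comp_swap:
  assumes "0 < \<rho>"
  shows "V (\<rho> + d x y) x \<le> Cmu * (2 * A0) powr hdim * V (\<rho> + d x y) y"
proof -
  have "V (\<rho> + d x y) x \<le> V (A0 * (\<rho> + d x y + d y x)) y"
    by (rule vol_shift)
  also have "\<dots> \<le> Cmu * (2 * A0) powr hdim * V (\<rho> + d x y) y"
  proof (rule vol_le_scale)
    show "0 < \<rho> + d x y" using assms dist_nonneg[of x y] by linarith
    show "A0 * (\<rho> + d x y + d y x) \<le> 2 * A0 * (\<rho> + d x y)"
      using A0_pos assms by (simp add: dist_sym[of y x] algebra_simps)
  qed (use A0_ge_1 in auto)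
  finally show ?thesis .
qed

lemma pker_sym:
  assumes "0 < \<rho>"
  shows "pker g \<rho> x y \<le> Cmu * (2 * A0) powr hdim * pker g \<rho> y x"
proof -
  have pos: "0 < \<rho> + d x y" using assms dist_nonneg[of x y] by linarith
  have "V (\<rho> + d x y) y \<le> Cmu * (2 * A0) powr hdim * V (\<rho> + d x y) x"
    using vol_comp_swap[OF assms, of y x] by (simp add: dist_sym)
  then have "1 / V (\<rho> + d x y) x \<le> Cmu * (2 * A0) powr hdim * (1 / V (\<rho> + d x y) y)"
    using vol_pos[OF pos, of x] vol_pos[OF pos, of y] by (simp add: field_simps)
  then have "(\<rho> / (\<rho> + d x y)) powr g * (1 / V (\<rho> + d x y) x)
     \<le> (\<rho> / (\<rho> + d x y)) powr g * (Cmu * (2 * A0) powr hdim * (1 / V (\<rho> + d x y) y))"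
    by (rule mult_left_mono) simp
  then show ?thesis by (simp add: pker_def dist_sym[of y x] mult_ac)
qed

text \<open>Cut the space into annuli 2^n \<rho> \<le> \<rho> + d < 2^(n+1) \<rho>. On the n-th one
  the p-th power of the kernel is at most 2^(-ngp) V(2^n \<rho>)^(-p), and its measure is at most
  Cmu V(2^n \<rho>). Volume growth turns the product into V(\<rho>)^(1-p) times the n-th power of
  2^(hdim (1-p) - gp), a number less than 1 precisely under the last hypothesis.\<close>

lemma pker_powr_integral:
  assumes "0 < p" "p \<le> 1" "0 < g" "hdim < p * (hdim + g)"
  obtains C where "0 < C" "\<And>\<rho> x. 0 < \<rho> \<Longrightarrow>
    (\<integral>\<^sup>+y. ennreal (pker g \<rho> x y powr p) \<partial>M) \<le> ennreal (C * V \<rho> x powr (1 - p))"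
proof -
  define b where "b = 2 powr (hdim * (1 - p) - g * p)"
  have b: "0 < b" "b < 1"
    using assms by (auto simp: b_def algebra_simps powr_less_one)
  have bs: "summable (\<lambda>n. Cmu * b ^ n)"
    using b by (intro summable_mult summable_geometric) auto
  show ?thesis
  proof (rule that)
    show "0 < Cmu * (1 / (1 - b))" using b Cmu_ge_1 by simp
    fix \<rho> :: real and x assume \<rho>: "0 < \<rho>"
    define c where "c n = 2 powr (- (real n * g * p)) / V (2 ^ n * \<rho>) x powr p" for n :: nat
    have c0: "0 \<le> c n" for n by (simp add: c_def)
    have pt: "ennreal (pker g \<rho> x y powr p) \<le> (\<Sum>n. ennreal (c n) * indicator (qball d x (2 ^ Suc n * \<rho>)) y)" for y
    proof -
      \<comment> \<open>The annulus is read off from \<rho> + d rather than d, so that n = 0 takes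
        in the ball of radius \<rho>.\<close>
      define n where "n = nat \<lfloor>log 2 ((\<rho> + d x y) / \<rho>)\<rfloor>"
      have ge1: "1 \<le> (\<rho> + d x y) / \<rho>" using \<rho> dist_nonneg[of x y] by simp
      have l: "0 \<le> log 2 ((\<rho> + d x y) / \<rho>)" using ge1 by simp
      have n: "real n \<le> log 2 ((\<rho> + d x y) / \<rho>)" "log 2 ((\<rho> + d x y) / \<rho>) < real (Suc n)"
        using l unfolding n_def by linarith+
      have "2 powr real n \<le> (\<rho> + d x y) / \<rho>"
        using n(1) ge1 by (subst (asm) le_log_iff) auto
      then have lo: "2 ^ n * \<rho> \<le> \<rho> + d x y"
        using \<rho> by (simp add: powr_realpow field_simps)
      have "(\<rho> + d x y) / \<rho> < 2 powr real (Suc n)"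
        using n(2) ge1 by (subst (asm) log_less_iff) auto
      then have hi: "d x y < 2 ^ Suc n * \<rho>"
        using \<rho> by (simp add: powr_realpow field_simps del: power_Suc of_nat_Suc)
      have v: "0 < V (2 ^ n * \<rho>) x" using \<rho> by (intro vol_pos) simp
      have "pker g \<rho> x y \<le> (2 powr - real n) powr g / V (2 ^ n * \<rho>) x"
        unfolding pker_def
      proof (intro frac_le powr_mono2)
        show "\<rho> / (\<rho> + d x y) \<le> 2 powr - real n"
          using lo \<rho> ge1 dist_nonneg[of x y] by (simp add: powr_minus powr_realpow field_simps)
        show "V (2 ^ n * \<rho>) x \<le> V (\<rho> + d x y) x" using lo by (rule vol_mono)
      qed (use assms \<rho> v dist_nonneg[of x y] in auto)
      then have "pker g \<rho> x y powr p \<le> ((2 powr - real n) powr g / V (2 ^ n * \<rho>) x) powr p"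
        using assms by (intro powr_mono2) auto
      also have "\<dots> = c n"
        using v by (simp add: c_def powr_divide powr_powr)
      finally have "ennreal (pker g \<rho> x y powr p) \<le> ennreal (c n) * indicator (qball d x (2 ^ Suc n * \<rho>)) y"
        using hi by (simp add: ennreal_leI qball_def)
      also have "\<dots> \<le> (\<Sum>n. ennreal (c n) * indicator (qball d x (2 ^ Suc n * \<rho>)) y)"
        using sum_le_suminf[of "\<lambda>n. ennreal (c n) * indicator (qball d x (2 ^ Suc n * \<rho>)) y" "{n}"]
        by (simp del: power_Suc sum_mult_indicator)
      finally show ?thesis .
    qed
    have summand: "ennreal (c n) * ennreal (V (2 ^ Suc n * \<rho>) x) \<le> ennreal (V \<rho> x powr (1 - p) * (Cmu * b ^ n))" for n
    proof -
      have v: "0 < V (2 ^ n * \<rho>) x" "0 < V \<rho> x" using \<rho> by (auto intro!: vol_pos)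
      have "V (2 ^ Suc n * \<rho>) x \<le> Cmu * V (2 ^ n * \<rho>) x"
        using doubling[of "2 ^ n * \<rho>" x] \<rho> by (simp add: vol_def mult.assoc)
      then have "c n * V (2 ^ Suc n * \<rho>) x \<le> c n * (Cmu * V (2 ^ n * \<rho>) x)"
        by (intro mult_left_mono c0)
      also have "\<dots> = Cmu * 2 powr (- (real n * g * p)) * V (2 ^ n * \<rho>) x powr (1 - p)"
        using v by (simp add: c_def powr_diff)
      \<comment> \<open>The exponent 1 - p is nonnegative, so an upper bound for the volume may be
        inserted.\<close>
      also have "\<dots> \<le> Cmu * 2 powr (- (real n * g * p)) * ((2 powr hdim) ^ n * V \<rho> x) powr (1 - p)"
        using assms Cmu_ge_1 \<rho> by (intro mult_left_mono powr_mono2 vol_two_power) auto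
      also have "\<dots> = Cmu * V \<rho> x powr (1 - p) * 2 powr (- (real n * g * p) + hdim * real n * (1 - p))"
        using v unfolding powr_add
        by (simp add: powr_mult powr_powr flip: powr_realpow)
      also have "- (real n * g * p) + hdim * real n * (1 - p) = (hdim * (1 - p) - g * p) * real n"
        by (simp add: algebra_simps)
      also have "2 powr \<dots> = b ^ n"
        by (simp add: b_def powr_powr flip: powr_realpow)
      finally show ?thesis
        by (subst ennreal_mult[symmetric]) (auto simp: c0 mult_ac intro!: ennreal_leI)
    qed
    have "(\<integral>\<^sup>+y. ennreal (pker g \<rho> x y powr p) \<partial>M)
        \<le> (\<integral>\<^sup>+y. (\<Sum>n. ennreal (c n) * indicator (qball d x (2 ^ Suc n * \<rho>)) y) \<partial>M)"
      by (intro nn_integral_mono pt)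
    also have "\<dots> = (\<Sum>n. ennreal (c n) * ennreal (V (2 ^ Suc n * \<rho>) x))"
      by (subst nn_integral_suminf) (auto simp: nn_integral_cmult_indicator emeasure_qball)
    also have "\<dots> \<le> (\<Sum>n. ennreal (V \<rho> x powr (1 - p) * (Cmu * b ^ n)))"
      by (intro suminf_le summand) auto
    also have "\<dots> = ennreal (\<Sum>n. V \<rho> x powr (1 - p) * (Cmu * b ^ n))"
      using b Cmu_ge_1 by (intro suminf_ennreal2 summable_mult bs) auto
    also have "(\<Sum>n. V \<rho> x powr (1 - p) * (Cmu * b ^ n)) = Cmu * (1 / (1 - b)) * V \<rho> x powr (1 - p)"
      using b by (subst suminf_mult) (auto simp: suminf_geometric suminf_mult bs summable_mult)
    finally show "(\<integral>\<^sup>+y. ennreal (pker g \<rho> x y powr p) \<partial>M)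
      \<le> ennreal (Cmu * (1 / (1 - b)) * V \<rho> x powr (1 - p))" .
  qed
qed

text \<open>The case p = 1, in which the condition on the exponents reduces to 0 < g.\<close>

lemma pker_integral:
  assumes "0 < g"
  obtains C where "0 < C" "\<And>\<rho> x. 0 < \<rho> \<Longrightarrow> (\<integral>\<^sup>+y. ennreal (pker g \<rho> x y) \<partial>M) \<le> ennreal C"
proof -
  obtain C where C: "0 < C" "\<And>\<rho> x. 0 < \<rho> \<Longrightarrow>
    (\<integral>\<^sup>+y. ennreal (pker g \<rho> x y powr 1) \<partial>M) \<le> ennreal (C * V \<rho> x powr (1 - 1))"
    using pker_powr_integral[of 1 g] assms hdim_nonneg by auto
  show ?thesis
  proof (rule that[OF C(1)])
    fix \<rho> :: real and x assume "0 < \<rho>"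
    then show "(\<integral>\<^sup>+y. ennreal (pker g \<rho> x y) \<partial>M) \<le> ennreal C"
      using C(2)[of \<rho> x] vol_pos[of \<rho> x] by simp
  qed
qed

text \<open>By the quasi-triangle inequality at least one of \<rho> + d(x,y) and \<rho>' + d(u,y) is
  comparable to max(\<rho>,\<rho>') + d(x,u). The kernel with that argument is bounded by the
  composed kernel, and the other one is kept as an integrable factor. Adding the two possibilities
  avoids splitting the domain of y.\<close>

lemma pker_compose_pointwise:
  assumes "0 < g" "g \<le> G"
  obtains C where "0 < C" "\<And>\<rho> \<rho>' x y u. 0 < \<rho> \<Longrightarrow> 0 < \<rho>' \<Longrightarrow>
     pker G \<rho> x y * pker g \<rho>' u y
       \<le> C * pker g (max \<rho> \<rho>') x u * (pker G \<rho> x y + pker g \<rho>' u y)"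
proof -
  define t where "t = 2 * A0"
  have t: "1 \<le> t" "0 < t" using A0_ge_1 by (auto simp: t_def)
  define C where "C = (Cmu * t powr hdim) * (Cmu * t powr hdim) * t powr G"
  have C1: "Cmu * t powr hdim * t powr G \<le> C"
  proof -
    have "1 \<le> Cmu * t powr hdim"
      using Cmu_ge_1 t hdim_nonneg mult_mono[of 1 Cmu 1 "t powr hdim"] by (simp add: ge_one_powr_ge_zero)
    then have "1 * (Cmu * t powr hdim * t powr G) \<le> (Cmu * t powr hdim) * (Cmu * t powr hdim * t powr G)"
      using Cmu_ge_1 by (intro mult_right_mono) auto
    then show ?thesis unfolding C_def by (simp add: mult.assoc)
  qed
  show ?thesis
  proof (rule that)
    show "0 < C" using t Cmu_ge_1 by (simp add: C_def)
    fix \<rho> \<rho>' :: real and x y u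
    assume \<rho>: "0 < \<rho>" "0 < \<rho>'"
    define m where "m = max \<rho> \<rho>'"
    define D where "D = m + d x u"
    have mD: "0 < m" "m \<le> D" "\<rho> \<le> m" "\<rho>' \<le> m" "0 < D"
      using \<rho> dist_nonneg[of x u] by (auto simp: m_def D_def)
    have tri: "d x u \<le> A0 * (d x y + d u y)"
      using quasi_triangle[of x u y] by (simp add: dist_sym[of y u])
    \<comment> \<open>Otherwise 2 A0 times the sum of both arguments would be less than 2 D, against
      the quasi-triangle inequality for x, y, u.\<close>
    have "D \<le> t * (\<rho> + d x y) \<or> D \<le> t * (\<rho>' + d u y)"
    proof (rule ccontr)
      assume "\<not> ?thesis"
      then have "2 * D > t * (\<rho> + d x y) + t * (\<rho>' + d u y)" by simp
      also have "t * (\<rho> + d x y) + t * (\<rho>' + d u y) = 2 * (A0 * (\<rho> + \<rho>')) + 2 * (A0 * (d x y + d u y))"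
        by (simp add: t_def algebra_simps)
      finally have "D > A0 * (\<rho> + \<rho>') + A0 * (d x y + d u y)" by simp
      moreover have "m \<le> 1 * (\<rho> + \<rho>')" using \<rho> by (simp add: m_def)
      moreover have "1 * (\<rho> + \<rho>') \<le> A0 * (\<rho> + \<rho>')"
        using \<rho> A0_ge_1 by (intro mult_right_mono) auto
      ultimately show False using tri by (simp add: D_def)
    qed
    then show "pker G \<rho> x y * pker g \<rho>' u y
       \<le> C * pker g (max \<rho> \<rho>') x u * (pker G \<rho> x y + pker g \<rho>' u y)"
    proof
      assume le: "D \<le> t * (\<rho> + d x y)"
      have "pker G \<rho> x y \<le> Cmu * t powr hdim * t powr G * ((m / D) powr g / V D x)"
        by (rule pker_bound) (use le mD t \<rho> assms in auto)
      also have "\<dots> = Cmu * t powr hdim * t powr G * pker g m x u"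
        by (simp add: pker_def D_def)
      also have "\<dots> \<le> C * pker g m x u"
        by (intro mult_right_mono C1) simp
      finally have "pker G \<rho> x y * pker g \<rho>' u y \<le> C * pker g m x u * pker g \<rho>' u y"
        by (intro mult_right_mono) auto
      also have "\<dots> \<le> C * pker g m x u * (pker G \<rho> x y + pker g \<rho>' u y)"
        using Cmu_ge_1 by (intro mult_left_mono) (auto simp: C_def)
      finally show ?thesis by (simp add: m_def)
    next
      assume le: "D \<le> t * (\<rho>' + d u y)"
      have "pker g \<rho>' u y \<le> Cmu * t powr hdim * t powr g * ((m / D) powr g / V D u)"
        by (rule pker_bound) (use le mD t \<rho> assms in auto)
      also have "\<dots> = Cmu * t powr hdim * t powr g * pker g m u x"
        by (simp add: pker_def D_def dist_sym[of u x])
      also have "\<dots> \<le> Cmu * t powr hdim * t powr G * (Cmu * (2 * A0) powr hdim * pker g m x u)"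
        using assms t Cmu_ge_1 mD by (intro mult_mono powr_mono pker_sym) auto
      also have "\<dots> = C * pker g m x u"
        by (simp add: C_def t_def mult_ac)
      finally have "pker G \<rho> x y * pker g \<rho>' u y \<le> pker G \<rho> x y * (C * pker g m x u)"
        by (intro mult_left_mono) auto
      also have "\<dots> = C * pker g m x u * pker G \<rho> x y" by simp
      also have "\<dots> \<le> C * pker g m x u * (pker G \<rho> x y + pker g \<rho>' u y)"
        using Cmu_ge_1 by (intro mult_left_mono) (auto simp: C_def)
      finally show ?thesis by (simp add: m_def)
    qed
  qed
qed

text \<open>Integrating the pointwise bound in y removes the kept kernel; the larger scale and the
  smaller exponent survive.\<close>

lemma pker_compose:
  assumes "0 < g" "g \<le> G"
  obtains C where "0 < C" "\<And>\<rho> \<rho>' x u. 0 < \<rho> \<Longrightarrow> 0 < \<rho>' \<Longrightarrow>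
     (\<integral>\<^sup>+y. ennreal (pker G \<rho> x y * pker g \<rho>' u y) \<partial>M) \<le> ennreal (C * pker g (max \<rho> \<rho>') x u)"
proof -
  obtain C where C: "0 < C" "\<And>\<rho> \<rho>' x y u. 0 < \<rho> \<Longrightarrow> 0 < \<rho>' \<Longrightarrow>
     pker G \<rho> x y * pker g \<rho>' u y
       \<le> C * pker g (max \<rho> \<rho>') x u * (pker G \<rho> x y + pker g \<rho>' u y)"
    using pker_compose_pointwise assms by blast
  obtain C1 where C1: "0 < C1" "\<And>\<rho> x. 0 < \<rho> \<Longrightarrow> (\<integral>\<^sup>+y. ennreal (pker G \<rho> x y) \<partial>M) \<le> ennreal C1"
    using pker_integral[of G] assms by (metis less_le_trans)
  obtain C2 where C2: "0 < C2" "\<And>\<rho> x. 0 < \<rho> \<Longrightarrow> (\<integral>\<^sup>+y. ennreal (pker g \<rho> x y) \<partial>M) \<le> ennreal C2"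
    using pker_integral[of g] assms by metis
  show ?thesis
  proof (rule that)
    show "0 < C * (C1 + C2)" using C C1 C2 by simp
    fix \<rho> \<rho>' :: real and x u
    assume \<rho>: "0 < \<rho>" "0 < \<rho>'"
    let ?P = "pker g (max \<rho> \<rho>') x u"
    have "(\<integral>\<^sup>+y. ennreal (pker G \<rho> x y * pker g \<rho>' u y) \<partial>M)
        \<le> (\<integral>\<^sup>+y. ennreal (C * ?P) * (ennreal (pker G \<rho> x y) + ennreal (pker g \<rho>' u y)) \<partial>M)"
      using C \<rho> by (intro nn_integral_mono)
        (auto simp flip: ennreal_mult ennreal_plus intro!: ennreal_leI)
    also have "\<dots> = ennreal (C * ?P) * ((\<integral>\<^sup>+y. ennreal (pker G \<rho> x y) \<partial>M) + (\<integral>\<^sup>+y. ennreal (pker g \<rho>' u y) \<partial>M))"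
      by (subst nn_integral_cmult) (auto simp: nn_integral_add)
    also have "\<dots> \<le> ennreal (C * ?P) * (ennreal C1 + ennreal C2)"
      by (intro mult_left_mono add_mono C1 C2 \<rho>) auto
    also have "\<dots> = ennreal (C * (C1 + C2) * ?P)"
      using C C1 C2 by (simp flip: ennreal_mult ennreal_plus add: mult_ac)
    finally show "(\<integral>\<^sup>+y. ennreal (pker G \<rho> x y * pker g \<rho>' u y) \<partial>M) \<le> ennreal (C * (C1 + C2) * ?P)" .
  qed
qed

end

section \<open>Exponential kernels and test functions\<close>

lemma exp_powr_bound:
  fixes \<nu> a b :: real
  assumes "0 < \<nu>" "0 < a" "0 \<le> b"
  obtains C where "0 < C" "\<And>t. 0 \<le> t \<Longrightarrow> exp (- \<nu> * t powr a) * (1 + t) powr b \<le> C"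
proof -
  \<comment> \<open>The n-th term of the exponential series in \<nu> t^a alone dominates t^b, as
    soon as a n \<ge> b and t \<ge> 1; smaller t are bounded crudely.\<close>
  define n where "n = nat \<lceil>b / a\<rceil>"
  have "b / a \<le> real n" unfolding n_def by linarith
  then have n: "b \<le> a * real n" using assms by (simp add: field_simps)
  have pos: "0 < 1 + fact n / \<nu> ^ n" using assms by (simp add: add_pos_pos)
  show ?thesis
  proof (rule that)
    show "0 < 2 powr b * (1 + fact n / \<nu> ^ n)" using pos by simp
    fix t :: real assume t: "0 \<le> t"
    show "exp (- \<nu> * t powr a) * (1 + t) powr b \<le> 2 powr b * (1 + fact n / \<nu> ^ n)"
    proof (cases "t \<le> 1")
      case True
      have "exp (- \<nu> * t powr a) * (1 + t) powr b \<le> 1 * 2 powr b"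
        using assms True t by (intro mult_mono powr_mono2) auto
      also have "\<dots> \<le> 2 powr b * (1 + fact n / \<nu> ^ n)"
        using assms by simp
      finally show ?thesis .
    next
      case False
      define s where "s = t powr a"
      have s: "0 < s" using False by (simp add: s_def)
      have "(\<nu> * s) ^ n /\<^sub>R fact n \<le> (\<Sum>n. (\<nu> * s) ^ n /\<^sub>R fact n)"
        using sum_le_suminf[OF sums_summable[OF exp_converges[of "\<nu> * s"]], of "{n}"] assms s by simp
      also have "\<dots> = exp (\<nu> * s)"
        by (rule sums_unique[OF exp_converges, symmetric])
      finally have "(\<nu> * s) ^ n / fact n \<le> exp (\<nu> * s)"
        by (simp add: divide_inverse mult.commute)
      then have es: "s ^ n * exp (- \<nu> * s) \<le> fact n / \<nu> ^ n"
        using assms s by (simp add: exp_minus field_simps)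
      have "(1 + t) powr b \<le> (2 * t) powr b"
        using assms False by (intro powr_mono2) auto
      also have "\<dots> = 2 powr b * t powr b" using False by (simp add: powr_mult)
      also have "t powr b \<le> t powr (a * real n)"
        using n False by (intro powr_mono) auto
      also have "t powr (a * real n) = s ^ n"
        using False s by (simp add: s_def powr_powr flip: powr_realpow)
      finally have "exp (- \<nu> * s) * (1 + t) powr b \<le> exp (- \<nu> * s) * (2 powr b * s ^ n)"
        by (simp add: mult_left_mono)
      also have "\<dots> = 2 powr b * (s ^ n * exp (- \<nu> * s))" by simp
      also have "\<dots> \<le> 2 powr b * (1 + fact n / \<nu> ^ n)"
        using es by (intro mult_left_mono) auto
      finally show ?thesis by (simp add: s_def)
    qed
  qed
qed

text \<open>If h is not integrable, its Bochner integral is 0 by convention, so the bound on the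
  absolute integral transfers in every case.\<close>

lemma cmod_integral_le:
  fixes h :: "'a \<Rightarrow> complex"
  assumes "(\<integral>\<^sup>+y. ennreal (cmod (h y)) \<partial>M) \<le> ennreal c" "0 \<le> c"
  shows "cmod (\<integral>y. h y \<partial>M) \<le> c"
proof (cases "integrable M h")
  case True
  have "ennreal (cmod (\<integral>y. h y \<partial>M)) \<le> (\<integral>\<^sup>+y. ennreal (cmod (h y)) \<partial>M)"
    using True by (rule integral_norm_bound_ennreal)
  then show ?thesis using assms by (simp add: order_trans[of _ _ "ennreal c", THEN ennreal_le_iff[OF assms(2), THEN iffD1]])
qed (use assms in \<open>simp add: not_integrable_integral_eq\<close>)

context homogeneous_type
begin

text \<open>The exponential absorbs (1 + t)^(hdim + G) with t = d(x,y)/\<rho>. The share G becomes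
  the decay of \<open>pker\<close>; the share hdim pays, through volume growth, for passing from the
  volumes at x and y with radius \<rho> to the one with radius \<rho> + d(x,y). The factor with the
  distances to Y is bounded by 1.\<close>

lemma iati_bound_le_pker:
  assumes "0 < \<nu>" "0 < a" "0 \<le> G" "0 < \<delta>"
  obtains C where "0 < C" "\<And>k x y. iati_bound M d \<delta> Y \<nu> a k x y \<le> C * pker G (\<delta> ^ k) x y"
proof -
  obtain C0 where C0: "0 < C0"
    "\<And>t. 0 \<le> t \<Longrightarrow> exp (- \<nu> * t powr a) * (1 + t) powr (hdim + G) \<le> C0"
    using exp_powr_bound[of \<nu> a "hdim + G"] assms hdim_nonneg by auto
  define L where "L = Cmu * (Cmu * (2 * A0) powr hdim)"
  have t1: "1 \<le> Cmu * (2 * A0) powr hdim"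
    using mult_mono[of 1 Cmu 1 "(2 * A0) powr hdim"] Cmu_ge_1 A0_ge_1 hdim_nonneg
    by (simp add: ge_one_powr_ge_zero)
  have L: "0 < L" "Cmu \<le> L"
    using mult_left_mono[OF t1, of Cmu] Cmu_ge_1 A0_ge_1 by (auto simp: L_def)
  show ?thesis
  proof (rule that)
    show "0 < L * C0" using L C0 by simp
    fix k x y
    define \<rho> where "\<rho> = \<delta> ^ k"
    have \<rho>: "0 < \<rho>" using assms by (simp add: \<rho>_def)
    define t where "t = d x y / \<rho>"
    have t: "0 \<le> t" "(1 + t) * \<rho> = \<rho> + d x y"
      using \<rho> dist_nonneg[of x y] by (auto simp: t_def field_simps)
    define W where "W = V (\<rho> + d x y) x"
    have vp: "0 < V \<rho> x" "0 < V \<rho> y" "0 < W"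
      unfolding W_def using \<rho> dist_nonneg[of x y] by (auto intro!: vol_pos add_pos_nonneg)
    define H where "H = L * (1 + t) powr hdim"
    have H: "0 < H" using L t by (simp add: H_def)
    have "W \<le> Cmu * (1 + t) powr hdim * V \<rho> x"
      unfolding W_def t(2)[symmetric] using t \<rho> by (intro vol_scale) auto
    also have "\<dots> \<le> H * V \<rho> x"
      unfolding H_def using L by (intro mult_right_mono) auto
    finally have 1: "W \<le> H * V \<rho> x" .
    have "W \<le> Cmu * (2 * A0) powr hdim * V (\<rho> + d x y) y"
      unfolding W_def using \<rho> by (rule vol_comp_swap)
    also have "\<dots> \<le> Cmu * (2 * A0) powr hdim * (Cmu * (1 + t) powr hdim * V \<rho> y)"
      unfolding t(2)[symmetric] using t \<rho> t1 by (intro mult_left_mono vol_scale) auto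
    also have "\<dots> = H * V \<rho> y" by (simp add: H_def L_def mult_ac)
    finally have 2: "W \<le> H * V \<rho> y" .
    have "sqrt (W * W) \<le> sqrt ((H * V \<rho> x) * (H * V \<rho> y))"
      using 1 2 vp H by (intro real_sqrt_le_mono mult_mono) auto
    also have "\<dots> = H * sqrt (V \<rho> x * V \<rho> y)"
      using H by (simp add: real_sqrt_mult mult_ac)
    finally have 3: "1 / sqrt (V \<rho> x * V \<rho> y) \<le> H / W"
      using vp by (simp add: field_simps)
    have f: "(if k = 0 then 1
      else if Y k = {} then 0
      else exp (- \<nu> * (max (INF v\<in>Y k. d x v) (INF v\<in>Y k. d y v) / \<delta> ^ k) powr a)) \<le> (1::real)" (is "?f \<le> 1")
      using assms by auto
    have f0: "0 \<le> ?f" by simp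
    have "iati_bound M d \<delta> Y \<nu> a k x y = 1 / sqrt (V \<rho> x * V \<rho> y) * exp (- \<nu> * t powr a) * ?f"
      by (simp add: iati_bound_def \<rho>_def t_def)
    also have "\<dots> \<le> 1 / sqrt (V \<rho> x * V \<rho> y) * exp (- \<nu> * t powr a) * 1"
      using vp by (intro mult_left_mono f) auto
    also have "\<dots> \<le> H / W * (C0 / (1 + t) powr (hdim + G)) * 1"
      using C0 t vp H 3 by (intro mult_right_mono mult_mono) (auto simp: pos_le_divide_eq)
    also have "\<dots> = L * C0 * ((1 / (1 + t)) powr G / W)"
      using t by (simp add: H_def powr_add powr_divide field_simps)
    also have "1 / (1 + t) = \<rho> / (\<rho> + d x y)"
      using t \<rho> dist_nonneg[of x y] by (simp add: t_def field_simps)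
    finally show "iati_bound M d \<delta> Y \<nu> a k x y \<le> L * C0 * pker G (\<delta> ^ k) x y"
      by (simp add: pker_def W_def \<rho>_def)
  qed
qed

text \<open>The decay exponent G is free. It is taken to be 3 below, since both the membership in
  test spaces and \<open>pairing_bound_fine_cancellation\<close> consume part of the decay of
  Q_k.\<close>

lemma exp_IATI_bounds:
  assumes "exp_IATI M d \<delta> Y \<eta> Q" "0 < \<delta>" "0 \<le> G"
  obtains C where "0 < C" "\<And>k x y. cmod (Q k x y) \<le> C * pker G (\<delta> ^ k) x y"
    "\<And>k x y y'. d y y' \<le> \<delta> ^ k \<Longrightarrow>
       cmod (Q k x y - Q k x y') \<le> C * (d y y' / \<delta> ^ k) powr \<eta> * pker G (\<delta> ^ k) x y"
proof -
  note Q = assms(1)[unfolded exp_IATI_def Let_def, THEN conjunct2, THEN conjunct2, THEN conjunct1]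
  from Q obtain C1 \<nu> a where C1: "0 < C1" "0 < \<nu>" "0 < a" and
    all: "\<forall>k. (\<forall>x y. cmod (Q k x y) \<le> C1 * iati_bound M d \<delta> Y \<nu> a k x y) \<and>
       (\<forall>x x' y. d x x' \<le> \<delta> ^ k \<longrightarrow>
            cmod (Q k x y - Q k x' y) + cmod (Q k y x - Q k y x')
              \<le> C1 * (d x x' / \<delta> ^ k) powr \<eta> * iati_bound M d \<delta> Y \<nu> a k x y) \<and>
       (\<forall>x x' y y'. d x x' \<le> \<delta> ^ k \<longrightarrow> d y y' \<le> \<delta> ^ k \<longrightarrow>
            cmod ((Q k x y - Q k x' y) - (Q k x y' - Q k x' y'))
              \<le> C1 * (d x x' / \<delta> ^ k) powr \<eta> * (d y y' / \<delta> ^ k) powr \<eta> * iati_bound M d \<delta> Y \<nu> a k x y)"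
    by (elim exE conjE) (rule that)
  have size: "cmod (Q k x y) \<le> C1 * iati_bound M d \<delta> Y \<nu> a k x y" for k x y
    using all[THEN spec, of k] by simp
  have hold: "cmod (Q k x y - Q k x' y) + cmod (Q k y x - Q k y x')
              \<le> C1 * (d x x' / \<delta> ^ k) powr \<eta> * iati_bound M d \<delta> Y \<nu> a k x y"
    if "d x x' \<le> \<delta> ^ k" for k x x' y
    using all[THEN spec, of k, THEN conjunct2, THEN conjunct1] that by simp
  obtain C2 where C2: "0 < C2" "\<And>k x y. iati_bound M d \<delta> Y \<nu> a k x y \<le> C2 * pker G (\<delta> ^ k) x y"
    using iati_bound_le_pker[of \<nu> a G \<delta> Y] C1 assms by blast
  define S where "S = Cmu * (2 * A0) powr hdim"
  have S: "1 \<le> S"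
    using mult_mono[of 1 Cmu 1 "(2 * A0) powr hdim"] Cmu_ge_1 A0_ge_1 hdim_nonneg
    by (simp add: ge_one_powr_ge_zero S_def)
  show ?thesis
  proof (rule that)
    show "0 < C1 * C2 * S" using C1 C2 S by simp
    fix k x y
    have "cmod (Q k x y) \<le> C1 * (C2 * pker G (\<delta> ^ k) x y)"
      using size[of k x y] C2(2)[of k x y] C1 by (meson mult_left_mono less_imp_le order_trans)
    also have "\<dots> \<le> S * \<dots>"
      using mult_right_mono[OF S, of "C1 * (C2 * pker G (\<delta> ^ k) x y)"] C1 C2 by simp
    finally show "cmod (Q k x y) \<le> C1 * C2 * S * pker G (\<delta> ^ k) x y" by (simp add: mult_ac)
    fix y' assume y': "d y y' \<le> \<delta> ^ k"
    \<comment> \<open>The regularity condition is read with the two variables exchanged. Its bound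
      is then centred at y, and \<open>pker_sym\<close> brings it back to x.\<close>
    have "cmod (Q k x y - Q k x y') \<le> C1 * (d y y' / \<delta> ^ k) powr \<eta> * iati_bound M d \<delta> Y \<nu> a k y x"
      using hold[OF y', of x] norm_ge_zero[of "Q k y x - Q k y' x"] by linarith
    also have "\<dots> \<le> C1 * (d y y' / \<delta> ^ k) powr \<eta> * (C2 * (S * pker G (\<delta> ^ k) x y))"
    proof (intro mult_left_mono)
      have "iati_bound M d \<delta> Y \<nu> a k y x \<le> C2 * pker G (\<delta> ^ k) y x" by (rule C2)
      also have "\<dots> \<le> C2 * (S * pker G (\<delta> ^ k) x y)"
        unfolding S_def using assms C2 by (intro mult_left_mono pker_sym) auto
      finally show "iati_bound M d \<delta> Y \<nu> a k y x \<le> C2 * (S * pker G (\<delta> ^ k) x y)" .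
    qed (use C1 in auto)
    finally show "cmod (Q k x y - Q k x y') \<le> C1 * C2 * S * (d y y' / \<delta> ^ k) powr \<eta> * pker G (\<delta> ^ k) x y"
      by (simp add: mult_ac)
  qed
qed

text \<open>The constant depends on both centres and both scales. This is enough for membership in a
  test space, where only some finite constant is asked for.\<close>

lemma pker_change_center:
  assumes "0 < \<rho>" "0 < \<rho>'" "0 \<le> G"
  obtains L where "0 < L" "\<And>y. pker G \<rho> x y \<le> L * pker G \<rho>' x' y"
proof -
  define t where "t = (\<rho>' + A0 * d x' x) / \<rho> + A0"
  define t' where "t' = A0 * (t + d x x' / \<rho>)"
  have t: "1 \<le> t"
    using assms A0_ge_1 dist_nonneg[of x' x] by (simp add: t_def add_increasing)
  have "1 * 1 \<le> A0 * (t + d x x' / \<rho>)"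
    using t A0_ge_1 assms dist_nonneg[of x x'] by (intro mult_mono) (auto intro: add_increasing2)
  then have t': "1 \<le> t'" by (simp add: t'_def)
  show ?thesis
  proof (rule that)
    show "0 < (\<rho> * t / \<rho>') powr G * (Cmu * t' powr hdim)" using assms t t' Cmu_ge_1 by simp
    fix y
    have p: "0 < \<rho> + d x y" "0 < \<rho>' + d x' y"
      using assms dist_nonneg by (auto intro: add_pos_nonneg)
    have "\<rho>' + d x' y \<le> \<rho>' + A0 * (d x' x + d x y)"
      using quasi_triangle[of x' y x] by simp
    also have "\<dots> \<le> (\<rho>' + A0 * d x' x) / \<rho> * (\<rho> + d x y) + A0 * (\<rho> + d x y)"
    proof -
      have "0 \<le> (\<rho>' + A0 * d x' x) / \<rho> * d x y" using assms A0_pos dist_nonneg by simp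
      moreover have "0 \<le> A0 * \<rho>" using assms A0_pos by simp
      ultimately show ?thesis using assms by (simp add: distrib_left)
    qed
    finally have le: "\<rho>' + d x' y \<le> t * (\<rho> + d x y)" by (simp add: t_def distrib_right)
    have "V (\<rho>' + d x' y) x' \<le> V (A0 * (\<rho>' + d x' y + d x x')) x" by (rule vol_shift)
    also have "\<dots> \<le> Cmu * t' powr hdim * V (\<rho> + d x y) x"
    proof (rule vol_le_scale)
      have "d x x' \<le> d x x' / \<rho> * (\<rho> + d x y)"
        using assms dist_nonneg[of x y] dist_nonneg[of x x'] by (simp add: distrib_left)
      then have "\<rho>' + d x' y + d x x' \<le> (t + d x x' / \<rho>) * (\<rho> + d x y)"
        using le by (simp add: distrib_right)
      then show "A0 * (\<rho>' + d x' y + d x x') \<le> t' * (\<rho> + d x y)"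
        unfolding t'_def using A0_pos by (simp add: mult.assoc)
    qed (use p t' in auto)
    finally have 1: "1 / V (\<rho> + d x y) x \<le> Cmu * t' powr hdim / V (\<rho>' + d x' y) x'"
      using vol_pos p by (simp add: field_simps)
    have "\<rho> / (\<rho> + d x y) \<le> (\<rho> * t / \<rho>') * (\<rho>' / (\<rho>' + d x' y))"
    proof -
      have "1 / (\<rho> + d x y) \<le> t / (\<rho>' + d x' y)"
        using le p by (simp add: field_simps)
      then show ?thesis using mult_left_mono[of _ _ \<rho>] assms by fastforce
    qed
    then have "(\<rho> / (\<rho> + d x y)) powr G \<le> ((\<rho> * t / \<rho>') * (\<rho>' / (\<rho>' + d x' y))) powr G"
      using assms p by (intro powr_mono2) auto
    also have "\<dots> = (\<rho> * t / \<rho>') powr G * (\<rho>' / (\<rho>' + d x' y)) powr G"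
      by (rule powr_mult)
    finally have 2: "(\<rho> / (\<rho> + d x y)) powr G \<le> (\<rho> * t / \<rho>') powr G * (\<rho>' / (\<rho>' + d x' y)) powr G" .
    have "pker G \<rho> x y = (\<rho> / (\<rho> + d x y)) powr G * (1 / V (\<rho> + d x y) x)"
      by (simp add: pker_def)
    also have "\<dots> \<le> ((\<rho> * t / \<rho>') powr G * (\<rho>' / (\<rho>' + d x' y)) powr G) * (Cmu * t' powr hdim / V (\<rho>' + d x' y) x')"
      by (intro mult_mono 1 2) auto
    also have "\<dots> = (\<rho> * t / \<rho>') powr G * (Cmu * t' powr hdim) * pker G \<rho>' x' y"
      by (simp add: pker_def)
    finally show "pker G \<rho> x y \<le> (\<rho> * t / \<rho>') powr G * (Cmu * t' powr hdim) * pker G \<rho>' x' y" .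
  qed
qed

text \<open>Decay 3 exceeds the exponent g \<le> 1 by at least 2. The surplus (1 + d(x0,y))^(-2)
  absorbs the powers of 1 + d(x0,y) that appear when an increment measured against \<rho> is
  measured against 1 + d(x0,y) instead.\<close>

lemma pker_test_space:
  fixes \<phi> :: "'a \<Rightarrow> complex"
  assumes "0 < \<rho>" "0 < b" "b \<le> \<eta>" "\<eta> \<le> 1" "0 < g" "g \<le> 1" "0 \<le> B"
    and size: "\<And>y. cmod (\<phi> y) \<le> B * pker 3 \<rho> x y"
    and hold: "\<And>y y'. d y y' \<le> \<rho> \<Longrightarrow> cmod (\<phi> y - \<phi> y') \<le> B * (d y y' / \<rho>) powr \<eta> * pker 3 \<rho> x y"
  shows "\<phi> \<in> test_space M d A0 x0 b g"
proof -
  define D where "D y = 1 / (V 1 x0 + vol2 M d x0 y) * (1 + d x0 y) powr (- g)" for y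
  define e where "e y = 1 + d x0 y" for y
  have e1: "1 \<le> e y" for y by (simp add: e_def dist_nonneg)
  obtain L where L: "0 < L" "\<And>y. pker 3 \<rho> x y \<le> L * pker 3 1 x0 y"
    using pker_change_center[of \<rho> 1 3 x x0] assms by auto
  have D0: "0 \<le> D y" for y by (simp add: D_def vol2_def vol_def)
  have pk: "pker 3 1 x0 y \<le> 2 * (e y powr - 2 * D y)" for y
  proof -
    have "V 1 x0 + vol2 M d x0 y \<le> 2 * V (e y) x0"
      using vol_mono[of 1 "e y" x0] vol_mono[of "d x0 y" "e y" x0] e1[of y]
      by (simp add: vol2_def vol_def e_def)
    moreover have "0 < V 1 x0" "0 < V (e y) x0" using e1[of y] by (auto intro: vol_pos)
    moreover have "0 \<le> vol2 M d x0 y" by (simp add: vol2_def)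
    ultimately have "1 / V (e y) x0 \<le> 2 * (1 / (V 1 x0 + vol2 M d x0 y))"
      by (simp add: divide_simps add_nonneg_eq_0_iff mult.commute)
    moreover have "(1 / e y) powr 3 \<le> e y powr - 2 * e y powr (- g)"
    proof -
      have "(1 / e y) powr 3 = e y powr - 3"
        using e1[of y] by (simp add: powr_divide powr_minus_divide)
      also have "\<dots> = e y powr - 2 * e y powr - 1"
        by (subst powr_add[symmetric]) simp
      also have "\<dots> \<le> e y powr - 2 * e y powr (- g)"
        using assms e1[of y] by (intro mult_left_mono powr_mono) auto
      finally show ?thesis .
    qed
    ultimately have "(1 / e y) powr 3 * (1 / V (e y) x0) \<le> (e y powr - 2 * e y powr (- g)) * (2 * (1 / (V 1 x0 + vol2 M d x0 y)))"
      by (intro mult_mono) auto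
    then show ?thesis by (simp add: pker_def D_def e_def mult_ac)
  qed
  define A where "A = B * L * 2"
  have A0': "0 \<le> A" using assms L by (simp add: A_def)
  have b1: "B * pker 3 \<rho> x y \<le> A * (e y powr - 2 * D y)" for y
  proof -
    have "B * pker 3 \<rho> x y \<le> B * (L * (2 * (e y powr - 2 * D y)))"
      using L pk[of y] assms by (intro mult_left_mono order_trans[OF L(2)[of y]]) auto
    then show ?thesis by (simp add: A_def)
  qed
  have em: "e y powr - 2 \<le> 1" for y
    using powr_mono[of "-2" 0 "e y"] e1[of y] by simp
  have emm: "e y powr p * e y powr - 2 \<le> 1" if "p \<le> 1" for y p
    using powr_mono[of "p - 2" 0 "e y"] e1[of y] that by (simp flip: powr_add)
  define T where "T = Cmu * (2 * A0) powr hdim * (2 * A0) powr 3"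
  have T: "0 < T" using Cmu_ge_1 A0_pos by (simp add: T_def)
  \<comment> \<open>The summand 1 keeps K positive when B = 0.\<close>
  define K where "K = A + A * \<rho> powr - \<eta> + A * (1 + T) * \<rho> powr - b + 1"
  have Kpos: "0 < K" "A \<le> K" "A * \<rho> powr - \<eta> \<le> K" "A * (1 + T) * \<rho> powr - b \<le> K"
    using A0' T by (auto simp: K_def intro!: add_nonneg_pos add_nonneg_nonneg mult_nonneg_nonneg)
  have c1: "cmod (\<phi> y) \<le> K * D y" for y
  proof -
    have "cmod (\<phi> y) \<le> A * (e y powr - 2 * D y)" using size[of y] b1[of y] by linarith
    also have "\<dots> \<le> A * (1 * D y)" using em D0 A0' by (intro mult_left_mono mult_right_mono) auto
    also have "\<dots> \<le> K * D y" using Kpos D0 by (simp add: mult_right_mono)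
    finally show ?thesis .
  qed
  have c2: "cmod (\<phi> y - \<phi> y') \<le> K * (d y y' / e y) powr b * D y" if le: "d y y' \<le> e y / (2 * A0)" for y y'
  proof -
    have dy: "0 \<le> d y y'" by (rule dist_nonneg)
    have "e y / (2 * A0) \<le> e y / 1"
      using e1[of y] A0_ge_1 by (intro divide_left_mono) auto
    then have de: "d y y' \<le> e y" using le by simp
    define w where "w = (d y y' / e y) powr b"
    have w0: "0 \<le> w" by (simp add: w_def)
    show ?thesis
    \<comment> \<open>Short increments use the regularity of \<phi>. For long ones (d/\<rho>)^b
      \<ge> 1, and the two values are bounded separately.\<close>
    proof (cases "d y y' \<le> \<rho>")
      case True
      have "(d y y' / \<rho>) powr \<eta> = (d y y' / e y) powr \<eta> * (e y powr \<eta> * \<rho> powr - \<eta>)"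
        using assms e1[of y] dy by (simp add: powr_divide powr_minus divide_simps)
      also have "\<dots> \<le> w * (e y powr \<eta> * \<rho> powr - \<eta>)"
        unfolding w_def using assms de e1[of y] dy by (intro mult_right_mono powr_mono') auto
      finally have "cmod (\<phi> y - \<phi> y') \<le> (w * (e y powr \<eta> * \<rho> powr - \<eta>)) * (A * (e y powr - 2 * D y))"
        using hold[OF True] b1[of y] assms w0
        by (smt (verit) mult.assoc mult.commute mult_mono pker_nonneg powr_ge_zero zero_le_mult_iff)
      also have "\<dots> = (A * \<rho> powr - \<eta> * w * D y) * (e y powr \<eta> * e y powr - 2)" by simp
      also have "\<dots> \<le> (A * \<rho> powr - \<eta> * w * D y) * 1"
        using assms A0' w0 D0 by (intro mult_left_mono emm) auto
      also have "\<dots> \<le> K * w * D y"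
        using Kpos D0 w0 by (simp add: mult_right_mono)
      finally show ?thesis by (simp add: w_def)
    next
      case False
      have "\<rho> powr b \<le> d y y' powr b" using assms False by (intro powr_mono2) auto
      then have "1 \<le> w * (e y powr b * \<rho> powr - b)"
        using e1[of y] dy assms by (simp add: w_def powr_divide powr_minus divide_simps)
      moreover have "cmod (\<phi> y - \<phi> y') \<le> (1 + T) * (A * (e y powr - 2 * D y))"
      proof -
        \<comment> \<open>The restriction on d(y,y') makes 1 + d(x0,y) at most 2 A0 (1 + d(x0,y')),
          so that the bound at y' can be moved to y.\<close>
        have "d x0 y \<le> A0 * (d x0 y' + d y' y)" by (rule quasi_triangle)
        moreover have "A0 * d y' y \<le> e y / 2"
          using le A0_pos by (simp add: dist_sym[of y' y] field_simps)
        ultimately have "e y \<le> 2 + 2 * (A0 * d x0 y')"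
          by (simp add: e_def distrib_left)
        then have "1 + d x0 y \<le> 2 * A0 * (1 + d x0 y')"
          using A0_ge_1 by (simp add: e_def distrib_left)
        then have "pker 3 1 x0 y' \<le> T * pker 3 1 x0 y"
          unfolding T_def using A0_ge_1 by (intro pker_compare) auto
        then have "B * pker 3 \<rho> x y' \<le> B * (L * (T * pker 3 1 x0 y))"
          using L assms by (intro mult_left_mono order_trans[OF L(2)[of y']]) auto
        also have "\<dots> \<le> B * (L * (T * (2 * (e y powr - 2 * D y))))"
          using L assms T by (intro mult_left_mono pk) auto
        finally have "cmod (\<phi> y') \<le> T * (A * (e y powr - 2 * D y))"
          using size[of y'] by (simp add: A_def mult_ac)
        moreover have "cmod (\<phi> y) \<le> A * (e y powr - 2 * D y)" using size[of y] b1[of y] by linarith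
        ultimately show ?thesis
          using norm_triangle_ineq4[of "\<phi> y" "\<phi> y'"] by (simp add: distrib_right)
      qed
      ultimately have "1 * cmod (\<phi> y - \<phi> y') \<le> (w * (e y powr b * \<rho> powr - b)) * ((1 + T) * (A * (e y powr - 2 * D y)))"
        by (intro mult_mono) auto
      also have "\<dots> = (A * (1 + T) * \<rho> powr - b * w * D y) * (e y powr b * e y powr - 2)" by simp
      also have "\<dots> \<le> (A * (1 + T) * \<rho> powr - b * w * D y) * 1"
        using assms A0' w0 D0 T by (intro mult_left_mono emm) auto
      also have "\<dots> \<le> K * w * D y"
        using Kpos D0 w0 by (simp add: mult_right_mono)
      finally show ?thesis by (simp add: w_def)
    qed
  qed
  have "test_bound M d A0 x0 b g \<phi> K"
    unfolding test_bound_def Let_def using c1 c2 by (simp add: D_def e_def)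
  then show ?thesis using Kpos by (auto simp: test_space_def)
qed

text \<open>The function approximates itself: for the zero function every positive constant is
  admissible, so its norm is the infimum 0.\<close>

lemma test_space0I:
  assumes "\<phi> \<in> test_space M d A0 x0 \<eta> \<eta>" "\<phi> \<in> test_space M d A0 x0 \<beta> \<gamma>"
  shows "\<phi> \<in> test_space0 M d A0 x0 \<eta> \<beta> \<gamma>"
proof -
  have "test_bound M d A0 x0 \<beta> \<gamma> (\<lambda>x. \<phi> x - \<phi> x) C" if "0 < C" for C
    using that dist_nonneg unfolding test_bound_def Let_def
    by (auto intro!: mult_nonneg_nonneg divide_nonneg_nonneg add_nonneg_nonneg simp: vol2_def)
  then have "{C. 0 < C \<and> test_bound M d A0 x0 \<beta> \<gamma> (\<lambda>x. \<phi> x - \<phi> x) C} = {0<..}" by auto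
  then have "test_norm M d A0 x0 \<beta> \<gamma> (\<lambda>x. \<phi> x - \<phi> x) = 0"
    unfolding test_norm_def by (simp only:) simp
  then show ?thesis unfolding test_space0_def using assms by force
qed

text \<open>Gives a meaning to Q_k f(x) as a value of f, and admits Q_k(x,.) as a test function in
  the reproducing formula.\<close>

lemma exp_IATI_test_space0:
  assumes "exp_IATI M d \<delta> Y \<eta> Q" "0 < \<delta>" "0 < \<beta>" "\<beta> \<le> \<eta>" "0 < \<gamma>" "\<gamma> \<le> 1" "\<eta> \<le> 1"
  shows "Q k x \<in> test_space0 M d A0 x0 \<eta> \<beta> \<gamma>"
proof -
  obtain C where C: "0 < C" "\<And>k x y. cmod (Q k x y) \<le> C * pker 3 (\<delta> ^ k) x y"
    "\<And>k x y y'. d y y' \<le> \<delta> ^ k \<Longrightarrow>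
       cmod (Q k x y - Q k x y') \<le> C * (d y y' / \<delta> ^ k) powr \<eta> * pker 3 (\<delta> ^ k) x y"
    using exp_IATI_bounds[OF assms(1,2), of 3] by auto
  show ?thesis
    by (intro test_space0I pker_test_space[where B = C and \<rho> = "\<delta> ^ k" and x = x and \<eta> = \<eta>] C) (use assms C in auto)
qed

end

section \<open>Almost orthogonality\<close>

context homogeneous_type
begin

section \<open>Integrals of functions dominated by kernels\<close>

lemma integrable_pker_bounded:
  fixes h :: "'a \<Rightarrow> complex"
  assumes "h \<in> borel_measurable M" "0 < \<rho>" "0 < g" "\<And>y. cmod (h y) \<le> B * pker g \<rho> x y" "0 \<le> B"
  shows "integrable M h"
proof (rule integrableI_bounded)
  obtain C where C: "0 < C" "\<And>\<rho> x. 0 < \<rho> \<Longrightarrow> (\<integral>\<^sup>+y. ennreal (pker g \<rho> x y) \<partial>M) \<le> ennreal C"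
    using pker_integral assms by blast
  have "(\<integral>\<^sup>+y. ennreal (norm (h y)) \<partial>M) \<le> (\<integral>\<^sup>+y. ennreal B * ennreal (pker g \<rho> x y) \<partial>M)"
    using assms by (intro nn_integral_mono) (auto simp flip: ennreal_mult intro!: ennreal_leI)
  also have "\<dots> \<le> ennreal B * ennreal C"
    by (subst nn_integral_cmult) (auto intro!: mult_left_mono C assms)
  finally show "(\<integral>\<^sup>+y. ennreal (norm (h y)) \<partial>M) < \<infinity>"
    by (simp add: order_le_less_trans ennreal_mult_less_top flip: ennreal_mult')
qed fact

text \<open>For the fine cancellation estimate, in which the terms away from x keep different
  kernels.\<close>

lemma integral_le_two_pkers:
  fixes h :: "'a \<Rightarrow> complex"
  assumes "0 < g" "0 < g'"
  obtains C where "0 < C" "\<And>\<rho> \<rho>' x u B h. 0 < \<rho> \<Longrightarrow> 0 < \<rho>' \<Longrightarrow> 0 \<le> B \<Longrightarrow>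
     (\<And>y. cmod (h y) \<le> B * (pker g \<rho> x y + pker g' \<rho>' u y)) \<Longrightarrow> cmod (\<integral>y. h y \<partial>M) \<le> C * B"
proof -
  obtain C1 where C1: "0 < C1" "\<And>\<rho> x. 0 < \<rho> \<Longrightarrow> (\<integral>\<^sup>+y. ennreal (pker g \<rho> x y) \<partial>M) \<le> ennreal C1"
    using pker_integral assms by blast
  obtain C2 where C2: "0 < C2" "\<And>\<rho> x. 0 < \<rho> \<Longrightarrow> (\<integral>\<^sup>+y. ennreal (pker g' \<rho> x y) \<partial>M) \<le> ennreal C2"
    using pker_integral assms by blast
  show ?thesis
  proof (rule that)
    show "0 < C1 + C2" using C1 C2 by simp
    fix \<rho> \<rho>' B :: real and x u and h :: "'a \<Rightarrow> complex"
    assume a: "0 < \<rho>" "0 < \<rho>'" "0 \<le> B" and h: "\<And>y. cmod (h y) \<le> B * (pker g \<rho> x y + pker g' \<rho>' u y)"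
    have "(\<integral>\<^sup>+y. ennreal (cmod (h y)) \<partial>M)
        \<le> (\<integral>\<^sup>+y. ennreal B * (ennreal (pker g \<rho> x y) + ennreal (pker g' \<rho>' u y)) \<partial>M)"
      using a h by (intro nn_integral_mono)
        (auto simp flip: ennreal_mult ennreal_plus intro!: ennreal_leI)
    also have "\<dots> = ennreal B * ((\<integral>\<^sup>+y. ennreal (pker g \<rho> x y) \<partial>M) + (\<integral>\<^sup>+y. ennreal (pker g' \<rho>' u y) \<partial>M))"
      by (subst nn_integral_cmult) (auto simp: nn_integral_add)
    also have "\<dots> \<le> ennreal B * (ennreal C1 + ennreal C2)"
      by (intro mult_left_mono add_mono C1 C2 a) auto
    also have "\<dots> = ennreal ((C1 + C2) * B)"
      using C1 C2 a by (simp flip: ennreal_mult ennreal_plus add: mult_ac)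
    finally show "cmod (\<integral>y. h y \<partial>M) \<le> (C1 + C2) * B"
      using C1 C2 a by (intro cmod_integral_le) auto
  qed
qed

text \<open>Allows a multiple of one factor to be subtracted under the integral in the two
  cancellation estimates.\<close>

lemma integrable_pker_product:
  fixes f h :: "'a \<Rightarrow> complex"
  assumes "f \<in> borel_measurable M" "h \<in> borel_measurable M" "0 < \<rho>" "0 < \<rho>'" "0 < g" "g \<le> G"
    "0 \<le> A" "0 \<le> B" "\<And>y. cmod (f y) \<le> A * pker G \<rho> x y" "\<And>y. cmod (h y) \<le> B * pker g \<rho>' u y"
  shows "integrable M (\<lambda>y. h y * f y)"
proof -
  obtain C where C: "0 < C" "\<And>\<rho> \<rho>' x y u. 0 < \<rho> \<Longrightarrow> 0 < \<rho>' \<Longrightarrow>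
     pker G \<rho> x y * pker g \<rho>' u y
       \<le> C * pker g (max \<rho> \<rho>') x u * (pker G \<rho> x y + pker g \<rho>' u y)"
    using pker_compose_pointwise assms by blast
  define L where "L = A * B * (C * pker g (max \<rho> \<rho>') x u)"
  have L: "0 \<le> L" using C assms by (simp add: L_def)
  have int: "integrable M (\<lambda>y. complex_of_real (L * pker G \<rho> x y))" "integrable M (\<lambda>y. complex_of_real (L * pker g \<rho>' u y))"
    by (rule integrable_pker_bounded[where B=L and g=G and x=x and \<rho>=\<rho>];
         use L assms in \<open>auto simp: norm_mult\<close>)
       (rule integrable_pker_bounded[where B=L and g=g and x=u and \<rho>=\<rho>'];
         use L assms in \<open>auto simp: norm_mult\<close>)
  have "integrable M (\<lambda>y. complex_of_real (L * pker G \<rho> x y) + complex_of_real (L * pker g \<rho>' u y))"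
    by (rule Bochner_Integration.integrable_add[OF int])
  then show ?thesis
  proof (rule Bochner_Integration.integrable_bound)
    show "AE y in M. norm (h y * f y) \<le> norm (complex_of_real (L * pker G \<rho> x y) + complex_of_real (L * pker g \<rho>' u y))"
    proof (intro AE_I2)
      fix y
      have "norm (h y * f y) \<le> (B * pker g \<rho>' u y) * (A * pker G \<rho> x y)"
        unfolding norm_mult using assms by (intro mult_mono) auto
      also have "\<dots> = A * B * (pker G \<rho> x y * pker g \<rho>' u y)" by simp
      also have "\<dots> \<le> A * B * (C * pker g (max \<rho> \<rho>') x u * (pker G \<rho> x y + pker g \<rho>' u y))"
        using assms C by (intro mult_left_mono C) auto
      also have "\<dots> = L * pker G \<rho> x y + L * pker g \<rho>' u y" by (simp add: L_def distrib_left mult_ac)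
      also have "\<dots> = norm (complex_of_real (L * pker G \<rho> x y) + complex_of_real (L * pker g \<rho>' u y))"
        using L by (simp flip: of_real_add of_real_mult)
      finally show "norm (h y * f y) \<le> norm (complex_of_real (L * pker G \<rho> x y) + complex_of_real (L * pker g \<rho>' u y))" .
    qed
  qed (use assms in measurable)
qed

text \<open>For those pairs of levels at which the finer of the two functions need not have
  vanishing integral.\<close>

lemma pairing_bound:
  assumes "0 < g" "g \<le> G"
  obtains C where "0 < C" "\<And>\<rho> \<rho>' x u A B \<phi> h. 0 < \<rho> \<Longrightarrow> 0 < \<rho>' \<Longrightarrow> 0 \<le> A \<Longrightarrow> 0 \<le> B \<Longrightarrow>
     (\<And>y. cmod (\<phi> y) \<le> A * pker G \<rho> x y) \<Longrightarrow> (\<And>y. cmod (h y) \<le> B * pker g \<rho>' u y) \<Longrightarrow>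
     cmod (\<integral>y. h y * \<phi> y \<partial>M) \<le> C * (A * B) * pker g (max \<rho> \<rho>') x u"
proof -
  obtain C where C: "0 < C" "\<And>\<rho> \<rho>' x u. 0 < \<rho> \<Longrightarrow> 0 < \<rho>' \<Longrightarrow>
     (\<integral>\<^sup>+y. ennreal (pker G \<rho> x y * pker g \<rho>' u y) \<partial>M) \<le> ennreal (C * pker g (max \<rho> \<rho>') x u)"
    using pker_compose assms by blast
  show ?thesis
  proof (rule that[OF C(1)])
    fix \<rho> \<rho>' A B :: real and x u and \<phi> h :: "'a \<Rightarrow> complex"
    assume a: "0 < \<rho>" "0 < \<rho>'" "0 \<le> A" "0 \<le> B" and
      \<phi>: "\<And>y. cmod (\<phi> y) \<le> A * pker G \<rho> x y" and h: "\<And>y. cmod (h y) \<le> B * pker g \<rho>' u y"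
    have "(\<integral>\<^sup>+y. ennreal (cmod (h y * \<phi> y)) \<partial>M)
       \<le> (\<integral>\<^sup>+y. ennreal (A * B) * ennreal (pker G \<rho> x y * pker g \<rho>' u y) \<partial>M)"
    proof (intro nn_integral_mono)
      fix y
      have "cmod (h y * \<phi> y) \<le> (B * pker g \<rho>' u y) * (A * pker G \<rho> x y)"
        unfolding norm_mult using a by (intro mult_mono \<phi> h) auto
      then show "ennreal (cmod (h y * \<phi> y)) \<le> ennreal (A * B) * ennreal (pker G \<rho> x y * pker g \<rho>' u y)"
        using a by (simp flip: ennreal_mult add: mult_ac ennreal_leI)
    qed
    also have "\<dots> \<le> ennreal (A * B) * ennreal (C * pker g (max \<rho> \<rho>') x u)"
      by (subst nn_integral_cmult) (auto intro!: mult_left_mono C a)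
    also have "\<dots> = ennreal (C * (A * B) * pker g (max \<rho> \<rho>') x u)"
      using a C by (simp flip: ennreal_mult add: mult_ac)
    finally show "cmod (\<integral>y. h y * \<phi> y \<partial>M) \<le> C * (A * B) * pker g (max \<rho> \<rho>') x u"
      using a C by (intro cmod_integral_le) auto
  qed
qed

text \<open>Here \<phi> lives at the finer scale and has integral 0, so h may be replaced by h -
  h(x). Near x the regularity of h yields (d/D)^b, which together with (\<rho>/(\<rho>+d))^b from
  the decay of \<phi> is at most (\<rho>/\<rho>')^b. Away from x the decay of \<phi> alone gives
  this factor.\<close>

lemma pairing_bound_fine_cancellation:
  assumes "0 < g" "g \<le> 2" "0 < b" "b \<le> 1" "0 < c" "c \<le> 1"
  obtains C where "0 < C" "\<And>\<rho> \<rho>' x u A B \<phi> h. 0 < \<rho> \<Longrightarrow> \<rho> \<le> \<rho>' \<Longrightarrow> 0 \<le> A \<Longrightarrow> 0 \<le> B \<Longrightarrow>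
     \<phi> \<in> borel_measurable M \<Longrightarrow> h \<in> borel_measurable M \<Longrightarrow>
     (\<And>y. cmod (\<phi> y) \<le> A * pker 3 \<rho> x y) \<Longrightarrow> (\<And>y. cmod (h y) \<le> B * pker g \<rho>' u y) \<Longrightarrow>
     (\<And>y. d x y \<le> c * (\<rho>' + d x u) \<Longrightarrow>
        cmod (h x - h y) \<le> B * (d x y / (\<rho>' + d x u)) powr b * pker g \<rho>' u x) \<Longrightarrow>
     (\<integral>y. \<phi> y \<partial>M) = 0 \<Longrightarrow>
     cmod (\<integral>y. h y * \<phi> y \<partial>M) \<le> C * (A * B) * (\<rho> / \<rho>') powr b * pker g \<rho>' u x"
proof -
  define T where "T = Cmu * (1 / c) powr hdim * (1 / c) powr 2 * (Cmu * (2 * A0) powr hdim)"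
  have T: "0 < T" using Cmu_ge_1 A0_pos assms by (simp add: T_def)
  define U where "U = 1 + (1 / c) powr b * (1 + T)"
  have U: "1 \<le> U" "(1 / c) powr b \<le> U" "(1 / c) powr b * T \<le> U" using T by (auto simp: U_def distrib_left)
  obtain C where C: "0 < C" "\<And>\<rho> \<rho>' x u B h. 0 < \<rho> \<Longrightarrow> 0 < \<rho>' \<Longrightarrow> 0 \<le> B \<Longrightarrow>
     (\<And>y. cmod (h y) \<le> B * (pker 2 \<rho> x y + pker g \<rho>' u y)) \<Longrightarrow> cmod (\<integral>y. h y \<partial>M) \<le> C * B"
    using integral_le_two_pkers[of 2 g] assms by auto
  show ?thesis
  proof (rule that)
    show "0 < C * U" using C U by simp
    fix \<rho> \<rho>' A B :: real and x u and \<phi> h :: "'a \<Rightarrow> complex"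
    assume \<rho>: "0 < \<rho>" "\<rho> \<le> \<rho>'" and AB: "0 \<le> A" "0 \<le> B" and
      [measurable]: "\<phi> \<in> borel_measurable M" "h \<in> borel_measurable M" and
      \<phi>: "\<And>y. cmod (\<phi> y) \<le> A * pker 3 \<rho> x y" and h: "\<And>y. cmod (h y) \<le> B * pker g \<rho>' u y" and
      hold: "\<And>y. d x y \<le> c * (\<rho>' + d x u) \<Longrightarrow>
        cmod (h x - h y) \<le> B * (d x y / (\<rho>' + d x u)) powr b * pker g \<rho>' u x" and
      cancel: "(\<integral>y. \<phi> y \<partial>M) = 0"
    have \<rho>': "0 < \<rho>'" using \<rho> by simp
    define D where "D = \<rho>' + d x u"
    define P where "P = pker g \<rho>' u x"
    define w where "w = (\<rho> / \<rho>') powr b"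
    have D: "\<rho>' \<le> D" "0 < D" using \<rho>' dist_nonneg[of x u] by (auto simp: D_def)
    have nn: "0 \<le> w" "0 \<le> P" by (auto simp: w_def P_def)
    \<comment> \<open>As b \<le> 1, one of the three units of decay can be spent on
      (\<rho>/(\<rho>+d))^b; the exponent 2 that remains is at least g.\<close>
    have p3: "pker 3 \<rho> x y \<le> (\<rho> / (\<rho> + d x y)) powr b * pker 2 \<rho> x y" for y
      unfolding pker_add[symmetric] using \<rho> assms by (intro pker_mono) auto
    have pt: "cmod (h y * \<phi> y - h x * \<phi> y) \<le> A * B * w * P * U * (pker 2 \<rho> x y + pker g \<rho>' u y)" for y
    proof (cases "d x y \<le> c * D")
      case True
      have "(d x y / D) * (\<rho> / (\<rho> + d x y)) \<le> \<rho> / \<rho>'"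
      proof -
        have "(d x y / D) * (\<rho> / (\<rho> + d x y)) = (d x y / (\<rho> + d x y)) * (\<rho> / D)" by simp
        also have "\<dots> \<le> 1 * (\<rho> / \<rho>')"
          using \<rho> \<rho>' D dist_nonneg[of x y] by (intro mult_mono divide_left_mono) auto
        finally show ?thesis by simp
      qed
      then have "((d x y / D) * (\<rho> / (\<rho> + d x y))) powr b \<le> w"
        unfolding w_def using \<rho> D assms dist_nonneg[of x y] by (intro powr_mono2) auto
      then have w: "(d x y / D) powr b * (\<rho> / (\<rho> + d x y)) powr b \<le> w" by (simp only: powr_mult)
      have "cmod (h y * \<phi> y - h x * \<phi> y) = cmod (h x - h y) * cmod (\<phi> y)"
        by (metis left_diff_distrib norm_minus_commute norm_mult)
      also have "\<dots> \<le> (B * (d x y / D) powr b * P) * (A * ((\<rho> / (\<rho> + d x y)) powr b * pker 2 \<rho> x y))"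
        using hold[of y] True \<phi>[of y] p3[of y] AB nn unfolding D_def P_def
        by (intro mult_mono) (auto intro: order_trans mult_left_mono)
      also have "\<dots> = A * B * ((d x y / D) powr b * (\<rho> / (\<rho> + d x y)) powr b) * P * pker 2 \<rho> x y" by simp
      also have "\<dots> \<le> A * B * w * P * pker 2 \<rho> x y"
        using AB nn w by (intro mult_right_mono mult_left_mono) auto
      also have "\<dots> \<le> A * B * w * P * (U * (pker 2 \<rho> x y + pker g \<rho>' u y))"
        using AB nn U mult_mono[of 1 U "pker 2 \<rho> x y" "pker 2 \<rho> x y + pker g \<rho>' u y"]
        by (intro mult_left_mono) auto
      finally show ?thesis by (simp add: mult_ac)
    next
      \<comment> \<open>The two terms are treated differently. For h(x) the kernel of \<phi> stays
        as the integrand; for h(y) it is replaced by its size \<open>T * P\<close> beyond distance c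
        D, and the kernel of h is integrated.\<close>
      case False
      have "\<rho> / (\<rho> + d x y) \<le> (1 / c) * (\<rho> / \<rho>')"
      proof -
        have "c * \<rho>' \<le> c * D" using assms D by simp
        then have "c * \<rho>' \<le> \<rho> + d x y" using False \<rho> by linarith
        then have "\<rho> / (\<rho> + d x y) \<le> \<rho> / (c * \<rho>')"
          using \<rho> \<rho>' assms by (intro divide_left_mono) (auto intro!: mult_pos_pos add_pos_nonneg dist_nonneg)
        then show ?thesis by simp
      qed
      then have "(\<rho> / (\<rho> + d x y)) powr b \<le> ((1 / c) * (\<rho> / \<rho>')) powr b"
        using \<rho> assms dist_nonneg[of x y] by (intro powr_mono2) auto
      then have "(\<rho> / (\<rho> + d x y)) powr b \<le> (1 / c) powr b * w"
        by (simp only: powr_mult w_def)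
      then have "pker 3 \<rho> x y \<le> (1 / c) powr b * w * pker 2 \<rho> x y"
        using p3[of y] by (meson mult_right_mono order_trans pker_nonneg)
      then have "A * pker 3 \<rho> x y \<le> A * ((1 / c) powr b * w * pker 2 \<rho> x y)"
        by (rule mult_left_mono) fact
      then have \<phi>': "cmod (\<phi> y) \<le> A * ((1 / c) powr b * w * pker 2 \<rho> x y)"
        using \<phi>[of y] by linarith
      have "pker 2 \<rho> x y \<le> Cmu * (1 / c) powr hdim * (1 / c) powr 2 * ((\<rho>' / D) powr g / V D x)"
      proof (rule pker_bound)
        show "D \<le> 1 / c * (\<rho> + d x y)" using False \<rho> assms by (simp add: field_simps)
      qed (use assms \<rho> D in auto)
      also have "(\<rho>' / D) powr g / V D x = pker g \<rho>' x u"
        by (simp add: pker_def D_def)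
      also have "Cmu * (1 / c) powr hdim * (1 / c) powr 2 * pker g \<rho>' x u
          \<le> Cmu * (1 / c) powr hdim * (1 / c) powr 2 * (Cmu * (2 * A0) powr hdim * P)"
        unfolding P_def using \<rho>' Cmu_ge_1 assms by (intro mult_left_mono pker_sym) auto
      finally have far: "pker 2 \<rho> x y \<le> T * P" by (simp add: T_def mult_ac)
      have "cmod (h x * \<phi> y) \<le> (B * P) * (A * ((1 / c) powr b * w * pker 2 \<rho> x y))"
        unfolding norm_mult P_def using h[of x] \<phi>' AB by (intro mult_mono) auto
      also have "\<dots> = A * B * w * P * ((1 / c) powr b * pker 2 \<rho> x y)" by simp
      also have "\<dots> \<le> A * B * w * P * (U * pker 2 \<rho> x y)"
        using AB nn U by (intro mult_left_mono mult_right_mono) auto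
      finally have 1: "cmod (h x * \<phi> y) \<le> A * B * w * P * (U * pker 2 \<rho> x y)" .
      have "cmod (h y * \<phi> y) \<le> (B * pker g \<rho>' u y) * (A * ((1 / c) powr b * w * pker 2 \<rho> x y))"
        unfolding norm_mult using h[of y] \<phi>' AB by (intro mult_mono) auto
      also have "\<dots> \<le> (B * pker g \<rho>' u y) * (A * ((1 / c) powr b * w * (T * P)))"
        using AB nn far by (intro mult_left_mono) auto
      also have "\<dots> = A * B * w * P * (((1 / c) powr b * T) * pker g \<rho>' u y)" by simp
      also have "\<dots> \<le> A * B * w * P * (U * pker g \<rho>' u y)"
        using AB nn U by (intro mult_left_mono mult_right_mono) auto
      finally have 2: "cmod (h y * \<phi> y) \<le> A * B * w * P * (U * pker g \<rho>' u y)" .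
      show ?thesis
        using 1 2 norm_triangle_ineq4[of "h y * \<phi> y" "h x * \<phi> y"] by (simp add: distrib_left mult.assoc)
    qed
    have i1: "integrable M \<phi>" using \<phi> AB \<rho> by (intro integrable_pker_bounded[where g = 3 and \<rho> = \<rho> and B = A and x = x]) auto
    have i2: "integrable M (\<lambda>y. h y * \<phi> y)"
      by (rule integrable_pker_product[where f = \<phi> and h = h and \<rho> = \<rho> and \<rho>' = \<rho>' and g = g and G = 3
            and A = A and B = B and x = x and u = u]) (use \<phi> h AB \<rho> \<rho>' assms in auto)
    have "(\<integral>y. h y * \<phi> y \<partial>M) = (\<integral>y. h y * \<phi> y - h x * \<phi> y \<partial>M)"
      using i1 i2 cancel by simp
    also have "cmod \<dots> \<le> C * (A * B * w * P * U)"
      by (rule C(2)[OF _ _ _ pt]) (use \<rho> \<rho>' AB nn U in auto)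
    finally show "cmod (\<integral>y. h y * \<phi> y \<partial>M) \<le> C * U * (A * B) * (\<rho> / \<rho>') powr b * pker g \<rho>' u x"
      by (simp add: w_def P_def mult_ac)
  qed
qed

text \<open>The mirror image: h is the finer factor, has integral 0 and decays only with exponent g.
  The power \<tau> that produces (\<rho>'/\<rho>)^\<tau> is taken out of g, and g - \<tau> must be
  positive for the remaining kernel to be integrable.\<close>

lemma pairing_bound_coarse_cancellation:
  assumes "0 < \<tau>" "\<tau> < g" "\<tau> \<le> \<eta>" "g \<le> 3"
  obtains C where "0 < C" "\<And>\<rho> \<rho>' x u A B \<phi> h. 0 < \<rho>' \<Longrightarrow> \<rho>' \<le> \<rho> \<Longrightarrow> 0 \<le> A \<Longrightarrow> 0 \<le> B \<Longrightarrow>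
     \<phi> \<in> borel_measurable M \<Longrightarrow> h \<in> borel_measurable M \<Longrightarrow>
     (\<And>y. cmod (\<phi> y) \<le> A * pker 3 \<rho> x y) \<Longrightarrow> (\<And>y. cmod (h y) \<le> B * pker g \<rho>' u y) \<Longrightarrow>
     (\<And>y. d u y \<le> \<rho> \<Longrightarrow> cmod (\<phi> u - \<phi> y) \<le> A * (d u y / \<rho>) powr \<eta> * pker 3 \<rho> x u) \<Longrightarrow>
     (\<integral>y. h y \<partial>M) = 0 \<Longrightarrow>
     cmod (\<integral>y. h y * \<phi> y \<partial>M) \<le> C * (A * B) * (\<rho>' / \<rho>) powr \<tau> * pker g \<rho> x u"
proof -
  define K where "K = 2 powr g * (Cmu * 2 powr hdim)"
  have K: "0 < K" using Cmu_ge_1 by (simp add: K_def)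
  obtain C1 where C1: "0 < C1" "\<And>\<rho> x. 0 < \<rho> \<Longrightarrow> (\<integral>\<^sup>+y. ennreal (pker (g - \<tau>) \<rho> x y) \<partial>M) \<le> ennreal C1"
    using pker_integral[of "g - \<tau>"] assms by auto
  obtain C2 where C2: "0 < C2" "\<And>\<rho> \<rho>' x u. 0 < \<rho> \<Longrightarrow> 0 < \<rho>' \<Longrightarrow>
     (\<integral>\<^sup>+y. ennreal (pker 3 \<rho> x y * pker g \<rho>' u y) \<partial>M) \<le> ennreal (C2 * pker g (max \<rho> \<rho>') x u)"
    using pker_compose[of g 3] assms by auto
  show ?thesis
  proof (rule that)
    show "0 < C1 + K * C2" using C1 C2 K by (simp add: add_pos_pos)
    fix \<rho> \<rho>' A B :: real and x u and \<phi> h :: "'a \<Rightarrow> complex"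
    assume \<rho>: "0 < \<rho>'" "\<rho>' \<le> \<rho>" and AB: "0 \<le> A" "0 \<le> B" and
      [measurable]: "\<phi> \<in> borel_measurable M" "h \<in> borel_measurable M" and
      \<phi>: "\<And>y. cmod (\<phi> y) \<le> A * pker 3 \<rho> x y" and h: "\<And>y. cmod (h y) \<le> B * pker g \<rho>' u y" and
      hold: "\<And>y. d u y \<le> \<rho> \<Longrightarrow> cmod (\<phi> u - \<phi> y) \<le> A * (d u y / \<rho>) powr \<eta> * pker 3 \<rho> x u" and
      cancel: "(\<integral>y. h y \<partial>M) = 0"
    have \<rho>p: "0 < \<rho>" using \<rho> by simp
    define w where "w = (\<rho>' / \<rho>) powr \<tau>"
    define P where "P = pker g \<rho> x u"
    have nn: "0 \<le> w" "0 \<le> P" by (auto simp: w_def P_def)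
    have P3: "pker 3 \<rho> x u \<le> P" unfolding P_def using \<rho>p assms by (intro pker_mono) auto
    have split: "pker g \<rho>' u y = (\<rho>' / (\<rho>' + d u y)) powr \<tau> * pker (g - \<tau>) \<rho>' u y" for y
      using pker_add[of \<tau> "g - \<tau>" \<rho>' u y] by simp
    have pt: "cmod (h y * \<phi> y - h y * \<phi> u)
        \<le> A * B * w * (P * pker (g - \<tau>) \<rho>' u y + K * (pker 3 \<rho> x y * pker g \<rho> u y))" for y
    proof (cases "d u y \<le> \<rho>")
      case True
      have dy: "0 \<le> d u y" by (rule dist_nonneg)
      have "(d u y / \<rho>) * (\<rho>' / (\<rho>' + d u y)) = (d u y / (\<rho>' + d u y)) * (\<rho>' / \<rho>)" by simp
      also have "\<dots> \<le> 1 * (\<rho>' / \<rho>)" using \<rho> \<rho>p dy by (intro mult_right_mono) auto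
      finally have "((d u y / \<rho>) * (\<rho>' / (\<rho>' + d u y))) powr \<tau> \<le> w"
        unfolding w_def using assms \<rho> \<rho>p dy by (intro powr_mono2) auto
      then have w: "(d u y / \<rho>) powr \<tau> * (\<rho>' / (\<rho>' + d u y)) powr \<tau> \<le> w" by (simp only: powr_mult)
      have "cmod (\<phi> u - \<phi> y) \<le> A * (d u y / \<rho>) powr \<eta> * pker 3 \<rho> x u" by (rule hold) fact
      also have "\<dots> \<le> A * (d u y / \<rho>) powr \<tau> * P"
        using AB nn P3 assms True dy \<rho>p by (intro mult_mono mult_left_mono powr_mono') auto
      finally have "cmod (h y) * cmod (\<phi> u - \<phi> y) \<le> (B * ((\<rho>' / (\<rho>' + d u y)) powr \<tau> * pker (g - \<tau>) \<rho>' u y)) * (A * (d u y / \<rho>) powr \<tau> * P)"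
        using h[of y] AB nn by (intro mult_mono) (auto simp: split)
      also have "\<dots> = A * B * ((d u y / \<rho>) powr \<tau> * (\<rho>' / (\<rho>' + d u y)) powr \<tau>) * (P * pker (g - \<tau>) \<rho>' u y)" by simp
      also have "\<dots> \<le> A * B * w * (P * pker (g - \<tau>) \<rho>' u y)"
        using AB nn w by (intro mult_right_mono mult_left_mono) auto
      also have "\<dots> \<le> A * B * w * (P * pker (g - \<tau>) \<rho>' u y + K * (pker 3 \<rho> x y * pker g \<rho> u y))"
        using AB nn K by (intro mult_left_mono) auto
      also have "cmod (h y) * cmod (\<phi> u - \<phi> y) = cmod (h y * \<phi> y - h y * \<phi> u)"
        by (metis norm_minus_commute norm_mult right_diff_distrib)
      finally show ?thesis .
    next
      case False
      have "\<rho>' / (\<rho>' + d u y) \<le> \<rho>' / \<rho>" using False \<rho> \<rho>p by (intro divide_left_mono) auto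
      then have w: "(\<rho>' / (\<rho>' + d u y)) powr \<tau> \<le> w"
        unfolding w_def using assms \<rho> dist_nonneg[of u y] by (intro powr_mono2) auto
      have "cmod (h y) \<le> B * (w * pker (g - \<tau>) \<rho>' u y)"
        using h[of y] w AB unfolding split by (meson mult_left_mono mult_right_mono order_trans pker_nonneg)
      moreover have "cmod (\<phi> u) \<le> A * P"
        using \<phi>[of u] P3 AB by (meson mult_left_mono order_trans)
      ultimately have "cmod (h y * \<phi> u) \<le> (B * (w * pker (g - \<tau>) \<rho>' u y)) * (A * P)"
        unfolding norm_mult using AB nn by (intro mult_mono) auto
      then have 1: "cmod (h y * \<phi> u) \<le> A * B * w * (P * pker (g - \<tau>) \<rho>' u y)" by (simp add: mult_ac)
      \<comment> \<open>Beyond distance \<rho> both scales give comparable arguments, so passing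
        from \<rho>' to \<rho> gains (\<rho>'/\<rho>)^g, which is at most w. Both kernels then have
        scale \<rho>, and their composition is a multiple of P.\<close>
      have "pker g \<rho>' u y \<le> w * (K * pker g \<rho> u y)"
      proof -
        have p: "0 < \<rho>' + d u y" "0 < \<rho> + d u y" using \<rho> \<rho>p dist_nonneg[of u y] by linarith+
        have 2: "\<rho> + d u y \<le> 2 * (\<rho>' + d u y)" using False \<rho> by simp
        have "1 / (\<rho>' + d u y) \<le> 2 / (\<rho> + d u y)" using 2 p by (simp add: field_simps)
        then have "\<rho>' * (1 / (\<rho>' + d u y)) \<le> \<rho>' * (2 / (\<rho> + d u y))" using \<rho> by (intro mult_left_mono) auto
        also have "\<dots> = 2 * (\<rho>' / \<rho>) * (\<rho> / (\<rho> + d u y))" using \<rho>p by simp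
        finally have "\<rho>' / (\<rho>' + d u y) \<le> 2 * (\<rho>' / \<rho>) * (\<rho> / (\<rho> + d u y))" by simp
        then have "(\<rho>' / (\<rho>' + d u y)) powr g \<le> (2 * (\<rho>' / \<rho>) * (\<rho> / (\<rho> + d u y))) powr g"
          using p \<rho> assms by (intro powr_mono2) auto
        also have "\<dots> = 2 powr g * (\<rho>' / \<rho>) powr g * (\<rho> / (\<rho> + d u y)) powr g"
          by (simp only: powr_mult)
        also have "\<dots> \<le> 2 powr g * w * (\<rho> / (\<rho> + d u y)) powr g"
          unfolding w_def using \<rho> \<rho>p assms by (intro mult_right_mono mult_left_mono powr_mono') auto
        finally have e: "(\<rho>' / (\<rho>' + d u y)) powr g \<le> 2 powr g * w * (\<rho> / (\<rho> + d u y)) powr g" .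
        have "V (\<rho> + d u y) u \<le> Cmu * 2 powr hdim * V (\<rho>' + d u y) u"
          by (rule vol_le_scale) (use p 2 in auto)
        then have "1 / V (\<rho>' + d u y) u \<le> Cmu * 2 powr hdim / V (\<rho> + d u y) u"
          using p vol_pos by (simp add: field_simps)
        then have "(\<rho>' / (\<rho>' + d u y)) powr g * (1 / V (\<rho>' + d u y) u)
            \<le> (2 powr g * w * (\<rho> / (\<rho> + d u y)) powr g) * (Cmu * 2 powr hdim / V (\<rho> + d u y) u)"
          using e nn by (intro mult_mono) auto
        then show ?thesis by (simp add: pker_def K_def mult_ac)
      qed
      then have "B * pker g \<rho>' u y \<le> B * (w * (K * pker g \<rho> u y))" by (rule mult_left_mono) fact
      then have "cmod (h y) \<le> B * (w * (K * pker g \<rho> u y))" using h[of y] by linarith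
      then have "cmod (h y * \<phi> y) \<le> (B * (w * (K * pker g \<rho> u y))) * (A * pker 3 \<rho> x y)"
        unfolding norm_mult using AB nn K \<phi>[of y] by (intro mult_mono) auto
      then have 2: "cmod (h y * \<phi> y) \<le> A * B * w * (K * (pker 3 \<rho> x y * pker g \<rho> u y))" by (simp add: mult_ac)
      show ?thesis using 1 2 norm_triangle_ineq4[of "h y * \<phi> y" "h y * \<phi> u"]
        by (simp only: distrib_left)
    qed
    have i1: "integrable M h" using h AB \<rho> assms by (intro integrable_pker_bounded[where g = g and \<rho> = \<rho>' and B = B and x = u]) auto
    have i2: "integrable M (\<lambda>y. h y * \<phi> y)"
      by (rule integrable_pker_product[where f = \<phi> and h = h and \<rho> = \<rho> and \<rho>' = \<rho>' and g = g and G = 3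
            and A = A and B = B and x = x and u = u]) (use \<phi> h AB \<rho> \<rho>p assms in auto)
    have "(\<integral>y. h y * \<phi> y \<partial>M) = (\<integral>y. h y * \<phi> y - h y * \<phi> u \<partial>M)"
      using i1 i2 cancel by simp
    also have "cmod \<dots> \<le> A * B * w * (P * C1 + K * (C2 * P))"
    proof (rule cmod_integral_le)
      have "(\<integral>\<^sup>+y. ennreal (cmod (h y * \<phi> y - h y * \<phi> u)) \<partial>M)
        \<le> (\<integral>\<^sup>+y. ennreal (A * B * w) * (ennreal P * ennreal (pker (g - \<tau>) \<rho>' u y)
              + ennreal K * ennreal (pker 3 \<rho> x y * pker g \<rho> u y)) \<partial>M)"
        using pt AB nn K by (intro nn_integral_mono)
          (auto simp flip: ennreal_mult ennreal_plus intro!: ennreal_leI)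
      also have "\<dots> = ennreal (A * B * w) * (ennreal P * (\<integral>\<^sup>+y. ennreal (pker (g - \<tau>) \<rho>' u y) \<partial>M)
              + ennreal K * (\<integral>\<^sup>+y. ennreal (pker 3 \<rho> x y * pker g \<rho> u y) \<partial>M))"
        by (subst nn_integral_cmult, simp, subst nn_integral_add) (auto simp: nn_integral_cmult)
      also have "\<dots> \<le> ennreal (A * B * w) * (ennreal P * ennreal C1 + ennreal K * ennreal (C2 * P))"
        using C2(2)[of \<rho> \<rho> x u] \<rho> \<rho>p unfolding P_def by (intro mult_left_mono add_mono C1) auto
      also have "\<dots> = ennreal (A * B * w * (P * C1 + K * (C2 * P)))"
        using AB nn K C1 C2 by (simp flip: ennreal_mult ennreal_plus)
      finally show "(\<integral>\<^sup>+y. ennreal (cmod (h y * \<phi> y - h y * \<phi> u)) \<partial>M) \<le> ennreal (A * B * w * (P * C1 + K * (C2 * P)))" .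
    qed (use AB nn K C1 C2 in auto)
    finally show "cmod (\<integral>y. h y * \<phi> y \<partial>M) \<le> (C1 + K * C2) * (A * B) * (\<rho>' / \<rho>) powr \<tau> * pker g \<rho> x u"
      by (simp add: w_def P_def algebra_simps)
  qed
qed

end

section \<open>Dyadic cubes\<close>

text \<open>At most one summand survives. Unordered sums of nonnegative terms are written as
  integrals over \<open>count_space\<close>, so that interchanging them with integrals is Tonelli's
  theorem.\<close>

lemma nn_integral_disjoint_indicator_le:
  assumes "disjoint_family_on F I"
  shows "(\<integral>\<^sup>+i. c * indicator (F i) y \<partial>count_space I) \<le> c"
proof (cases "\<exists>j\<in>I. y \<in> F j")
  case True
  then obtain j where j: "j \<in> I" "y \<in> F j" by blast
  have "(\<integral>\<^sup>+i. c * indicator (F i) y \<partial>count_space I) = (\<integral>\<^sup>+i. c * indicator {j} i \<partial>count_space I)"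
    using j disjoint_family_onD[OF assms]
    by (intro nn_integral_cong) (auto simp: indicator_def)
  also have "\<dots> = c"
    using j by (simp add: nn_integral_cmult_indicator)
  finally show ?thesis by simp
next
  case False
  then have "(\<integral>\<^sup>+i. c * indicator (F i) y \<partial>count_space I) = (\<integral>\<^sup>+i. 0 \<partial>count_space I)"
    by (intro nn_integral_cong) auto
  then show ?thesis by simp
qed

context homogeneous_type
begin

section \<open>Sigma-finiteness and countable index sets\<close>

lemma sigma_finite: "sigma_finite_measure M"
proof
  let ?A = "range (\<lambda>n. qball d undefined (real n))"
  have "x \<in> \<Union>?A" for x
  proof -
    obtain n where "d undefined x < real n" using reals_Archimedean2 by blast
    then show ?thesis by (auto simp: qball_def)
  qed
  then have "\<Union>?A = space M" by (auto simp: space_UNIV)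
  then show "\<exists>A. countable A \<and> A \<subseteq> sets M \<and> \<Union>A = space M \<and> (\<forall>a\<in>A. emeasure M a \<noteq> \<infinity>)"
    by (intro exI[of _ ?A]) (auto simp: emeasure_qball)
qed

text \<open>Inside a fixed ball the disjoint pieces have summable measures, so only countably many
  of them are not null, and every F j has positive measure in some ball of the exhaustion.
  Countability of the index sets of cubes is what Tonelli's theorem asks for.\<close>

lemma countable_disjoint_positive:
  assumes dis: "disjoint_family_on F J" and F: "\<And>j. j \<in> J \<Longrightarrow> F j \<in> sets M \<and> 0 < emeasure M (F j)"
  shows "countable J"
proof -
  let ?B = "\<lambda>n. qball d undefined (real n)"
  have fin: "emeasure M (F j \<inter> ?B n) \<noteq> \<infinity>" for j n
    using emeasure_mono[of "F j \<inter> ?B n" "?B n" M] by (auto simp: emeasure_qball top_unique)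
  have "(\<lambda>j. measure M (F j \<inter> ?B n)) summable_on J" for n
  proof (rule nonneg_bdd_above_summable_on)
    show "bdd_above (sum (\<lambda>j. measure M (F j \<inter> ?B n)) ` {S. S \<subseteq> J \<and> finite S})"
    proof (rule bdd_aboveI2)
      fix S assume S: "S \<in> {S. S \<subseteq> J \<and> finite S}"
      have "(\<Sum>j\<in>S. measure M (F j \<inter> ?B n)) = measure M (\<Union>j\<in>S. F j \<inter> ?B n)"
      proof (rule measure_finite_Union[symmetric])
        show "disjoint_family_on (\<lambda>j. F j \<inter> ?B n) S"
          using S dis by (auto simp: disjoint_family_on_def)
        show "(\<lambda>j. F j \<inter> ?B n) ` S \<subseteq> sets M" using S F by (blast intro: sets.Int qball_sets)
      qed (use S fin in auto)
      also have "\<dots> \<le> measure M (?B n)"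
      proof (rule measure_mono_fmeasurable)
        show "(\<Union>j\<in>S. F j \<inter> ?B n) \<in> sets M" using S F by (intro sets.finite_UN) (blast intro: sets.Int qball_sets)+
        show "?B n \<in> fmeasurable M" by (intro fmeasurableI) (auto simp: emeasure_qball)
      qed auto
      finally show "(\<Sum>j\<in>S. measure M (F j \<inter> ?B n)) \<le> measure M (?B n)" .
    qed
  qed auto
  then have c: "countable {j \<in> J. measure M (F j \<inter> ?B n) \<noteq> 0}" for n
    by (rule summable_countable_real)
  have "J \<subseteq> (\<Union>n. {j \<in> J. measure M (F j \<inter> ?B n) \<noteq> 0})"
  proof (rule subsetI, rule ccontr)
    fix j assume j: "j \<in> J" "j \<notin> (\<Union>n. {j \<in> J. measure M (F j \<inter> ?B n) \<noteq> 0})"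
    then have "emeasure M (F j \<inter> ?B n) = 0" for n
      using fin[of j n] by (auto simp: measure_def enn2real_eq_0_iff)
    then have "emeasure M (\<Union>n. F j \<inter> ?B n) = 0"
      using F j(1) by (intro emeasure_UN_eq_0) (auto intro: sets.Int qball_sets)
    moreover have "(\<Union>n. F j \<inter> ?B n) = F j"
      using reals_Archimedean2 by (fastforce simp: qball_def)
    ultimately have "emeasure M (F j) = 0" by metis
    then show False using F[OF j(1)] by simp
  qed
  moreover have "countable (\<Union>n. {j \<in> J. measure M (F j \<inter> ?B n) \<noteq> 0})"
    using c by (intro countable_UN) auto
  ultimately show ?thesis by (rule countable_subset)
qed

end

context dyadic_system
begin

definition idx :: "nat \<Rightarrow> ('i \<times> nat) set" where
  "idx k = (SIGMA \<alpha>:A (int k). {1..cnt (int k) \<alpha>})"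

definition subc :: "nat \<Rightarrow> 'i \<times> nat \<Rightarrow> 'a set" where
  "subc k i = sub (int k) (fst i) (snd i)"

abbreviation sample_points :: "(nat \<Rightarrow> 'i \<times> nat \<Rightarrow> 'a) \<Rightarrow> bool" where
  "sample_points u \<equiv> \<forall>k. \<forall>i\<in>idx k. u k i \<in> subc k i"

section \<open>Size and measure of cubes and subcubes\<close>

lemma C0_pos: "0 < C0" using c0_pos c0_le_C0 by simp

lemma cube_center: "\<tau> \<in> A l \<Longrightarrow> z l \<tau> \<in> cube l \<tau>"
  using cube_inner[of \<tau> l] c0_pos delta_pos A0_pos by (auto simp: qball_def)

lemma subc_cube:
  assumes "i \<in> idx k"
  obtains \<tau> where "\<tau> \<in> A (int k + int j0)" "subc k i = cube (int k + int j0) \<tau>"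
    "subc k i \<subseteq> cube (int k) (fst i)" "fst i \<in> A (int k)"
proof -
  have i: "fst i \<in> A (int k)" "snd i \<in> {1..cnt (int k) (fst i)}"
    using assms by (auto simp: idx_def)
  then have "sub (int k) (fst i) (snd i) \<in> {cube (int k + int j0) \<tau> | \<tau>. \<tau> \<in> A (int k + int j0) \<and> cube (int k + int j0) \<tau> \<subseteq> cube (int k) (fst i)}"
    using sub_enum[OF i(1)] bij_betwE by blast
  then show ?thesis using that i by (auto simp: subc_def)
qed

lemma subc_nonempty: "i \<in> idx k \<Longrightarrow> subc k i \<noteq> {}"
  using subc_cube cube_center by (metis empty_iff)

text \<open>Subcubes of different parents lie in disjoint parents; for the same parent, injectivity
  of the enumeration yields different cubes of level k + j0.\<close>

lemma disjoint_subc: "disjoint_family_on (subc k) (idx k)"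
  unfolding disjoint_family_on_def
proof (intro ballI impI)
  fix i j assume ij: "i \<in> idx k" "j \<in> idx k" "i \<noteq> j"
  obtain \<tau> where t: "\<tau> \<in> A (int k + int j0)" "subc k i = cube (int k + int j0) \<tau>"
    "subc k i \<subseteq> cube (int k) (fst i)" "fst i \<in> A (int k)" using subc_cube[OF ij(1)] .
  obtain \<tau>' where t': "\<tau>' \<in> A (int k + int j0)" "subc k j = cube (int k + int j0) \<tau>'"
    "subc k j \<subseteq> cube (int k) (fst j)" "fst j \<in> A (int k)" using subc_cube[OF ij(2)] .
  show "subc k i \<inter> subc k j = {}"
  proof (cases "fst i = fst j")
    case True
    then have "snd i \<noteq> snd j" using ij by (metis prod_eqI)
    moreover have "snd i \<in> {1..cnt (int k) (fst i)}" "snd j \<in> {1..cnt (int k) (fst i)}"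
      using ij True by (auto simp: idx_def)
    ultimately have "subc k i \<noteq> subc k j"
      using bij_betw_imp_inj_on[OF sub_enum[OF t(4)]] True unfolding subc_def by (metis inj_onD)
    then have "\<tau> \<noteq> \<tau>'" using t t' by auto
    then show ?thesis using disjoint_family_onD[OF cube_disjoint t(1) t'(1)] t t' by simp
  next
    case False
    then show ?thesis using disjoint_family_onD[OF cube_disjoint t(4) t'(4)] t t' by blast
  qed
qed

lemma powi_level: "\<delta> powi (int k + int j0) = \<delta> ^ k * \<delta> ^ j0"
  by (metis of_nat_add power_add power_int_of_nat)

text \<open>Every point of a cube of level l is within 2 A0 C0 \<delta>^l of its centre; the
  quasi-triangle inequality multiplies the sum of two such distances by A0.\<close>

definition diam_const :: real where "diam_const = 4 * A0\<^sup>2 * C0"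

lemma diam_const_pos: "0 < diam_const"
  using A0_pos C0_pos by (simp add: diam_const_def)

lemma cube_diam:
  assumes "\<tau> \<in> A l" "u \<in> cube l \<tau>" "y \<in> cube l \<tau>"
  shows "d u y \<le> diam_const * \<delta> powi l"
proof -
  have "d (z l \<tau>) u < 2 * A0 * C0 * \<delta> powi l" "d (z l \<tau>) y < 2 * A0 * C0 * \<delta> powi l"
    using cube_outer[OF assms(1)] assms by (auto simp: qball_def)
  then have "d u (z l \<tau>) + d (z l \<tau>) y \<le> 4 * A0 * C0 * \<delta> powi l"
    by (simp add: dist_sym[of u])
  then have "A0 * (d u (z l \<tau>) + d (z l \<tau>) y) \<le> A0 * (4 * A0 * C0 * \<delta> powi l)"
    using A0_pos by (intro mult_left_mono) auto
  then show ?thesis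
    using quasi_triangle[of u y "z l \<tau>"] by (simp add: diam_const_def power2_eq_square mult_ac)
qed

lemma cube_emeasure:
  assumes "\<tau> \<in> A l"
  shows "emeasure M (cube l \<tau>) = ennreal (measure M (cube l \<tau>))"
proof -
  have "emeasure M (cube l \<tau>) \<le> emeasure M (qball d (z l \<tau>) (2 * A0 * C0 * \<delta> powi l))"
    using cube_outer[OF assms] by (intro emeasure_mono) auto
  also have "\<dots> < \<infinity>" by (rule emeasure_qball_finite)
  finally show ?thesis by (intro emeasure_eq_ennreal_measure) auto
qed

text \<open>The ball of radius \<delta>^l about any point of the cube lies in a fixed multiple of
  the inner ball at the centre, and the cube contains that inner ball.\<close>

lemma vol_le_cube:
  obtains C where "0 < C" "\<And>l \<tau> u. \<tau> \<in> A l \<Longrightarrow> u \<in> cube l \<tau> \<Longrightarrow> V (\<delta> powi l) u \<le> C * measure M (cube l \<tau>)"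
proof -
  define c where "c = c0 / (3 * A0\<^sup>2)"
  have c: "0 < c" using c0_pos A0_pos by (simp add: c_def)
  define t where "t = max 1 (A0 * (1 + 2 * A0 * C0) / c)"
  have t: "1 \<le> t" "A0 * (1 + 2 * A0 * C0) / c \<le> t" by (simp_all add: t_def)
  show ?thesis
  proof (rule that)
    show "0 < Cmu * t powr hdim" using t Cmu_ge_1 by simp
    fix l \<tau> u assume a: "\<tau> \<in> A l" "u \<in> cube l \<tau>"
    define r where "r = \<delta> powi l"
    have r: "0 < r" using delta_pos by (simp add: r_def)
    have du: "d (z l \<tau>) u \<le> 2 * A0 * C0 * r"
      using cube_outer[OF a(1)] a by (auto simp: qball_def r_def)
    have "V r u \<le> V (A0 * (r + d (z l \<tau>) u)) (z l \<tau>)" by (rule vol_shift)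
    also have "\<dots> \<le> Cmu * t powr hdim * V (c * r) (z l \<tau>)"
    proof (rule vol_le_scale)
      have "A0 * (r + d (z l \<tau>) u) \<le> A0 * (r + 2 * A0 * C0 * r)"
        using du A0_pos by (intro mult_left_mono) auto
      also have "\<dots> = (A0 * (1 + 2 * A0 * C0) / c) * (c * r)" using c by (simp add: field_simps)
      also have "\<dots> \<le> t * (c * r)" using t c r by (intro mult_right_mono) auto
      finally show "A0 * (r + d (z l \<tau>) u) \<le> t * (c * r)" .
    qed (use c r t in auto)
    also have "V (c * r) (z l \<tau>) \<le> measure M (cube l \<tau>)"
    proof -
      have "ennreal (V (c * r) (z l \<tau>)) \<le> ennreal (measure M (cube l \<tau>))"
        unfolding emeasure_qball[symmetric] cube_emeasure[OF a(1), symmetric]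
        using cube_inner[OF a(1)] cube_measurable[OF a(1)] by (intro emeasure_mono) (auto simp: c_def r_def)
      then show ?thesis by simp
    qed
    finally show "V (\<delta> powi l) u \<le> Cmu * t powr hdim * measure M (cube l \<tau>)"
      using Cmu_ge_1 by (simp add: r_def mult_left_mono)
  qed
qed

lemma cube_measure_pos: "\<tau> \<in> A l \<Longrightarrow> 0 < measure M (cube l \<tau>)"
proof -
  assume a: "\<tau> \<in> A l"
  obtain C where C: "0 < C" "\<And>l \<tau> u. \<tau> \<in> A l \<Longrightarrow> u \<in> cube l \<tau> \<Longrightarrow> V (\<delta> powi l) u \<le> C * measure M (cube l \<tau>)"
    using vol_le_cube by blast
  have "0 < V (\<delta> powi l) (z l \<tau>)" using delta_pos by (intro vol_pos) simp
  also have "\<dots> \<le> C * measure M (cube l \<tau>)" using a by (intro C cube_center)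
  finally show ?thesis using C by (simp add: zero_less_mult_iff)
qed

lemma countable_A: "countable (A l)"
  by (rule countable_disjoint_positive[OF cube_disjoint[of l]])
    (auto simp: cube_emeasure cube_measurable cube_measure_pos)

lemma subc_sets [measurable]: "i \<in> idx k \<Longrightarrow> subc k i \<in> sets M"
  by (metis subc_cube cube_measurable)

lemma subc_emeasure: "i \<in> idx k \<Longrightarrow> emeasure M (subc k i) = ennreal (measure M (subc k i))"
  by (metis subc_cube cube_emeasure)

lemma subc_measure_pos: "i \<in> idx k \<Longrightarrow> 0 < measure M (subc k i)"
  by (metis subc_cube cube_measure_pos)

lemma delta_power_le1: "\<delta> ^ k \<le> 1"
  using delta_pos delta_less_1 by (intro power_le_one) auto

lemma subc_diam:
  assumes "i \<in> idx k" "u \<in> subc k i" "y \<in> subc k i"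
  shows "d u y \<le> diam_const * \<delta> ^ k"
proof -
  obtain \<tau> where t: "\<tau> \<in> A (int k + int j0)" "subc k i = cube (int k + int j0) \<tau>"
    using subc_cube[OF assms(1)] .
  have "d u y \<le> diam_const * (\<delta> ^ k * \<delta> ^ j0)"
    using cube_diam[OF t(1)] assms t by (simp add: powi_level)
  also have "\<dots> \<le> diam_const * (\<delta> ^ k * 1)"
    using diam_const_pos delta_pos delta_power_le1 by (intro mult_left_mono) auto
  finally show ?thesis by simp
qed

text \<open>A subcube is a cube j0 levels deeper; the fixed ratio \<delta>^j0 of the scales is
  absorbed by volume growth.\<close>

lemma vol_le_subc:
  obtains C where "0 < C" "\<And>k i u. i \<in> idx k \<Longrightarrow> u \<in> subc k i \<Longrightarrow> V (\<delta> ^ k) u \<le> C * measure M (subc k i)"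
proof -
  obtain C where C: "0 < C" "\<And>l \<tau> u. \<tau> \<in> A l \<Longrightarrow> u \<in> cube l \<tau> \<Longrightarrow> V (\<delta> powi l) u \<le> C * measure M (cube l \<tau>)"
    using vol_le_cube by blast
  define t where "t = 1 / \<delta> ^ j0"
  have t: "1 \<le> t" using delta_pos delta_power_le1 by (simp add: t_def)
  show ?thesis
  proof (rule that)
    show "0 < Cmu * t powr hdim * C" using t C Cmu_ge_1 by simp
    fix k i u assume a: "i \<in> idx k" "u \<in> subc k i"
    obtain \<tau> where \<tau>: "\<tau> \<in> A (int k + int j0)" "subc k i = cube (int k + int j0) \<tau>"
      using subc_cube[OF a(1)] .
    have "V (\<delta> ^ k) u \<le> Cmu * t powr hdim * V (\<delta> ^ k * \<delta> ^ j0) u"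
      by (rule vol_le_scale) (use t delta_pos in \<open>auto simp: t_def\<close>)
    also have "V (\<delta> ^ k * \<delta> ^ j0) u \<le> C * measure M (subc k i)"
      using C(2)[OF \<tau>(1)] a \<tau> by (simp add: powi_level)
    finally show "V (\<delta> ^ k) u \<le> Cmu * t powr hdim * C * measure M (subc k i)"
      using Cmu_ge_1 by (simp add: mult_left_mono mult.assoc)
  qed
qed

lemma countable_idx: "countable (idx k)"
  unfolding idx_def by (intro countable_SIGMA countable_A) auto

text \<open>Two points of a subcube of level k are at most \<open>diam_const\<close> times
  \<delta>^k \<le> \<rho> apart, so a kernel of scale \<rho> may be evaluated at any of its points,
  up to a constant. This is what frees the later constants from the choice of the sample
  points.\<close>

lemma subc_compare:
  obtains t where "1 \<le> t" "\<And>k i u y \<rho> x. i \<in> idx k \<Longrightarrow> u \<in> subc k i \<Longrightarrow> y \<in> subc k i \<Longrightarrow> \<delta> ^ k \<le> \<rho> \<Longrightarrow>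
      \<rho> + d x y \<le> t * (\<rho> + d x u)"
proof (rule that)
  show "1 \<le> A0 * (1 + diam_const)"
    using mult_mono[of 1 A0 1 "1 + diam_const"] A0_ge_1 diam_const_pos by simp
  fix k i u y \<rho> x
  assume a: "i \<in> idx k" "u \<in> subc k i" "y \<in> subc k i" "\<delta> ^ k \<le> (\<rho>::real)"
  have \<rho>: "0 < \<rho>" using a delta_pos by (smt (verit) zero_less_power)
  have "d u y \<le> diam_const * \<rho>"
    using subc_diam[OF a(1-3)] a(4) diam_const_pos by (smt (verit) mult_left_mono)
  then have "A0 * (d x u + d u y) \<le> A0 * (d x u + diam_const * \<rho>)"
    using A0_pos by (intro mult_left_mono) auto
  then have "d x y \<le> A0 * (d x u + diam_const * \<rho>)" using quasi_triangle[of x y u] by linarith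
  moreover have "1 * \<rho> \<le> A0 * \<rho>" using A0_ge_1 \<rho> by (intro mult_right_mono) auto
  moreover have "0 \<le> A0 * diam_const * d x u" using A0_pos diam_const_pos dist_nonneg by simp
  ultimately show "\<rho> + d x y \<le> A0 * (1 + diam_const) * (\<rho> + d x u)"
    by (simp add: algebra_simps)
qed

text \<open>The sum is a Riemann sum: each value at \<open>u i\<close> is compared with the mean of
  the kernel over the subcube, and the subcubes are disjoint.\<close>

lemma sum_pker_le:
  assumes "0 < g"
  obtains C where "0 < C" "\<And>k \<rho> x u. \<delta> ^ k \<le> \<rho> \<Longrightarrow> (\<And>i. i \<in> idx k \<Longrightarrow> u i \<in> subc k i) \<Longrightarrow>
    (\<integral>\<^sup>+i. ennreal (measure M (subc k i) * pker g \<rho> x (u i)) \<partial>count_space (idx k)) \<le> ennreal C"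
proof -
  obtain t where t: "1 \<le> t" "\<And>k i u y \<rho> x. i \<in> idx k \<Longrightarrow> u \<in> subc k i \<Longrightarrow> y \<in> subc k i \<Longrightarrow> \<delta> ^ k \<le> \<rho> \<Longrightarrow>
      \<rho> + d x y \<le> t * (\<rho> + d x u)" using subc_compare by blast
  obtain C where C: "0 < C" "\<And>\<rho> x. 0 < \<rho> \<Longrightarrow> (\<integral>\<^sup>+y. ennreal (pker g \<rho> x y) \<partial>M) \<le> ennreal C"
    using pker_integral assms by blast
  define K where "K = Cmu * t powr hdim * t powr g"
  have K: "0 < K" using t Cmu_ge_1 by (simp add: K_def)
  show ?thesis
  proof (rule that)
    show "0 < K * C" using K C by simp
    fix k \<rho> x u assume \<rho>: "\<delta> ^ k \<le> (\<rho>::real)" and u: "\<And>i. i \<in> idx k \<Longrightarrow> u i \<in> subc k i"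
    have \<rho>0: "0 < \<rho>" using \<rho> delta_pos by (smt (verit) zero_less_power)
    have meas: "(\<lambda>y. ennreal (pker g \<rho> x y) * indicator (subc k i) y) \<in> borel_measurable M" if "i \<in> idx k" for i
      using that by (intro borel_measurable_times_ennreal) auto
    have "(\<integral>\<^sup>+i. ennreal (measure M (subc k i) * pker g \<rho> x (u i)) \<partial>count_space (idx k))
      \<le> (\<integral>\<^sup>+i. ennreal K * (\<integral>\<^sup>+y. ennreal (pker g \<rho> x y) * indicator (subc k i) y \<partial>M) \<partial>count_space (idx k))"
    proof (intro nn_integral_mono)
      fix i assume "i \<in> space (count_space (idx k))"
      then have i: "i \<in> idx k" by simp
      have "ennreal (measure M (subc k i) * pker g \<rho> x (u i)) = (\<integral>\<^sup>+y. ennreal (pker g \<rho> x (u i)) * indicator (subc k i) y \<partial>M)"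
        using i by (subst nn_integral_cmult_indicator) (auto simp: subc_emeasure ennreal_mult' mult.commute)
      also have "\<dots> \<le> (\<integral>\<^sup>+y. ennreal K * (ennreal (pker g \<rho> x y) * indicator (subc k i) y) \<partial>M)"
      proof (intro nn_integral_mono)
        fix y
        show "ennreal (pker g \<rho> x (u i)) * indicator (subc k i) y \<le> ennreal K * (ennreal (pker g \<rho> x y) * indicator (subc k i) y)"
        proof (cases "y \<in> subc k i")
          case True
          have "pker g \<rho> x (u i) \<le> K * pker g \<rho> x y"
            unfolding K_def using \<rho>0 t i u True \<rho> assms by (intro pker_compare) auto
          then show ?thesis using True K by (simp flip: ennreal_mult add: ennreal_leI)
        qed simp
      qed
      also have "\<dots> = ennreal K * (\<integral>\<^sup>+y. ennreal (pker g \<rho> x y) * indicator (subc k i) y \<partial>M)"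
        using meas[OF i] by (rule nn_integral_cmult)
      finally show "ennreal (measure M (subc k i) * pker g \<rho> x (u i))
        \<le> ennreal K * (\<integral>\<^sup>+y. ennreal (pker g \<rho> x y) * indicator (subc k i) y \<partial>M)" .
    qed
    also have "\<dots> = ennreal K * (\<integral>\<^sup>+i. (\<integral>\<^sup>+y. ennreal (pker g \<rho> x y) * indicator (subc k i) y \<partial>M) \<partial>count_space (idx k))"
      by (rule nn_integral_cmult) simp
    also have "(\<integral>\<^sup>+i. (\<integral>\<^sup>+y. ennreal (pker g \<rho> x y) * indicator (subc k i) y \<partial>M) \<partial>count_space (idx k))
        = (\<integral>\<^sup>+y. (\<integral>\<^sup>+i. ennreal (pker g \<rho> x y) * indicator (subc k i) y \<partial>count_space (idx k)) \<partial>M)"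
      by (rule nn_integral_count_space_nn_integral[symmetric, OF countable_idx meas])
    also have "\<dots> \<le> (\<integral>\<^sup>+y. ennreal (pker g \<rho> x y) \<partial>M)"
      by (intro nn_integral_mono nn_integral_disjoint_indicator_le disjoint_subc)
    also have "\<dots> \<le> ennreal C" using \<rho>0 by (rule C)
    finally show "(\<integral>\<^sup>+i. ennreal (measure M (subc k i) * pker g \<rho> x (u i)) \<partial>count_space (idx k)) \<le> ennreal (K * C)"
      using K C by (simp add: ennreal_mult mult_left_mono)
  qed
qed

end

section \<open>Pairings with the reproducing kernels\<close>

context dyadic_system
begin

text \<open>The part of \<open>crf_integer\<close> that concerns the kernels alone. \<open>C\<close>
  is a parameter because it stays the same for all choices of sample points, while \<open>K\<close>
  changes with them.\<close>

definition crf_kernel :: "real \<Rightarrow> real \<Rightarrow> real \<Rightarrow> nat \<Rightarrow> (nat \<Rightarrow> 'a \<Rightarrow> 'a \<Rightarrow> complex) \<Rightarrow> bool" where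
  "crf_kernel C \<beta> \<gamma> N K \<longleftrightarrow>
     (\<forall>k. L2_integral_operator M (K k)) \<and>
     (\<forall>k x y. cmod (K k x y) \<le> C * decay_bound M d \<delta> \<gamma> k x y) \<and>
     (\<forall>k x x' y. d x x' \<le> (\<delta> ^ k + d x y) / (2 * A0) \<longrightarrow>
        cmod (K k x y - K k x' y)
          \<le> C * (d x x' / (\<delta> ^ k + d x y)) powr \<beta> * decay_bound M d \<delta> \<gamma> k x y) \<and>
     (\<forall>k x. (\<integral>y. K k x y \<partial>M) = (if k \<le> N then 1 else 0) \<and>
            (\<integral>y. K k y x \<partial>M) = (if k \<le> N then 1 else 0))"

text \<open>
  The factor of the summand with index \<open>(k, i)\<close> that is integrated against the test function,
  divided by the measure of the subcube.  At level 0 the kernel is averaged over the subcube, which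
  preserves its size and regularity up to constants.
\<close>

definition crf_profile :: "(nat \<Rightarrow> 'a \<Rightarrow> 'a \<Rightarrow> complex) \<Rightarrow> (nat \<Rightarrow> 'i \<times> nat \<Rightarrow> 'a) \<Rightarrow> nat \<Rightarrow> 'i \<times> nat \<Rightarrow> 'a \<Rightarrow> complex" where
  "crf_profile K u k i x =
     (if k = 0 then (LINT y:subc 0 i|M. K 0 x y) / complex_of_real (measure M (subc 0 i)) else K k x (u k i))"

lemma L2_kernel_measurable:
  assumes "L2_integral_operator M K"
  shows "(\<lambda>(x, y). K x y) \<in> borel_measurable (M \<Otimes>\<^sub>M M)"
    "(\<lambda>y. K x y) \<in> borel_measurable M" "(\<lambda>x. K x y) \<in> borel_measurable M"
proof -
  show *: "(\<lambda>(x, y). K x y) \<in> borel_measurable (M \<Otimes>\<^sub>M M)"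
    using assms by (simp add: L2_integral_operator_def)
  show "(\<lambda>y. K x y) \<in> borel_measurable M"
    using measurable_compose[OF measurable_Pair1'[of x M M] *] by (simp add: space_UNIV)
  show "(\<lambda>x. K x y) \<in> borel_measurable M"
    using measurable_compose[OF measurable_Pair2'[of y M M] *] by (simp add: space_UNIV)
qed

lemma crf_profile_measurable:
  assumes "crf_kernel C \<beta> \<gamma> N K" "i \<in> idx k"
  shows "crf_profile K u k i \<in> borel_measurable M"
proof (cases "k = 0")
  case True
  have L2: "L2_integral_operator M (K 0)" using assms(1) by (simp add: crf_kernel_def)
  have E: "subc 0 i \<in> sets M" using assms True by auto
  have "(\<lambda>(x, y'). indicator (subc 0 i) y' *\<^sub>R K 0 x y') \<in> borel_measurable (M \<Otimes>\<^sub>M M)"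
  proof -
    note [measurable] = L2_kernel_measurable(1)[OF L2] E
    have "(\<lambda>p. indicator (subc 0 i) (snd p) *\<^sub>R (case p of (x, y) \<Rightarrow> K 0 x y)) \<in> borel_measurable (M \<Otimes>\<^sub>M M)"
      by measurable
    then show ?thesis by (simp add: case_prod_beta')
  qed
  then have "(\<lambda>x. (LINT y:subc 0 i|M. K 0 x y) / complex_of_real (measure M (subc 0 i))) \<in> borel_measurable M"
    unfolding set_lebesgue_integral_def
    by (intro borel_measurable_divide sigma_finite_measure.borel_measurable_lebesgue_integral[OF sigma_finite]) auto
  moreover have "crf_profile K u k i = (\<lambda>x. (LINT y:subc 0 i|M. K 0 x y) / complex_of_real (measure M (subc 0 i)))"
    using True by (simp add: crf_profile_def fun_eq_iff)
  ultimately show ?thesis by simp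
next
  case False
  then have "crf_profile K u k i = (\<lambda>x. K k x (u k i))"
    by (simp add: crf_profile_def fun_eq_iff)
  then show ?thesis
    using assms(1) L2_kernel_measurable(3)[of "K k" "u k i"] by (simp add: crf_kernel_def)
qed

lemma crf_kernel_le_pker:
  assumes "crf_kernel C \<beta> \<gamma> N K" "0 \<le> C"
  shows "cmod (K k x y) \<le> C * Cmu * pker \<gamma> (\<delta> ^ k) x y"
    "d x x' \<le> (\<delta> ^ k + d x y) / (2 * A0) \<Longrightarrow>
       cmod (K k x y - K k x' y) \<le> C * Cmu * (d x x' / (\<delta> ^ k + d x y)) powr \<beta> * pker \<gamma> (\<delta> ^ k) x y"
proof -
  have le: "C * w * decay_bound M d \<delta> \<gamma> k x y \<le> C * w * (Cmu * pker \<gamma> (\<delta> ^ k) x y)" if "0 \<le> w" for w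
    using assms delta_pos that by (intro mult_left_mono decay_le_pker) auto
  show "cmod (K k x y) \<le> C * Cmu * pker \<gamma> (\<delta> ^ k) x y"
    using assms(1) le[of 1] unfolding crf_kernel_def by (simp add: mult.assoc) (meson order_trans)
  assume "d x x' \<le> (\<delta> ^ k + d x y) / (2 * A0)"
  then have "cmod (K k x y - K k x' y) \<le> C * (d x x' / (\<delta> ^ k + d x y)) powr \<beta> * decay_bound M d \<delta> \<gamma> k x y"
    using assms(1) unfolding crf_kernel_def by blast
  also have "\<dots> \<le> C * (d x x' / (\<delta> ^ k + d x y)) powr \<beta> * (Cmu * pker \<gamma> (\<delta> ^ k) x y)"
    by (rule le) simp
  finally show "cmod (K k x y - K k x' y) \<le> C * Cmu * (d x x' / (\<delta> ^ k + d x y)) powr \<beta> * pker \<gamma> (\<delta> ^ k) x y"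
    by (simp add: mult_ac)
qed

lemma mean_le:
  fixes h :: "'a \<Rightarrow> complex"
  assumes "i \<in> idx k" "\<And>y. y \<in> subc k i \<Longrightarrow> cmod (h y) \<le> b" "0 \<le> b"
  shows "cmod ((LINT y:subc k i|M. h y) / complex_of_real (measure M (subc k i))) \<le> b"
proof -
  have "cmod (LINT y:subc k i|M. h y) \<le> b * measure M (subc k i)"
    unfolding set_lebesgue_integral_def
  proof (rule cmod_integral_le)
    have "(\<integral>\<^sup>+y. ennreal (cmod (indicator (subc k i) y *\<^sub>R h y)) \<partial>M) \<le> (\<integral>\<^sup>+y. ennreal b * indicator (subc k i) y \<partial>M)"
      using assms(2) by (intro nn_integral_mono) (auto simp: indicator_def ennreal_leI)
    also have "\<dots> = ennreal (b * measure M (subc k i))"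
      using assms by (subst nn_integral_cmult_indicator) (auto simp: subc_emeasure ennreal_mult)
    finally show "(\<integral>\<^sup>+y. ennreal (cmod (indicator (subc k i) y *\<^sub>R h y)) \<partial>M) \<le> ennreal (b * measure M (subc k i))" .
  qed (use assms in auto)
  then show ?thesis
    using subc_measure_pos[OF assms(1)] by (simp add: norm_divide divide_le_eq)
qed

text \<open>Recentres the bounds at the sample point, in the form that the pairing estimates require
  of h. The constants B and c depend on neither \<open>K\<close> nor \<open>u\<close>.\<close>

lemma crf_profile_bounds:
  assumes "0 < C" "0 < \<beta>" "\<beta> \<le> 1" "0 < \<gamma>"
  obtains B c where "0 < B" "0 < c" "c \<le> 1"
    "\<And>N K u k i. crf_kernel C \<beta> \<gamma> N K \<Longrightarrow> i \<in> idx k \<Longrightarrow> u k i \<in> subc k i \<Longrightarrow>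
      crf_profile K u k i \<in> borel_measurable M \<and>
      (\<forall>y. cmod (crf_profile K u k i y) \<le> B * pker \<gamma> (\<delta> ^ k) (u k i) y) \<and>
      (\<forall>x y. d x y \<le> c * (\<delta> ^ k + d x (u k i)) \<longrightarrow>
         cmod (crf_profile K u k i x - crf_profile K u k i y)
           \<le> B * (d x y / (\<delta> ^ k + d x (u k i))) powr \<beta> * pker \<gamma> (\<delta> ^ k) (u k i) x) \<and>
      (N < k \<longrightarrow> (\<integral>y. crf_profile K u k i y \<partial>M) = 0)"
proof -
  obtain t where t: "1 \<le> t" "\<And>k i u y \<rho> x. i \<in> idx k \<Longrightarrow> u \<in> subc k i \<Longrightarrow> y \<in> subc k i \<Longrightarrow> \<delta> ^ k \<le> \<rho> \<Longrightarrow>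
      \<rho> + d x y \<le> t * (\<rho> + d x u)" using subc_compare by blast
  define S where "S = Cmu * (2 * A0) powr hdim"
  define J where "J = Cmu * t powr hdim * t powr \<gamma>"
  \<comment> \<open>The factor t is for level 0: an increment that is admissible at u has to be
    admissible at every point of the subcube over which the kernel is averaged.\<close>
  define c where "c = 1 / (2 * A0 * t)"
  define B where "B = C * Cmu * (1 + t powr \<beta>) * (1 + J) * S"
  have pos: "0 < S" "0 < J" "0 < t" "0 < Cmu" using Cmu_ge_1 A0_pos t by (auto simp: S_def J_def)
  have c: "0 < c" "c \<le> 1 / (2 * A0)" "c \<le> 1"
  proof -
    have "1 * 1 \<le> A0 * t" using A0_ge_1 t by (intro mult_mono) auto
    then show "c \<le> 1" by (simp add: c_def divide_le_eq)
    show "c \<le> 1 / (2 * A0)" using A0_pos t by (simp add: c_def divide_simps)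
  qed (use A0_pos pos in \<open>simp add: c_def\<close>)
  have B1: "C * Cmu * S \<le> B" "C * Cmu * J * S \<le> B" "C * Cmu * t powr \<beta> * J * S \<le> B"
  proof -
    have "B = C * Cmu * S + C * Cmu * J * S + C * Cmu * t powr \<beta> * S + C * Cmu * t powr \<beta> * J * S"
      by (simp add: B_def algebra_simps)
    moreover have "0 \<le> C * Cmu * S" "0 \<le> C * Cmu * J * S" "0 \<le> C * Cmu * t powr \<beta> * S" "0 \<le> C * Cmu * t powr \<beta> * J * S"
      using assms pos by auto
    ultimately show "C * Cmu * S \<le> B" "C * Cmu * J * S \<le> B" "C * Cmu * t powr \<beta> * J * S \<le> B" by linarith+
  qed
  have sym: "a * pker \<gamma> (\<delta> ^ k) x y \<le> a * (S * pker \<gamma> (\<delta> ^ k) y x)" if "0 \<le> a" for a k x y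
    unfolding S_def using that delta_pos by (intro mult_left_mono pker_sym) auto
  have Bp: "a * (S * pker \<gamma> (\<delta> ^ k) y x) \<le> B * w * pker \<gamma> (\<delta> ^ k) y x" if "a * S \<le> B * w" for a w k x y
    using mult_right_mono[OF that, of "pker \<gamma> (\<delta> ^ k) y x"] by (simp add: mult.assoc)
  show ?thesis
  proof (rule that)
    show "0 < B" using assms pos by (auto simp: B_def add_pos_nonneg intro!: mult_pos_pos)
    show "0 < c" "c \<le> 1" by fact+
    fix N K u k i
    assume K: "crf_kernel C \<beta> \<gamma> N K" and i: "i \<in> idx k" and u: "u k i \<in> subc k i"
    have L2: "L2_integral_operator M (K k)" for k using K by (simp add: crf_kernel_def)
    note meas = L2_kernel_measurable[OF L2]
    show "crf_profile K u k i \<in> borel_measurable M \<and>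
      (\<forall>y. cmod (crf_profile K u k i y) \<le> B * pker \<gamma> (\<delta> ^ k) (u k i) y) \<and>
      (\<forall>x y. d x y \<le> c * (\<delta> ^ k + d x (u k i)) \<longrightarrow>
         cmod (crf_profile K u k i x - crf_profile K u k i y)
           \<le> B * (d x y / (\<delta> ^ k + d x (u k i))) powr \<beta> * pker \<gamma> (\<delta> ^ k) (u k i) x) \<and>
      (N < k \<longrightarrow> (\<integral>y. crf_profile K u k i y \<partial>M) = 0)"
    proof (cases "k = 0")
      case False
      then have eq: "crf_profile K u k i = (\<lambda>x. K k x (u k i))"
        by (simp add: crf_profile_def fun_eq_iff)
      show ?thesis
        unfolding eq
      proof (intro conjI allI impI)
        show "(\<lambda>x. K k x (u k i)) \<in> borel_measurable M" by (rule meas)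
        show "(\<integral>y. K k y (u k i) \<partial>M) = 0" if "N < k"
          using K that by (simp add: crf_kernel_def)
        fix x y
        have "cmod (K k y (u k i)) \<le> C * Cmu * pker \<gamma> (\<delta> ^ k) y (u k i)"
          using crf_kernel_le_pker(1)[OF K] assms by simp
        also have "\<dots> \<le> C * Cmu * (S * pker \<gamma> (\<delta> ^ k) (u k i) y)"
          using assms pos by (intro sym) auto
        also have "\<dots> \<le> B * 1 * pker \<gamma> (\<delta> ^ k) (u k i) y"
          by (rule Bp) (use B1 in simp)
        finally show "cmod (K k y (u k i)) \<le> B * pker \<gamma> (\<delta> ^ k) (u k i) y" by simp
        assume le: "d x y \<le> c * (\<delta> ^ k + d x (u k i))"
        have p: "0 \<le> \<delta> ^ k + d x (u k i)" using delta_pos dist_nonneg[of x "u k i"] by simp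
        let ?w = "(d x y / (\<delta> ^ k + d x (u k i))) powr \<beta>"
        have "c * (\<delta> ^ k + d x (u k i)) \<le> 1 / (2 * A0) * (\<delta> ^ k + d x (u k i))"
          using c p by (intro mult_right_mono) auto
        then have "d x y \<le> (\<delta> ^ k + d x (u k i)) / (2 * A0)" using le by simp
        then have "cmod (K k x (u k i) - K k y (u k i)) \<le> C * Cmu * ?w * pker \<gamma> (\<delta> ^ k) x (u k i)"
          using crf_kernel_le_pker(2)[OF K] assms by simp
        also have "\<dots> \<le> C * Cmu * ?w * (S * pker \<gamma> (\<delta> ^ k) (u k i) x)"
          using assms pos by (intro sym) auto
        also have "\<dots> \<le> B * ?w * pker \<gamma> (\<delta> ^ k) (u k i) x"
        proof (rule Bp)
          show "C * Cmu * ?w * S \<le> B * ?w"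
            using mult_right_mono[OF B1(1), of ?w] by (simp add: mult_ac)
        qed
        finally show "cmod (K k x (u k i) - K k y (u k i)) \<le> B * ?w * pker \<gamma> (\<delta> ^ k) (u k i) x" .
      qed
    next
      case True
      let ?E = "subc 0 i"
      let ?u = "u 0 i"
      have i0: "i \<in> idx 0" "?u \<in> ?E" using i u True by auto
      have E [measurable]: "?E \<in> sets M" using i0 by simp
      have cmp: "1 + d x y' \<le> t * (1 + d x ?u)" "1 + d x ?u \<le> t * (1 + d x y')" if "y' \<in> ?E" for x y'
        using t(2)[OF i0(1) i0(2) that, of 1 x] t(2)[OF i0(1) that i0(2), of 1 x] by simp_all
      have size: "cmod (K 0 y y') \<le> C * Cmu * (J * pker \<gamma> 1 y ?u)" if "y' \<in> ?E" for y y'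
      proof -
        have "cmod (K 0 y y') \<le> C * Cmu * pker \<gamma> 1 y y'"
          using crf_kernel_le_pker(1)[OF K, of 0] assms by simp
        also have "\<dots> \<le> C * Cmu * (J * pker \<gamma> 1 y ?u)"
          unfolding J_def using assms pos t cmp(2)[OF that, of y] cmp(1)[OF that, of y] by (intro mult_left_mono pker_compare) auto
        finally show ?thesis .
      qed
      have hold: "cmod (K 0 x y' - K 0 y y') \<le> C * Cmu * (t powr \<beta> * (d x y / (1 + d x ?u)) powr \<beta>) * (J * pker \<gamma> 1 x ?u)"
        if "y' \<in> ?E" and le: "d x y \<le> c * (1 + d x ?u)" for x y y'
      proof -
        have p: "0 < 1 + d x ?u" "0 < 1 + d x y'" using dist_nonneg[of x] by (simp_all add: add_pos_nonneg)
        have "c * (1 + d x ?u) \<le> c * (t * (1 + d x y'))"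
          using c cmp[OF that(1), of x] by (intro mult_left_mono) auto
        also have "\<dots> = (1 + d x y') / (2 * A0)" using pos by (simp add: c_def)
        finally have "d x y \<le> (1 + d x y') / (2 * A0)" using le by simp
        then have "cmod (K 0 x y' - K 0 y y') \<le> C * Cmu * (d x y / (1 + d x y')) powr \<beta> * pker \<gamma> 1 x y'"
          using crf_kernel_le_pker(2)[OF K, of x y 0 y'] assms by simp
        also have "\<dots> \<le> C * Cmu * (t powr \<beta> * (d x y / (1 + d x ?u)) powr \<beta>) * (J * pker \<gamma> 1 x ?u)"
        proof (intro mult_mono mult_left_mono)
          have "1 / (1 + d x y') \<le> t * (1 / (1 + d x ?u))"
            using cmp(2)[OF that(1), of x] p by (simp add: field_simps)
          then have "d x y * (1 / (1 + d x y')) \<le> d x y * (t * (1 / (1 + d x ?u)))"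
            using dist_nonneg by (rule mult_left_mono)
          then have "d x y / (1 + d x y') \<le> t * (d x y / (1 + d x ?u))"
            by (simp add: mult_ac)
          then have "(d x y / (1 + d x y')) powr \<beta> \<le> (t * (d x y / (1 + d x ?u))) powr \<beta>"
            using assms p dist_nonneg[of x y] by (intro powr_mono2) auto
          then show "(d x y / (1 + d x y')) powr \<beta> \<le> t powr \<beta> * (d x y / (1 + d x ?u)) powr \<beta>"
            by (simp only: powr_mult)
          show "pker \<gamma> 1 x y' \<le> J * pker \<gamma> 1 x ?u"
            unfolding J_def using assms t cmp[OF that(1), of x] by (intro pker_compare) auto
        qed (use assms pos in auto)
        finally show ?thesis .
      qed
      have int: "set_integrable M ?E (\<lambda>y'. K 0 x y')" for x
        unfolding set_integrable_def
      proof (rule integrableI_bounded_set[where A = ?E])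
        show "(\<lambda>y'. indicator ?E y' *\<^sub>R K 0 x y') \<in> borel_measurable M"
          using meas(2)[of 0 x] by measurable
        show "AE y' in M. y' \<in> ?E \<longrightarrow> norm (indicator ?E y' *\<^sub>R K 0 x y') \<le> C * Cmu * (J * pker \<gamma> 1 x ?u)"
          using size by (auto simp: indicator_def)
        show "emeasure M ?E < \<infinity>" using subc_emeasure[OF i0(1)] by simp
      qed auto
      have eq: "crf_profile K u k i = (\<lambda>x. (LINT y':?E|M. K 0 x y') / complex_of_real (measure M ?E))"
        using True by (simp add: crf_profile_def fun_eq_iff)
      show ?thesis
        unfolding eq
        unfolding True
      proof (intro conjI allI impI)
        show "(\<lambda>x. (LINT y':?E|M. K 0 x y') / complex_of_real (measure M ?E)) \<in> borel_measurable M"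
          using crf_profile_measurable[OF K i, of u] unfolding eq .
        fix x y
        have "cmod ((LINT y':?E|M. K 0 y y') / complex_of_real (measure M ?E)) \<le> C * Cmu * (J * pker \<gamma> 1 y ?u)"
          using assms pos by (intro mean_le[OF i0(1)] size) auto
        also have "\<dots> = C * Cmu * J * pker \<gamma> 1 y ?u" by simp
        also have "\<dots> \<le> C * Cmu * J * (S * pker \<gamma> 1 ?u y)"
          using sym[of "C * Cmu * J" 0] assms pos by simp
        also have "\<dots> \<le> B * pker \<gamma> 1 ?u y"
          using Bp[of "C * Cmu * J" 1 0] B1 by simp
        finally show "cmod ((LINT y':?E|M. K 0 y y') / complex_of_real (measure M ?E)) \<le> B * pker \<gamma> (\<delta> ^ 0) ?u y"
          by simp
        assume "d x y \<le> c * (\<delta> ^ 0 + d x ?u)"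
        then have le: "d x y \<le> c * (1 + d x ?u)" by simp
        let ?w = "(d x y / (1 + d x ?u)) powr \<beta>"
        have "(LINT y':?E|M. K 0 x y') / complex_of_real (measure M ?E) - (LINT y':?E|M. K 0 y y') / complex_of_real (measure M ?E)
          = (LINT y':?E|M. K 0 x y' - K 0 y y') / complex_of_real (measure M ?E)"
          using int by (simp add: set_integral_diff diff_divide_distrib)
        also have "cmod \<dots> \<le> C * Cmu * (t powr \<beta> * ?w) * (J * pker \<gamma> 1 x ?u)"
          using assms pos le by (intro mean_le[OF i0(1)] hold) auto
        also have "\<dots> = C * Cmu * t powr \<beta> * J * ?w * pker \<gamma> 1 x ?u" by simp
        also have "\<dots> \<le> C * Cmu * t powr \<beta> * J * ?w * (S * pker \<gamma> 1 ?u x)"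
          using sym[of "C * Cmu * t powr \<beta> * J * ?w" 0] assms pos by simp
        also have "\<dots> \<le> B * ?w * pker \<gamma> 1 ?u x"
          using Bp[of "C * Cmu * t powr \<beta> * J * ?w" ?w 0] mult_right_mono[OF B1(3), of ?w] by (simp add: mult_ac)
        finally show "cmod ((LINT y':?E|M. K 0 x y') / complex_of_real (measure M ?E) - (LINT y':?E|M. K 0 y y') / complex_of_real (measure M ?E))
          \<le> B * (d x y / (\<delta> ^ 0 + d x ?u)) powr \<beta> * pker \<gamma> (\<delta> ^ 0) ?u x" by simp
      qed simp
    qed
  qed
qed

text \<open>The finer level has to supply the cancellation: Q_k if k' \<le> k and k \<ge> 1, the
  profile if k \<le> k' and k' > N. In the remaining pairs both levels are at most N, so the decay
  factor is bounded below and costs only a constant.\<close>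

lemma crf_pairing_bound:
  assumes Q: "exp_IATI M d \<delta> Y \<eta> Q" and "\<eta> \<le> 1" "0 < C" "0 < \<beta>" "\<beta> \<le> 1" "0 < \<gamma>" "\<gamma> \<le> 1"
    "0 < \<sigma>" "\<sigma> \<le> \<beta>" "\<sigma> < \<gamma>" "\<sigma> \<le> \<eta>"
  obtains D where "0 < D"
    "\<And>K u k k' i x. crf_kernel C \<beta> \<gamma> N K \<Longrightarrow> i \<in> idx k' \<Longrightarrow> u k' i \<in> subc k' i \<Longrightarrow>
      cmod (\<integral>y. crf_profile K u k' i y * Q k x y \<partial>M)
        \<le> D * \<delta> powr (\<sigma> * \<bar>real k - real k'\<bar>) * pker \<gamma> (\<delta> ^ min k k') x (u k' i)"
proof -
  obtain A where A: "0 < A" "\<And>k x y. cmod (Q k x y) \<le> A * pker 3 (\<delta> ^ k) x y"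
    "\<And>k x y y'. d y y' \<le> \<delta> ^ k \<Longrightarrow>
       cmod (Q k x y - Q k x y') \<le> A * (d y y' / \<delta> ^ k) powr \<eta> * pker 3 (\<delta> ^ k) x y"
    using exp_IATI_bounds[OF Q delta_pos, of 3] by auto
  obtain B c where B: "0 < B" "0 < c" "c \<le> 1"
    "\<And>N K u k i. crf_kernel C \<beta> \<gamma> N K \<Longrightarrow> i \<in> idx k \<Longrightarrow> u k i \<in> subc k i \<Longrightarrow>
      crf_profile K u k i \<in> borel_measurable M \<and>
      (\<forall>y. cmod (crf_profile K u k i y) \<le> B * pker \<gamma> (\<delta> ^ k) (u k i) y) \<and>
      (\<forall>x y. d x y \<le> c * (\<delta> ^ k + d x (u k i)) \<longrightarrow>
         cmod (crf_profile K u k i x - crf_profile K u k i y)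
           \<le> B * (d x y / (\<delta> ^ k + d x (u k i))) powr \<beta> * pker \<gamma> (\<delta> ^ k) (u k i) x) \<and>
      (N < k \<longrightarrow> (\<integral>y. crf_profile K u k i y \<partial>M) = 0)"
  proof (rule crf_profile_bounds[OF \<open>0 < C\<close> \<open>0 < \<beta>\<close> \<open>\<beta> \<le> 1\<close> \<open>0 < \<gamma>\<close>], goal_cases)
    case 1
    show thesis by (rule that[OF 1(2-4)]) (rule 1(5); assumption)
  qed
  have g3: "\<gamma> \<le> 3" "\<gamma> \<le> 2" using assms by auto
  obtain C1 where C1: "0 < C1" "\<And>\<rho> \<rho>' x u A B \<phi> h. 0 < \<rho> \<Longrightarrow> 0 < \<rho>' \<Longrightarrow> 0 \<le> A \<Longrightarrow> 0 \<le> B \<Longrightarrow>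
     (\<And>y. cmod (\<phi> y) \<le> A * pker 3 \<rho> x y) \<Longrightarrow> (\<And>y. cmod (h y) \<le> B * pker \<gamma> \<rho>' u y) \<Longrightarrow>
     cmod (\<integral>y. h y * \<phi> y \<partial>M) \<le> C1 * (A * B) * pker \<gamma> (max \<rho> \<rho>') x u"
  proof (rule pairing_bound[OF \<open>0 < \<gamma>\<close> g3(1)], goal_cases)
    case (1 C)
    show thesis by (rule that[OF 1(2)]) (rule 1(3); simp)
  qed
  obtain C2 where C2: "0 < C2" "\<And>\<rho> \<rho>' x u A B \<phi> h. 0 < \<rho> \<Longrightarrow> \<rho> \<le> \<rho>' \<Longrightarrow> 0 \<le> A \<Longrightarrow> 0 \<le> B \<Longrightarrow>
     \<phi> \<in> borel_measurable M \<Longrightarrow> h \<in> borel_measurable M \<Longrightarrow>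
     (\<And>y. cmod (\<phi> y) \<le> A * pker 3 \<rho> x y) \<Longrightarrow> (\<And>y. cmod (h y) \<le> B * pker \<gamma> \<rho>' u y) \<Longrightarrow>
     (\<And>y. d x y \<le> c * (\<rho>' + d x u) \<Longrightarrow>
        cmod (h x - h y) \<le> B * (d x y / (\<rho>' + d x u)) powr \<beta> * pker \<gamma> \<rho>' u x) \<Longrightarrow>
     (\<integral>y. \<phi> y \<partial>M) = 0 \<Longrightarrow>
     cmod (\<integral>y. h y * \<phi> y \<partial>M) \<le> C2 * (A * B) * (\<rho> / \<rho>') powr \<beta> * pker \<gamma> \<rho>' u x"
  proof (rule pairing_bound_fine_cancellation[OF \<open>0 < \<gamma>\<close> g3(2) \<open>0 < \<beta>\<close> \<open>\<beta> \<le> 1\<close> B(2,3)], goal_cases)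
    case (1 C)
    show thesis by (rule that[OF 1(2)]) (rule 1(3); simp)
  qed
  obtain C3 where C3: "0 < C3" "\<And>\<rho> \<rho>' x u A B \<phi> h. 0 < \<rho>' \<Longrightarrow> \<rho>' \<le> \<rho> \<Longrightarrow> 0 \<le> A \<Longrightarrow> 0 \<le> B \<Longrightarrow>
     \<phi> \<in> borel_measurable M \<Longrightarrow> h \<in> borel_measurable M \<Longrightarrow>
     (\<And>y. cmod (\<phi> y) \<le> A * pker 3 \<rho> x y) \<Longrightarrow> (\<And>y. cmod (h y) \<le> B * pker \<gamma> \<rho>' u y) \<Longrightarrow>
     (\<And>y. d u y \<le> \<rho> \<Longrightarrow> cmod (\<phi> u - \<phi> y) \<le> A * (d u y / \<rho>) powr \<eta> * pker 3 \<rho> x u) \<Longrightarrow>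
     (\<integral>y. h y \<partial>M) = 0 \<Longrightarrow>
     cmod (\<integral>y. h y * \<phi> y \<partial>M) \<le> C3 * (A * B) * (\<rho>' / \<rho>) powr \<sigma> * pker \<gamma> \<rho> x u"
  proof (rule pairing_bound_coarse_cancellation[OF \<open>0 < \<sigma>\<close> \<open>\<sigma> < \<gamma>\<close> \<open>\<sigma> \<le> \<eta>\<close> g3(1)], goal_cases)
    case (1 C)
    show thesis by (rule that[OF 1(2)]) (rule 1(3); simp)
  qed
  define S where "S = Cmu * (2 * A0) powr hdim"
  have S: "0 < S" using Cmu_ge_1 A0_pos by (simp add: S_def)
  \<comment> \<open>The price of missing cancellation at levels up to N: there
    \<delta>^(\<sigma>|k-k'|) is at least \<delta>^(\<sigma>N).\<close>
  define e where "e = \<delta> powr (- (\<sigma> * real N))"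
  define D where "D = (C1 * e + C2 * S + C3) * (A * B)"
  have e: "0 < e" using delta_pos by (simp add: e_def)
  have D: "C1 * (A * B) * e \<le> D" "C2 * (A * B) * S \<le> D" "C3 * (A * B) \<le> D" "0 < D"
    using C1(1) C2(1) C3(1) A(1) B(1) S e by (auto simp: D_def algebra_simps add_pos_pos)
  show ?thesis
  proof (rule that[OF D(4)])
    fix K u k k' i x
    assume K: "crf_kernel C \<beta> \<gamma> N K" "i \<in> idx k'" "u k' i \<in> subc k' i"
    let ?h = "crf_profile K u k' i"
    let ?u = "u k' i"
    have h: "?h \<in> borel_measurable M" "\<And>y. cmod (?h y) \<le> B * pker \<gamma> (\<delta> ^ k') ?u y"
      "\<And>x y. d x y \<le> c * (\<delta> ^ k' + d x ?u) \<Longrightarrow>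
         cmod (?h x - ?h y) \<le> B * (d x y / (\<delta> ^ k' + d x ?u)) powr \<beta> * pker \<gamma> (\<delta> ^ k') ?u x"
      "N < k' \<Longrightarrow> (\<integral>y. ?h y \<partial>M) = 0"
      using B(4)[where N = N and K = K and u = u and k = k' and i = i, OF K] by blast+
    have L2: "L2_integral_operator M (Q k)" using Q by (simp add: exp_IATI_def)
    have \<phi>: "Q k x \<in> borel_measurable M" using L2_kernel_measurable(2)[OF L2, of x] by simp
    have dp: "0 < \<delta> ^ n" for n using delta_pos by simp
    have quot: "(\<delta> ^ n / \<delta> ^ m) powr b = \<delta> powr (b * (real n - real m))" for n m b
    proof -
      have "\<delta> ^ n / \<delta> ^ m = \<delta> powr (real n - real m)"
        using delta_pos by (simp add: powr_diff powr_realpow)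
      then show ?thesis by (simp add: powr_powr mult.commute)
    qed
    have dq: "0 \<le> \<delta> ^ k / \<delta> ^ k'" using delta_pos by simp
    have mono: "n \<le> m \<Longrightarrow> \<delta> ^ m \<le> \<delta> ^ n" for n m
      using delta_pos delta_less_1 by (intro power_decreasing) auto
    let ?R = "D * \<delta> powr (\<sigma> * \<bar>real k - real k'\<bar>) * pker \<gamma> (\<delta> ^ min k k') x ?u"
    consider "k' \<le> k" "1 \<le> k" | "N < k'" "k \<le> k'" | "k' \<le> N" "k \<le> k'" by linarith
    then show "cmod (\<integral>y. ?h y * Q k x y \<partial>M) \<le> ?R"
    proof cases
      case 1
      have cq: "(\<integral>y. Q k x y \<partial>M) = 0" using Q 1 by (simp add: exp_IATI_def)
      have "cmod (\<integral>y. ?h y * Q k x y \<partial>M)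
        \<le> C2 * (A * B) * (\<delta> ^ k / \<delta> ^ k') powr \<beta> * pker \<gamma> (\<delta> ^ k') ?u x"
        by (rule C2(2)) (use A(1,2) B(1) \<phi> h(1,2,3) cq mono[OF 1(1)] dp in simp_all)
      \<comment> \<open>The power \<beta> is lowered to \<sigma>, the quotient of the scales being
        at most 1, and the kernel is recentred at x.\<close>
      also have "\<dots> \<le> C2 * (A * B) * (\<delta> ^ k / \<delta> ^ k') powr \<sigma> * (S * pker \<gamma> (\<delta> ^ k') x ?u)"
        unfolding S_def using A(1) B(1) C2(1) 1 mono[of k' k] dp dq assms by (intro mult_mono mult_left_mono powr_mono' pker_sym) auto
      also have "\<dots> = (C2 * (A * B) * S) * \<delta> powr (\<sigma> * \<bar>real k - real k'\<bar>) * pker \<gamma> (\<delta> ^ min k k') x ?u"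
        using 1 by (simp add: quot)
      also have "\<dots> \<le> ?R" using D by (intro mult_right_mono) auto
      finally show ?thesis .
    next
      case 2
      have "cmod (\<integral>y. ?h y * Q k x y \<partial>M)
        \<le> C3 * (A * B) * (\<delta> ^ k' / \<delta> ^ k) powr \<sigma> * pker \<gamma> (\<delta> ^ k) x ?u"
        by (rule C3(2)) (use A B(1) \<phi> h(1,2) h(4)[OF 2(1)] mono[OF 2(2)] dp in simp_all)
      also have "\<dots> = (C3 * (A * B)) * \<delta> powr (\<sigma> * \<bar>real k - real k'\<bar>) * pker \<gamma> (\<delta> ^ min k k') x ?u"
        using 2 by (simp add: quot abs_minus_commute)
      also have "\<dots> \<le> ?R" using D by (intro mult_right_mono) auto
      finally show ?thesis .
    next
      case 3
      have mx: "max (\<delta> ^ k) (\<delta> ^ k') = \<delta> ^ min k k'" using 3 mono[of k k'] by simp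
      have "1 \<le> e * \<delta> powr (\<sigma> * \<bar>real k - real k'\<bar>)"
      proof -
        have "1 = \<delta> powr 0" using delta_pos by simp
        also have "\<dots> \<le> \<delta> powr (- (\<sigma> * real N) + \<sigma> * \<bar>real k - real k'\<bar>)"
        proof (intro powr_mono')
          have "\<sigma> * \<bar>real k - real k'\<bar> \<le> \<sigma> * real N" using assms 3 by (intro mult_left_mono) auto
          then show "- (\<sigma> * real N) + \<sigma> * \<bar>real k - real k'\<bar> \<le> 0" by simp
        qed (use delta_pos delta_less_1 in auto)
        finally show ?thesis unfolding e_def powr_add .
      qed
      then have "C1 * (A * B) * 1 \<le> C1 * (A * B) * (e * \<delta> powr (\<sigma> * \<bar>real k - real k'\<bar>))"
        using C1(1) A(1) B(1) by (intro mult_left_mono) auto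
      also have "\<dots> \<le> D * \<delta> powr (\<sigma> * \<bar>real k - real k'\<bar>)"
        using mult_right_mono[OF D(1), of "\<delta> powr (\<sigma> * \<bar>real k - real k'\<bar>)"] by (simp add: mult_ac)
      finally have le: "C1 * (A * B) * 1 \<le> D * \<delta> powr (\<sigma> * \<bar>real k - real k'\<bar>)" .
      have "cmod (\<integral>y. ?h y * Q k x y \<partial>M) \<le> C1 * (A * B) * pker \<gamma> (max (\<delta> ^ k) (\<delta> ^ k')) x ?u"
        by (rule C1(2)) (use A(1,2) B(1) h(2) dp in simp_all)
      also have "\<dots> \<le> ?R" unfolding mx using le by (intro mult_right_mono) auto
      finally show ?thesis .
    qed
  qed
qed

text \<open>With the measure of the subcube pulled out, level 0 takes the same form as the other
  levels, and the formula becomes a Riemann sum.\<close>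

lemma crf_summand_eq:
  assumes "i \<in> idx k"
  shows "crf_summand M sub (\<lambda>k \<alpha> m. u k (\<alpha>, m)) N T K \<phi> k (fst i) (snd i)
    = complex_of_real (measure M (subc k i)) * (\<integral>y. crf_profile K u k i y * \<phi> y \<partial>M) *
        (if k \<le> N then mean M (subc k i) (T k) else T k (u k i))"
proof (cases "k = 0")
  case True
  have i0: "i \<in> idx 0" using assms True by simp
  have "(\<integral>y. crf_profile K u 0 i y * \<phi> y \<partial>M)
     = (\<integral>x. (LINT y:subc 0 i|M. K 0 x y) * \<phi> x \<partial>M) / complex_of_real (measure M (subc 0 i))"
    by (simp add: crf_profile_def)
  then show ?thesis using True subc_measure_pos[OF i0]
    by (simp add: crf_summand_def Let_def subc_def)
next
  case False
  then show ?thesis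
    by (simp add: crf_summand_def Let_def subc_def crf_profile_def)
qed

end

section \<open>Pointwise estimates from the reproducing formula\<close>

lemma sum_le_nn_integral_count_space:
  fixes f :: "'b \<Rightarrow> ennreal"
  assumes "finite F" "F \<subseteq> I"
  shows "sum f F \<le> (\<integral>\<^sup>+i. f i \<partial>count_space I)"
proof -
  have "sum f F = (\<integral>\<^sup>+i. f i * indicator F i \<partial>count_space UNIV)"
    using assms by (simp add: nn_integral_count_space_finite flip: nn_integral_count_space_indicator)
  also have "\<dots> \<le> (\<integral>\<^sup>+i. f i * indicator I i \<partial>count_space UNIV)"
    using assms by (intro nn_integral_mono) (auto simp: indicator_def)
  also have "\<dots> = (\<integral>\<^sup>+i. f i \<partial>count_space I)"
    by (simp add: nn_integral_count_space_indicator)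
  finally show ?thesis .
qed

text \<open>An unconditional sum is the limit of its finite subsums, each subject to the triangle
  inequality. From here on the sums are taken in \<open>ennreal\<close>, where convergence is no
  longer an issue.\<close>

lemma cmod_infsum_le_nn_integral:
  fixes t :: "'b \<Rightarrow> complex"
  assumes "t summable_on I"
  shows "ennreal (cmod (infsum t I)) \<le> (\<integral>\<^sup>+i. ennreal (cmod (t i)) \<partial>count_space I)"
proof (rule tendsto_upperbound)
  have "(sum t \<longlongrightarrow> infsum t I) (finite_subsets_at_top I)"
    using has_sum_infsum[OF assms] by (simp add: has_sum_def)
  then show "((\<lambda>F. ennreal (cmod (sum t F))) \<longlongrightarrow> ennreal (cmod (infsum t I))) (finite_subsets_at_top I)"
    by (intro tendsto_ennrealI tendsto_norm)
  show "\<forall>\<^sub>F F in finite_subsets_at_top I. ennreal (cmod (sum t F)) \<le> (\<integral>\<^sup>+i. ennreal (cmod (t i)) \<partial>count_space I)"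
  proof (rule eventually_finite_subsets_at_top_weakI)
    fix F assume F: "finite F" "F \<subseteq> I"
    have "ennreal (cmod (sum t F)) \<le> (\<Sum>i\<in>F. ennreal (cmod (t i)))"
      by (simp add: sum_ennreal ennreal_leI norm_sum)
    also have "\<dots> \<le> (\<integral>\<^sup>+i. ennreal (cmod (t i)) \<partial>count_space I)"
      using F by (rule sum_le_nn_integral_count_space)
    finally show "ennreal (cmod (sum t F)) \<le> (\<integral>\<^sup>+i. ennreal (cmod (t i)) \<partial>count_space I)" .
  qed
qed simp

lemma cmod_sums_le_suminf:
  fixes a :: "nat \<Rightarrow> complex"
  assumes "a sums s" "\<And>k. ennreal (cmod (a k)) \<le> b k"
  shows "ennreal (cmod s) \<le> (\<Sum>k. b k)"
proof (rule tendsto_upperbound)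
  show "(\<lambda>n. ennreal (cmod (\<Sum>k<n. a k))) \<longlonglongrightarrow> ennreal (cmod s)"
    using assms(1) by (intro tendsto_ennrealI tendsto_norm) (simp add: sums_def)
  have "ennreal (cmod (\<Sum>k<n. a k)) \<le> (\<Sum>k. b k)" for n
  proof -
    have "ennreal (cmod (\<Sum>k<n. a k)) \<le> (\<Sum>k<n. ennreal (cmod (a k)))"
      by (simp add: sum_ennreal ennreal_leI norm_sum)
    also have "\<dots> \<le> (\<Sum>k<n. b k)" by (intro sum_mono assms)
    also have "\<dots> \<le> (\<Sum>k. b k)" by (intro sum_le_suminf) auto
    finally show ?thesis .
  qed
  then show "\<forall>\<^sub>F n in sequentially. ennreal (cmod (\<Sum>k<n. a k)) \<le> (\<Sum>k. b k)" by simp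
qed simp

text \<open>Along an enumeration of an infinite I the unconditional sum is a limit of partial sums,
  and pointwise limits of sequences preserve measurability.\<close>

lemma borel_measurable_infsum_countable:
  fixes t :: "'a \<Rightarrow> 'b \<Rightarrow> complex"
  assumes "countable I" "\<And>i. i \<in> I \<Longrightarrow> (\<lambda>x. t x i) \<in> borel_measurable M" "\<And>x. t x summable_on I"
  shows "(\<lambda>x. infsum (t x) I) \<in> borel_measurable M"
proof (cases "finite I")
  case True
  then show ?thesis using assms(2) by simp
next
  case False
  let ?e = "from_nat_into I"
  have b: "bij_betw ?e UNIV I" using assms(1) False by (rule bij_betw_from_nat_into)
  have "(\<lambda>n. t x (?e n)) sums infsum (t x) I" for x
  proof (rule has_sum_imp_sums)
    have "((t x) has_sum infsum (t x) I) (?e ` UNIV)"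
      using has_sum_infsum[OF assms(3)] b by (simp add: bij_betw_def)
    then have "((t x \<circ> ?e) has_sum infsum (t x) I) UNIV"
      using b by (subst (asm) has_sum_reindex) (auto simp: bij_betw_def)
    then show "((\<lambda>n. t x (?e n)) has_sum infsum (t x) I) UNIV" by (simp add: o_def)
  qed
  then have l: "(\<lambda>n. \<Sum>k<n. t x (?e k)) \<longlonglongrightarrow> infsum (t x) I" for x
    by (simp add: sums_def)
  have m: "(\<lambda>x. \<Sum>k<n. t x (?e k)) \<in> borel_measurable M" for n
    using False by (intro borel_measurable_sum assms(2) from_nat_into) auto
  show ?thesis by (rule borel_measurable_LIMSEQ_metric[OF m l])
qed

context dyadic_system
begin

definition crf_expansion where
  "crf_expansion x0 \<eta> \<beta> \<gamma> P N u K \<longleftrightarrow>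
     (\<forall>f\<in>distributions M d A0 x0 \<eta> \<beta> \<gamma>. \<forall>\<phi>\<in>test_space0 M d A0 x0 \<eta> \<beta> \<gamma>.
        let t = (\<lambda>k i. crf_summand M sub (\<lambda>k \<alpha> m. u k (\<alpha>, m)) N (dist_op P f) K \<phi> k (fst i) (snd i))
        in (\<forall>k. t k summable_on idx k) \<and> (\<lambda>k. infsum (t k) (idx k)) sums f \<phi>)"

lemma crf_integer_expansion:
  assumes crf: "crf_integer M d A0 x0 \<delta> A cnt sub \<eta> \<beta> \<gamma> P N"
  obtains C where "0 < C" "\<forall>u. sample_points u \<longrightarrow>
    (\<exists>K. crf_kernel C \<beta> \<gamma> N K \<and> crf_expansion x0 \<eta> \<beta> \<gamma> P N u K)"
proof -
  from crf[unfolded crf_integer_def, THEN conjunct2]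
  obtain C where C: "0 < C" and all: "\<forall>u. (\<forall>k. \<forall>\<alpha>\<in>A (int k). \<forall>m\<in>{1..cnt (int k) \<alpha>}. u k \<alpha> m \<in> sub (int k) \<alpha> m) \<longrightarrow>
     (\<exists>K.
         (\<forall>k. L2_integral_operator M (K k)) \<and>
         (\<forall>k x y. cmod (K k x y) \<le> C * decay_bound M d \<delta> \<gamma> k x y) \<and>
         (\<forall>k x x' y. d x x' \<le> (\<delta> ^ k + d x y) / (2 * A0) \<longrightarrow>
            cmod (K k x y - K k x' y)
              \<le> C * (d x x' / (\<delta> ^ k + d x y)) powr \<beta> * decay_bound M d \<delta> \<gamma> k x y) \<and>
         (\<forall>k x. (\<integral>y. K k x y \<partial>M) = (if k \<le> N then 1 else 0) \<and>
                (\<integral>y. K k y x \<partial>M) = (if k \<le> N then 1 else 0)) \<and>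
         (\<forall>f\<in>distributions M d A0 x0 \<eta> \<beta> \<gamma>. \<forall>\<phi>\<in>test_space0 M d A0 x0 \<eta> \<beta> \<gamma>.
            let I = (\<lambda>k. SIGMA \<alpha>:A (int k). {1..cnt (int k) \<alpha>});
                t = (\<lambda>k (\<alpha>, m). crf_summand M sub u N (dist_op P f) K \<phi> k \<alpha> m)
            in (\<forall>k. t k summable_on I k) \<and> (\<lambda>k. infsum (t k) (I k)) sums f \<phi>))"
    by (elim exE conjE) (rule that)
  show ?thesis
  proof (rule that[OF C], intro allI impI)
    fix u assume u: "sample_points u"
    have "\<forall>k. \<forall>\<alpha>\<in>A (int k). \<forall>m\<in>{1..cnt (int k) \<alpha>}. u k (\<alpha>, m) \<in> sub (int k) \<alpha> m"
      using u by (force simp: idx_def subc_def)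
    from all[THEN spec, THEN mp, OF this]
    show "\<exists>K. crf_kernel C \<beta> \<gamma> N K \<and> crf_expansion x0 \<eta> \<beta> \<gamma> P N u K"
      unfolding crf_kernel_def crf_expansion_def Let_def idx_def case_prod_beta' by (simp only: conj_assoc)
  qed
qed

text \<open>Since f is only a linear functional, measurability of x \<mapsto> f(Q_k(x,.)) has to be
  derived. The reproducing formula expresses this function as an iterated countable sum of parameter
  integrals, each measurable in x.\<close>

lemma dist_op_measurable:
  assumes Q: "exp_IATI M d \<delta> Y \<eta> Q" and crf: "crf_integer M d A0 x0 \<delta> A cnt sub \<eta> \<beta> \<gamma> P N"
    and f: "f \<in> distributions M d A0 x0 \<eta> \<beta> \<gamma>"
    and par: "0 < \<beta>" "\<beta> \<le> \<eta>" "0 < \<gamma>" "\<gamma> \<le> 1" "\<eta> \<le> 1"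
  shows "dist_op Q f k \<in> borel_measurable M"
proof -
  obtain C where C: "0 < C" "\<forall>u. sample_points u \<longrightarrow>
    (\<exists>K. crf_kernel C \<beta> \<gamma> N K \<and> crf_expansion x0 \<eta> \<beta> \<gamma> P N u K)"
    using crf_integer_expansion[OF crf] by blast
  define u where "u k i = (SOME y. y \<in> subc k i)" for k i
  have u: "i \<in> idx k \<Longrightarrow> u k i \<in> subc k i" for k i
    using subc_nonempty[of i k] by (simp add: u_def some_in_eq)
  obtain K where K: "crf_kernel C \<beta> \<gamma> N K" and exp: "crf_expansion x0 \<eta> \<beta> \<gamma> P N u K"
    using C(2) u by blast
  define t where "t = (\<lambda>x k' i. crf_summand M sub (\<lambda>k \<alpha> m. u k (\<alpha>, m)) N (dist_op P f) K (Q k x) k' (fst i) (snd i))"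
  have phi: "Q k x \<in> test_space0 M d A0 x0 \<eta> \<beta> \<gamma>" for x
    by (rule exp_IATI_test_space0[OF Q delta_pos par])
  have t: "t x k' summable_on idx k'" "(\<lambda>k'. infsum (t x k') (idx k')) sums dist_op Q f k x" for x k'
    using exp[unfolded crf_expansion_def, THEN bspec, OF f, THEN bspec, OF phi[of x]] by (auto simp: t_def dist_op_def Let_def)
  have "(\<lambda>x. t x k' i) \<in> borel_measurable M" if i: "i \<in> idx k'" for k' i
  proof -
    have L2: "L2_integral_operator M (Q k)" using Q by (simp add: exp_IATI_def)
    note [measurable] = L2_kernel_measurable(1)[OF L2] crf_profile_measurable[OF K i, of u]
    have "(\<lambda>p. crf_profile K u k' i (snd p) * (case p of (x, y) \<Rightarrow> Q k x y)) \<in> borel_measurable (M \<Otimes>\<^sub>M M)"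
      by measurable
    then have "(\<lambda>(x, y). crf_profile K u k' i y * Q k x y) \<in> borel_measurable (M \<Otimes>\<^sub>M M)"
      by (simp add: case_prod_beta')
    then have [measurable]: "(\<lambda>x. \<integral>y. crf_profile K u k' i y * Q k x y \<partial>M) \<in> borel_measurable M"
      by (rule sigma_finite_measure.borel_measurable_lebesgue_integral[OF sigma_finite])
    show ?thesis unfolding t_def crf_summand_eq[OF i] by measurable
  qed
  then have m: "(\<lambda>x. infsum (t x k') (idx k')) \<in> borel_measurable M" for k'
    using t(1) by (intro borel_measurable_infsum_countable countable_idx) auto
  have lim: "(\<lambda>n. \<Sum>k'<n. infsum (t x k') (idx k')) \<longlonglongrightarrow> dist_op Q f k x" for x
    using t(2)[of x] by (simp add: sums_def)
  show ?thesis
    by (rule borel_measurable_LIMSEQ_metric[OF _ lim]) (intro borel_measurable_sum m)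
qed

definition crf_coeff :: "nat \<Rightarrow> (nat \<Rightarrow> 'a \<Rightarrow> complex) \<Rightarrow> (nat \<Rightarrow> 'i \<times> nat \<Rightarrow> 'a) \<Rightarrow> nat \<Rightarrow> 'i \<times> nat \<Rightarrow> real" where
  "crf_coeff N T u k i = cmod (if k \<le> N then mean M (subc k i) (T k) else T k (u k i))"

text \<open>D is fixed before f and u, hence before the kernels, which depend on u:
  \<open>crf_pairing_bound\<close> sees them only through the constant C.\<close>

lemma dist_op_pointwise:
  assumes Q: "exp_IATI M d \<delta> Y \<eta> Q" and crf: "crf_integer M d A0 x0 \<delta> A cnt sub \<eta> \<beta> \<gamma> P N"
    and par: "0 < \<beta>" "\<beta> < \<eta>" "0 < \<gamma>" "\<gamma> < \<eta>" "\<eta> < 1" "0 < \<sigma>" "\<sigma> < \<beta>" "\<sigma> < \<gamma>"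
  obtains D where "0 < D"
    "\<And>f u k x. f \<in> distributions M d A0 x0 \<eta> \<beta> \<gamma> \<Longrightarrow> (\<And>k i. i \<in> idx k \<Longrightarrow> u k i \<in> subc k i) \<Longrightarrow>
       ennreal (cmod (dist_op Q f k x)) \<le> ennreal D * (\<Sum>k'. \<integral>\<^sup>+i. ennreal (\<delta> powr (\<sigma> * \<bar>real k - real k'\<bar>) *
         (measure M (subc k' i) * pker \<gamma> (\<delta> ^ min k k') x (u k' i)) * crf_coeff N (dist_op P f) u k' i) \<partial>count_space (idx k'))"
proof -
  obtain C where C: "0 < C" "\<forall>u. sample_points u \<longrightarrow>
    (\<exists>K. crf_kernel C \<beta> \<gamma> N K \<and> crf_expansion x0 \<eta> \<beta> \<gamma> P N u K)"
    using crf_integer_expansion[OF crf] by blast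
  have p: "\<eta> \<le> 1" "\<beta> \<le> 1" "\<gamma> \<le> 1" "\<sigma> \<le> \<beta>" "\<sigma> \<le> \<eta>" using par by auto
  obtain D where D: "0 < D" "\<And>K u k k' i x. crf_kernel C \<beta> \<gamma> N K \<Longrightarrow> i \<in> idx k' \<Longrightarrow> u k' i \<in> subc k' i \<Longrightarrow>
      cmod (\<integral>y. crf_profile K u k' i y * Q k x y \<partial>M)
        \<le> D * \<delta> powr (\<sigma> * \<bar>real k - real k'\<bar>) * pker \<gamma> (\<delta> ^ min k k') x (u k' i)"
  proof (rule crf_pairing_bound[where N = N, OF Q p(1) C(1) par(1) p(2) par(3) p(3) par(6) p(4) par(8) p(5)], goal_cases)
    case (1 D)
    show thesis by (rule that[OF 1(2)]) (rule 1(3); assumption)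
  qed
  show ?thesis
  proof (rule that[OF D(1)])
    fix f u k x
    assume f: "f \<in> distributions M d A0 x0 \<eta> \<beta> \<gamma>" and u: "\<And>k i. i \<in> idx k \<Longrightarrow> u k i \<in> subc k i"
    obtain K where K: "crf_kernel C \<beta> \<gamma> N K" and exp: "crf_expansion x0 \<eta> \<beta> \<gamma> P N u K"
      using C(2) u by blast
    define t where "t = (\<lambda>k' i. crf_summand M sub (\<lambda>k \<alpha> m. u k (\<alpha>, m)) N (dist_op P f) K (Q k x) k' (fst i) (snd i))"
    let ?w = "\<lambda>k' i. \<delta> powr (\<sigma> * \<bar>real k - real k'\<bar>) *
         (measure M (subc k' i) * pker \<gamma> (\<delta> ^ min k k') x (u k' i)) * crf_coeff N (dist_op P f) u k' i"
    have phi: "Q k x \<in> test_space0 M d A0 x0 \<eta> \<beta> \<gamma>"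
      by (rule exp_IATI_test_space0[OF Q delta_pos]) (use par in auto)
    have t: "t k' summable_on idx k'" "(\<lambda>k'. infsum (t k') (idx k')) sums dist_op Q f k x" for k'
      using exp[unfolded crf_expansion_def, THEN bspec, OF f, THEN bspec, OF phi] by (auto simp: t_def dist_op_def Let_def)
    have "ennreal (cmod (dist_op Q f k x)) \<le> (\<Sum>k'. ennreal D * (\<integral>\<^sup>+i. ennreal (?w k' i) \<partial>count_space (idx k')))"
    proof (rule cmod_sums_le_suminf[OF t(2)])
      fix k'
      have "ennreal (cmod (infsum (t k') (idx k'))) \<le> (\<integral>\<^sup>+i. ennreal (cmod (t k' i)) \<partial>count_space (idx k'))"
        by (rule cmod_infsum_le_nn_integral[OF t(1)])
      also have "\<dots> \<le> (\<integral>\<^sup>+i. ennreal D * ennreal (?w k' i) \<partial>count_space (idx k'))"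
      proof (intro nn_integral_mono)
        fix i assume "i \<in> space (count_space (idx k'))"
        then have i: "i \<in> idx k'" by simp
        have "cmod (t k' i) = measure M (subc k' i) * cmod (\<integral>y. crf_profile K u k' i y * Q k x y \<partial>M) * crf_coeff N (dist_op P f) u k' i"
          unfolding t_def crf_summand_eq[OF i] by (simp add: norm_mult crf_coeff_def)
        also have "\<dots> \<le> measure M (subc k' i) * (D * \<delta> powr (\<sigma> * \<bar>real k - real k'\<bar>) * pker \<gamma> (\<delta> ^ min k k') x (u k' i)) * crf_coeff N (dist_op P f) u k' i"
          by (intro mult_right_mono mult_left_mono D(2)[where u = u, OF K i u[OF i]]) (auto simp: crf_coeff_def)
        also have "\<dots> = D * ?w k' i" by (simp only: mult_ac)
        finally show "ennreal (cmod (t k' i)) \<le> ennreal D * ennreal (?w k' i)"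
          using D(1) by (subst ennreal_mult'[symmetric]) (auto intro: ennreal_leI)
      qed
      also have "\<dots> = ennreal D * (\<integral>\<^sup>+i. ennreal (?w k' i) \<partial>count_space (idx k'))"
        by (rule nn_integral_cmult) simp
      finally show "ennreal (cmod (infsum (t k') (idx k'))) \<le> \<dots>" .
    qed
    then show "ennreal (cmod (dist_op Q f k x)) \<le> ennreal D * (\<Sum>k'. \<integral>\<^sup>+i. ennreal (?w k' i) \<partial>count_space (idx k'))"
      by simp
  qed
qed

end

section \<open>Discrete sums over all subcubes\<close>

text \<open>The exponent \<open>min r 1\<close> covers both ranges of r. For r \<le> 1 the estimate
  is subadditivity of the r-th power, so c is raised to that power too. For r > 1 it is in substance
  Jensen's inequality with weights c, whose total mass W enters the constant.\<close>

lemma powr_sum_le: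
  fixes c \<tau> :: "'b \<Rightarrow> real"
  assumes "0 < r" "0 < W" "0 \<le> y" and c: "\<And>p. 0 \<le> c p" and \<tau>: "\<And>p. 0 \<le> \<tau> p"
    and W: "(\<integral>\<^sup>+p. ennreal (c p) \<partial>count_space J) \<le> ennreal W"
    and y: "ennreal y \<le> (\<integral>\<^sup>+p. ennreal (c p * \<tau> p) \<partial>count_space J)"
  shows "ennreal (y powr r) \<le> ennreal (1 + 2 powr r * W powr (r - 1)) *
    (\<integral>\<^sup>+p. ennreal (c p powr (min r 1) * \<tau> p powr r) \<partial>count_space J)"
proof (cases "(\<integral>\<^sup>+p. ennreal (c p powr (min r 1) * \<tau> p powr r) \<partial>count_space J) = \<infinity> \<or> y = 0")
  case True
  \<comment> \<open>A strictly positive factor makes the right-hand side infinite whenever the sum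
    is.\<close>
  have "0 < ennreal (1 + 2 powr r * W powr (r - 1))" by (simp add: add_pos_nonneg)
  then show ?thesis using True by (auto simp: ennreal_mult_top)
next
  case False
  then have yp: "0 < y" using assms by simp
  from False obtain b where b: "0 \<le> b" "(\<integral>\<^sup>+p. ennreal (c p powr (min r 1) * \<tau> p powr r) \<partial>count_space J) = ennreal b"
    by (cases "\<integral>\<^sup>+p. ennreal (c p powr (min r 1) * \<tau> p powr r) \<partial>count_space J") auto
  have "y powr r \<le> (1 + 2 powr r * W powr (r - 1)) * b"
  proof (cases "r \<le> 1")
    case True
    \<comment> \<open>Each term is at most b^(1/r). Writing it as its r-th power times its (1-r)-th
      power therefore costs b^((1-r)/r).\<close>
    have pt: "c p * \<tau> p \<le> (c p powr r * \<tau> p powr r) * b powr ((1 - r) / r)" if "p \<in> J" for p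
    proof -
      have "ennreal (c p powr r * \<tau> p powr r) \<le> ennreal b"
        using nn_integral_ge_point[OF that, of "\<lambda>p. ennreal (c p powr (min r 1) * \<tau> p powr r)"] b True by simp
      then have le: "(c p * \<tau> p) powr r \<le> b" using b by (simp add: powr_mult)
      have "c p * \<tau> p = (c p * \<tau> p) powr r * ((c p * \<tau> p) powr r) powr ((1 - r) / r)"
        using assms(1) c[of p] \<tau>[of p] by (cases "c p * \<tau> p = 0") (auto simp: powr_powr simp flip: powr_add)
      also have "\<dots> \<le> (c p * \<tau> p) powr r * b powr ((1 - r) / r)"
        using le True assms(1) by (intro mult_left_mono powr_mono2) auto
      finally show ?thesis by (simp add: powr_mult)
    qed
    have "ennreal y \<le> (\<integral>\<^sup>+p. ennreal (b powr ((1 - r) / r)) * ennreal (c p powr r * \<tau> p powr r) \<partial>count_space J)"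
      using pt by (intro order_trans[OF y] nn_integral_mono)
        (auto simp flip: ennreal_mult simp: mult.commute intro!: ennreal_leI)
    also have "\<dots> = ennreal (b powr ((1 - r) / r)) * ennreal b"
      using b True by (subst nn_integral_cmult) auto
    finally have "y \<le> b powr ((1 - r) / r) * b"
      using b by (simp flip: ennreal_mult)
    also have "\<dots> = b powr (1 / r)"
      using b assms(1) by (cases "b = 0") (auto simp: diff_divide_distrib powr_diff)
    finally have "y powr r \<le> (b powr (1 / r)) powr r"
      using assms by (intro powr_mono2) auto
    also have "\<dots> = b" using assms b by (simp add: powr_powr)
    also have "\<dots> \<le> (1 + 2 powr r * W powr (r - 1)) * b" using b by (simp add: distrib_right)
    finally show ?thesis .
  next
    case False
    \<comment> \<open>\<open>\<tau> \<le> v + v\<^bsup>1-r\<^esup> \<tau>\<^bsup>r\<^esup>\<close> with this \<open>v\<close> replaces Hoelder's inequality: the sum of \<open>c v\<close> is at most \<open>y / 2\<close>.\<close>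
    define v where "v = y / (2 * W)"
    have v: "0 < v" using yp assms by (simp add: v_def)
    have pt: "\<tau> p \<le> v + v powr (1 - r) * \<tau> p powr r" for p
    proof (cases "\<tau> p \<le> v")
      case True
      then show ?thesis by (simp add: add_increasing2)
    next
      case gt: False
      then have tp: "0 < \<tau> p" using v by simp
      have "\<tau> p = \<tau> p powr (1 - r) * \<tau> p powr r" using tp by (simp flip: powr_add)
      also have "\<dots> \<le> v powr (1 - r) * \<tau> p powr r"
        using gt v False by (intro mult_right_mono powr_mono2') auto
      finally show ?thesis using v by simp
    qed
    have "ennreal y \<le> (\<integral>\<^sup>+p. ennreal v * ennreal (c p) + ennreal (v powr (1 - r)) * ennreal (c p powr (min r 1) * \<tau> p powr r) \<partial>count_space J)"
    proof (intro order_trans[OF y] nn_integral_mono)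
      fix p
      have "c p * \<tau> p \<le> c p * (v + v powr (1 - r) * \<tau> p powr r)"
        using pt c by (rule mult_left_mono)
      also have "\<dots> = v * c p + v powr (1 - r) * (c p powr (min r 1) * \<tau> p powr r)"
        using False c[of p] by (simp add: distrib_left mult_ac)
      finally have "ennreal (c p * \<tau> p) \<le> ennreal (v * c p + v powr (1 - r) * (c p powr (min r 1) * \<tau> p powr r))"
        by (rule ennreal_leI)
      then show "ennreal (c p * \<tau> p) \<le> ennreal v * ennreal (c p) + ennreal (v powr (1 - r)) * ennreal (c p powr (min r 1) * \<tau> p powr r)"
        using v c[of p] by (simp add: ennreal_mult)
    qed
    also have "\<dots> = ennreal v * (\<integral>\<^sup>+p. ennreal (c p) \<partial>count_space J) + ennreal (v powr (1 - r)) * ennreal b"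
      by (subst nn_integral_add) (auto simp: nn_integral_cmult b)
    also have "\<dots> \<le> ennreal v * ennreal W + ennreal (v powr (1 - r)) * ennreal b"
      using W by (intro add_right_mono mult_left_mono) auto
    also have "\<dots> = ennreal (v * W + v powr (1 - r) * b)"
      using v b assms by (simp flip: ennreal_mult)
    finally have "y \<le> v * W + v powr (1 - r) * b"
      using v b(1) assms(2) by (subst (asm) ennreal_le_iff) auto
    also have "v * W = y / 2" using assms by (simp add: v_def)
    finally have "y \<le> 2 * v powr (1 - r) * b" by simp
    then have "y * y powr (r - 1) \<le> 2 * v powr (1 - r) * b * y powr (r - 1)"
      by (rule mult_right_mono) simp
    also have "v powr (1 - r) = (2 * W) powr (r - 1) * y powr (1 - r)"
      using yp assms by (simp add: v_def powr_divide powr_diff field_simps)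
    also have "2 * ((2 * W) powr (r - 1) * y powr (1 - r)) * b * y powr (r - 1)
        = (2 * 2 powr (r - 1)) * W powr (r - 1) * b * (y powr (1 - r) * y powr (r - 1))"
      by (simp add: powr_mult)
    also have "y powr (1 - r) * y powr (r - 1) = 1" using yp by (simp flip: powr_add)
    also have "2 * 2 powr (r - 1) = (2 powr r :: real)" by (simp add: powr_diff)
    also have "y * y powr (r - 1) = y powr r" using yp by (simp add: powr_diff)
    finally show ?thesis using b by (simp add: distrib_right)
  qed
  then show ?thesis
    unfolding b(2) using b(1) by (subst ennreal_mult[symmetric]) (auto intro!: ennreal_leI)
qed

context dyadic_system
begin

section \<open>Geometric weights between levels\<close>

lemma delta_power_powr: "\<delta> ^ k = \<delta> powr real k"
  using delta_pos by (simp add: powr_realpow)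

lemma delta_powr_mono: "x \<le> y \<Longrightarrow> \<delta> powr y \<le> \<delta> powr x"
  using delta_pos delta_less_1 by (intro powr_mono') auto

text \<open>Split at level k': on either side the exponents are distinct, so each part is dominated
  by a full geometric series, whatever the starting level l.\<close>

lemma sum_delta_powr_le:
  assumes "0 < \<kappa>"
  obtains C where "0 < C" "\<And>l k'. (\<Sum>n. ennreal (\<delta> powr (\<kappa> * \<bar>real (l + n) - real k'\<bar>))) \<le> ennreal C"
proof -
  define b where "b = \<delta> powr \<kappa>"
  have b: "0 < b" "b < 1"
    using delta_pos delta_less_1 assms powr_less_mono2[of \<kappa> \<delta> 1] by (auto simp: b_def)
  have geo: "(\<Sum>n\<in>S. b ^ g n) \<le> 1 / (1 - b)" if "finite S" "inj_on g S" for S :: "nat set" and g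
  proof -
    have "(\<Sum>n\<in>S. b ^ g n) = (\<Sum>j\<in>g ` S. b ^ j)" using that by (simp add: sum.reindex)
    also have "\<dots> \<le> (\<Sum>j. b ^ j)" using that b by (intro sum_le_suminf summable_geometric) auto
    also have "\<dots> = 1 / (1 - b)" using b by (intro suminf_geometric) auto
    finally show ?thesis .
  qed
  show ?thesis
  proof (rule that)
    show "0 < 2 * (1 / (1 - b))" using b by simp
    fix l k' :: nat
    let ?f = "\<lambda>n. \<delta> powr (\<kappa> * \<bar>real (l + n) - real k'\<bar>)"
    have bp: "\<delta> powr (\<kappa> * real j) = b ^ j" for j
      using b by (simp add: b_def powr_powr flip: powr_realpow)
    have part: "(\<Sum>n<m. ?f n) \<le> 2 * (1 / (1 - b))" for m
    proof -
      have "(\<Sum>n<m. ?f n) \<le> (\<Sum>n<m. (if k' \<le> l + n then b ^ (l + n - k') else b ^ (k' - (l + n))))"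
      proof (rule sum_mono)
        fix n
        show "?f n \<le> (if k' \<le> l + n then b ^ (l + n - k') else b ^ (k' - (l + n)))"
          by (cases "k' \<le> l + n") (auto simp flip: bp simp: of_nat_diff)
      qed
      also have "\<dots> = (\<Sum>n\<in>{n\<in>{..<m}. k' \<le> l + n}. b ^ (l + n - k')) + (\<Sum>n\<in>{n\<in>{..<m}. \<not> k' \<le> l + n}. b ^ (k' - (l + n)))"
        by (subst sum.If_cases) (auto intro!: arg_cong2[where f = "(+)"] sum.cong)
      also have "\<dots> \<le> 1 / (1 - b) + 1 / (1 - b)"
        by (intro add_mono geo) (auto simp: inj_on_def)
      finally show ?thesis by simp
    qed
    have s: "summable ?f" by (rule summableI_nonneg_bounded[OF _ part]) simp
    have "(\<Sum>n. ennreal (?f n)) = ennreal (\<Sum>n. ?f n)" using s by (intro suminf_ennreal2) auto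
    also have "\<dots> \<le> ennreal (2 * (1 / (1 - b)))"
      using s part by (intro ennreal_leI suminf_le_const) auto
    finally show "(\<Sum>n. ennreal (?f n)) \<le> ennreal (2 * (1 / (1 - b)))" .
  qed
qed

definition all_idx :: "(nat \<times> 'i \<times> nat) set" where
  "all_idx = Sigma UNIV idx"

abbreviation cm :: "nat \<times> 'i \<times> nat \<Rightarrow> real" where
  "cm p \<equiv> measure M (subc (fst p) (snd p))"

lemma countable_all_idx: "countable all_idx"
  unfolding all_idx_def by (intro countable_SIGMA countable_idx) auto

text \<open>Levels and subcubes become one index set, so that the r-th power can be taken inside the
  double sum in a single step.\<close>

lemma suminf_idx_eq:
  fixes f :: "nat \<Rightarrow> 'i \<times> nat \<Rightarrow> ennreal"
  shows "(\<Sum>k. \<integral>\<^sup>+i. f k i \<partial>count_space (idx k)) = (\<integral>\<^sup>+p. f (fst p) (snd p) \<partial>count_space all_idx)"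
proof -
  have "(\<integral>\<^sup>+p. f (fst p) (snd p) \<partial>count_space all_idx)
    = (\<integral>\<^sup>+p. f (fst p) (snd p) * indicator all_idx p \<partial>count_space UNIV)"
    by (simp add: nn_integral_count_space_indicator)
  also have "\<dots> = (\<integral>\<^sup>+k. \<integral>\<^sup>+i. f k i * indicator all_idx (k, i) \<partial>count_space UNIV \<partial>count_space UNIV)"
    by (subst nn_integral_fst_count_space[symmetric]) simp
  also have "\<dots> = (\<integral>\<^sup>+k. (\<integral>\<^sup>+i. f k i \<partial>count_space (idx k)) \<partial>count_space UNIV)"
    by (simp add: nn_integral_count_space_indicator all_idx_def indicator_def)
  finally show ?thesis by (simp add: nn_integral_count_space_nat)
qed

text \<open>This is \<open>sum_pker_le\<close> level by level. The scale may vary with the level, as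
  long as it is no finer than the subcubes.\<close>

lemma weighted_sum_pker_le:
  assumes "0 < g"
  shows "\<exists>C>0. \<forall>\<rho> x u (h :: nat \<Rightarrow> real). (\<forall>k. \<delta> ^ k \<le> \<rho> k) \<longrightarrow> (\<forall>k. 0 \<le> h k) \<longrightarrow>
    sample_points u \<longrightarrow>
    (\<integral>\<^sup>+p. ennreal (h (fst p) * (cm p * pker g (\<rho> (fst p)) x (u (fst p) (snd p)))) \<partial>count_space all_idx)
      \<le> ennreal C * (\<Sum>k. ennreal (h k))"
proof -
  obtain C where C: "0 < C" "\<And>k \<rho> x u. \<delta> ^ k \<le> \<rho> \<Longrightarrow> (\<And>i. i \<in> idx k \<Longrightarrow> u i \<in> subc k i) \<Longrightarrow>
    (\<integral>\<^sup>+i. ennreal (measure M (subc k i) * pker g \<rho> x (u i)) \<partial>count_space (idx k)) \<le> ennreal C"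
  proof (rule sum_pker_le[OF assms], goal_cases)
    case (1 C)
    show thesis by (rule that[OF 1(2)]) (rule 1(3); simp)
  qed
  show ?thesis
  proof (intro exI[of _ C] conjI allI impI C(1))
    fix \<rho> x u and h :: "nat \<Rightarrow> real"
    assume "\<forall>k. \<delta> ^ k \<le> \<rho> k" and "\<forall>k. 0 \<le> h k" and "sample_points u"
    then have \<rho>: "\<And>k. \<delta> ^ k \<le> \<rho> k" and h: "\<And>k. 0 \<le> h k" and u: "\<And>k i. i \<in> idx k \<Longrightarrow> u k i \<in> subc k i"
      by auto
    have "(\<integral>\<^sup>+p. ennreal (h (fst p) * (cm p * pker g (\<rho> (fst p)) x (u (fst p) (snd p)))) \<partial>count_space all_idx)
      = (\<Sum>k. \<integral>\<^sup>+i. ennreal (h k * (measure M (subc k i) * pker g (\<rho> k) x (u k i))) \<partial>count_space (idx k))"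
      by (rule suminf_idx_eq[symmetric])
    also have "\<dots> = (\<Sum>k. ennreal (h k) * (\<integral>\<^sup>+i. ennreal (measure M (subc k i) * pker g (\<rho> k) x (u k i)) \<partial>count_space (idx k)))"
      using h by (subst nn_integral_cmult[symmetric]) (auto simp: ennreal_mult)
    also have "\<dots> \<le> (\<Sum>k. ennreal (h k) * ennreal C)"
      by (intro suminf_le mult_left_mono C(2) \<rho> u) auto
    also have "\<dots> = ennreal C * (\<Sum>k. ennreal (h k))"
      by (simp add: mult.commute)
    finally show "(\<integral>\<^sup>+p. ennreal (h (fst p) * (cm p * pker g (\<rho> (fst p)) x (u (fst p) (snd p)))) \<partial>count_space all_idx)
      \<le> ennreal C * (\<Sum>k. ennreal (h k))" .
  qed
qed

text \<open>
  The factor $\delta^{|k-k'|\sigma}$ after level \<open>k\<close> has been rescaled by $\delta^{-ks}$ and level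
  \<open>k'\<close> by $\delta^{-k's}$.
\<close>

definition dyw :: "real \<Rightarrow> real \<Rightarrow> nat \<Rightarrow> nat \<Rightarrow> real" where
  "dyw \<sigma> s k k' = \<delta> powr (\<sigma> * \<bar>real k - real k'\<bar> + s * (real k' - real k))"

text \<open>The rescaling by s costs at most |s| of the decay rate \<sigma>, whichever of the two
  levels is larger.\<close>

lemma dyw_le: "dyw \<sigma> s k k' \<le> \<delta> powr ((\<sigma> - \<bar>s\<bar>) * \<bar>real k - real k'\<bar>)"
proof -
  have "- (s * (real k' - real k)) \<le> \<bar>s * (real k' - real k)\<bar>" by linarith
  also have "\<dots> = \<bar>s\<bar> * \<bar>real k - real k'\<bar>" by (simp add: abs_mult abs_minus_commute)
  finally show ?thesis unfolding dyw_def by (intro delta_powr_mono) (simp add: left_diff_distrib)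
qed

lemma dyw_nonneg [simp]: "0 \<le> dyw \<sigma> s k k'"
  by (simp add: dyw_def)

lemma delta_min: "\<delta> ^ k' \<le> \<delta> ^ min k k'"
  using delta_pos delta_less_1 by (intro power_decreasing) auto

text \<open>Bounds the total mass of the weights in the pointwise estimate. It turns a uniform bound
  on the coefficients into a uniform bound on \<delta>^(-ks)|Q_kf|, and it serves as W in
  \<open>powr_sum_le\<close>.\<close>

lemma dyw_sum_pker_le:
  assumes "0 < \<gamma>" "\<bar>s\<bar> < \<sigma>"
  shows "\<exists>C>0. \<forall>k x u. sample_points u \<longrightarrow>
    (\<integral>\<^sup>+p. ennreal (dyw \<sigma> s k (fst p) * (cm p *
        pker \<gamma> (\<delta> ^ min k (fst p)) x (u (fst p) (snd p)))) \<partial>count_space all_idx) \<le> ennreal C"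
proof -
  obtain C1 where C1: "0 < C1" "\<forall>\<rho> x u (h :: nat \<Rightarrow> real). (\<forall>k. \<delta> ^ k \<le> \<rho> k) \<longrightarrow> (\<forall>k. 0 \<le> h k) \<longrightarrow>
    sample_points u \<longrightarrow>
    (\<integral>\<^sup>+p. ennreal (h (fst p) * (cm p * pker \<gamma> (\<rho> (fst p)) x (u (fst p) (snd p)))) \<partial>count_space all_idx)
      \<le> ennreal C1 * (\<Sum>k. ennreal (h k))"
    using weighted_sum_pker_le[OF assms(1)] by (elim exE conjE) (rule that)
  have pos: "0 < \<sigma> - \<bar>s\<bar>" using assms by simp
  obtain C2 where C2: "0 < C2" "\<And>l k'. (\<Sum>n. ennreal (\<delta> powr ((\<sigma> - \<bar>s\<bar>) * \<bar>real (l + n) - real k'\<bar>))) \<le> ennreal C2"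
    by (rule sum_delta_powr_le[OF pos], rule that)
  show ?thesis
  proof (intro exI[of _ "C1 * C2"] conjI allI impI)
    show "0 < C1 * C2" using C1(1) C2(1) by simp
    fix k x u assume u: "sample_points u"
    have "(\<integral>\<^sup>+p. ennreal (dyw \<sigma> s k (fst p) * (cm p *
        pker \<gamma> (\<delta> ^ min k (fst p)) x (u (fst p) (snd p)))) \<partial>count_space all_idx) \<le> ennreal C1 * (\<Sum>k'. ennreal (dyw \<sigma> s k k'))"
      using u delta_min by (intro C1(2)[rule_format, where \<rho> = "\<lambda>k'. \<delta> ^ min k k'" and h = "dyw \<sigma> s k" and u = u and x = x]) auto
    also have "(\<Sum>k'. ennreal (dyw \<sigma> s k k')) \<le> (\<Sum>k'. ennreal (\<delta> powr ((\<sigma> - \<bar>s\<bar>) * \<bar>real (0 + k') - real k\<bar>)))"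
      using dyw_le[of \<sigma> s k] by (intro suminf_le ennreal_leI) (auto simp: abs_minus_commute)
    also have "\<dots> \<le> ennreal C2" by (rule C2)
    finally show "(\<integral>\<^sup>+p. ennreal (dyw \<sigma> s k (fst p) * (cm p *
        pker \<gamma> (\<delta> ^ min k (fst p)) x (u (fst p) (snd p)))) \<partial>count_space all_idx) \<le> ennreal (C1 * C2)"
      using C1(1) C2(1) by (simp add: ennreal_mult mult_left_mono)
  qed
qed

text \<open>Chosen so that a point farther than this multiple of \<delta>^l from the centre of a
  cube of level l is farther than \<delta>^l from every point of the cube.\<close>

definition near_const :: real where "near_const = A0 * (2 * A0 * C0 + 1)"

text \<open>Levels up to \<open>N\<close>, at which the reproducing formula has no cancellation, never count as near.\<close>

definition near :: "nat \<Rightarrow> nat \<Rightarrow> 'i \<Rightarrow> (nat \<Rightarrow> 'i \<times> nat \<Rightarrow> 'a) \<Rightarrow> (nat \<times> 'i \<times> nat) set" where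
  "near N l \<alpha> u = {p. max l (Suc N) \<le> fst p \<and> d (z (int l) \<alpha>) (u (fst p) (snd p)) \<le> near_const * \<delta> ^ l}"

text \<open>Half of the rate \<sigma> - |s| and half of \<gamma> are kept for the summation; the
  other halves produce the factor with k - l. If k' is below max(l, N+1), then |k-k'| \<ge> k - l -
  N. If the sample point is far, the spatial decay contributes the exponent min(k,k') - l, and k - l
  is at most the sum of this number and |k-k'|.\<close>

lemma dyw_pker_not_near_le:
  assumes "0 < \<gamma>" "\<bar>s\<bar> < \<sigma>"
  defines "\<kappa> \<equiv> min ((\<sigma> - \<bar>s\<bar>) / 2) (\<gamma> / 2)"
  assumes "\<alpha> \<in> A (int l)" "x \<in> cube (int l) \<alpha>" "l \<le> k" "p \<notin> near N l \<alpha> u"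
  shows "dyw \<sigma> s k (fst p) * pker \<gamma> (\<delta> ^ min k (fst p)) x (u (fst p) (snd p))
    \<le> \<delta> powr (- ((\<sigma> - \<bar>s\<bar>) / 2 * real N)) * \<delta> powr (\<kappa> * (real k - real l)) *
      (\<delta> powr ((\<sigma> - \<bar>s\<bar>) / 2 * \<bar>real k - real (fst p)\<bar>) * pker (\<gamma> / 2) (\<delta> ^ min k (fst p)) x (u (fst p) (snd p)))"
proof -
  define k' where "k' = fst p"
  define w where "w = u (fst p) (snd p)"
  define e where "e = (\<sigma> - \<bar>s\<bar>) / 2"
  define D where "D = \<bar>real k - real k'\<bar>"
  define \<rho> where "\<rho> = \<delta> ^ min k k'"
  have \<rho>: "0 < \<rho>" using delta_pos by (simp add: \<rho>_def)
  have e: "0 < e" "\<kappa> \<le> e" "\<kappa> \<le> \<gamma> / 2" "0 < \<kappa>" using assms(1,2) by (auto simp: e_def \<kappa>_def min_def)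
  have dw: "dyw \<sigma> s k k' \<le> \<delta> powr ((e * D + e * D))"
  proof -
    have "2 * e = \<sigma> - \<bar>s\<bar>" by (simp add: e_def)
    then have "e * D + e * D = (\<sigma> - \<bar>s\<bar>) * D" by (metis distrib_right mult_2)
    then show ?thesis using dyw_le[of \<sigma> s k k'] by (simp only: D_def)
  qed
  show ?thesis
  proof (cases "max l (Suc N) \<le> k'")
    case False
    then have "real k' \<le> real l + real N" by auto
    then have "e * (real k - real l - real N) \<le> e * (real k - real k')"
      using e by (intro mult_left_mono) auto
    also have "\<dots> \<le> e * D" using e by (intro mult_left_mono) (auto simp: D_def)
    finally have 1: "e * (real k - real l) - e * real N \<le> e * D" by (simp add: algebra_simps)
    have "\<kappa> * (real k - real l) \<le> e * (real k - real l)"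
      using e assms by (intro mult_right_mono) auto
    then have "- (e * real N) + \<kappa> * (real k - real l) + e * D \<le> (e * D + e * D)" using 1 by linarith
    then have "dyw \<sigma> s k k' \<le> \<delta> powr (- (e * real N)) * \<delta> powr (\<kappa> * (real k - real l)) * \<delta> powr (e * D)"
      using dw delta_powr_mono unfolding powr_add[symmetric] by (meson order_trans)
    moreover have "pker \<gamma> \<rho> x w \<le> pker (\<gamma> / 2) \<rho> x w" using \<rho> assms(1) by (intro pker_mono) auto
    ultimately have "dyw \<sigma> s k k' * pker \<gamma> \<rho> x w
        \<le> \<delta> powr (- (e * real N)) * \<delta> powr (\<kappa> * (real k - real l)) * \<delta> powr (e * D) * pker (\<gamma> / 2) \<rho> x w"
      by (intro mult_mono) auto
    then show ?thesis by (simp only: k'_def w_def e_def D_def \<rho>_def mult.assoc)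
  next
    case True
    then have far: "near_const * \<delta> ^ l < d (z (int l) \<alpha>) w"
      using assms by (auto simp: near_def k'_def w_def)
    have dx: "d (z (int l) \<alpha>) x \<le> 2 * A0 * C0 * \<delta> ^ l"
      using cube_outer[of \<alpha> "int l"] assms by (auto simp: qball_def power_int_of_nat)
    have dxw: "\<delta> ^ l < d x w"
    proof (rule ccontr)
      assume "\<not> \<delta> ^ l < d x w"
      then have "A0 * (d (z (int l) \<alpha>) x + d x w) \<le> A0 * (2 * A0 * C0 * \<delta> ^ l + \<delta> ^ l)"
        using dx A0_pos by (intro mult_left_mono) auto
      then have "d (z (int l) \<alpha>) w \<le> A0 * (2 * A0 * C0 * \<delta> ^ l + \<delta> ^ l)"
        using quasi_triangle[of "z (int l) \<alpha>" w x] by linarith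
      then show False using far by (simp add: near_const_def algebra_simps)
    qed
    have "pker \<gamma> \<rho> x w = (\<rho> / (\<rho> + d x w)) powr (\<gamma> / 2) * pker (\<gamma> / 2) \<rho> x w"
      using pker_add[of "\<gamma> / 2" "\<gamma> / 2" \<rho> x w] by simp
    also have "\<dots> \<le> (\<rho> / \<delta> ^ l) powr (\<gamma> / 2) * pker (\<gamma> / 2) \<rho> x w"
      using \<rho> dxw delta_pos assms(1) dist_nonneg[of x w]
      by (intro mult_right_mono powr_mono2 divide_left_mono) (auto intro!: mult_pos_pos add_pos_nonneg)
    also have "(\<rho> / \<delta> ^ l) powr (\<gamma> / 2) = \<delta> powr (\<gamma> / 2 * (real (min k k') - real l))"
    proof -
      have "\<rho> / \<delta> ^ l = \<delta> powr (real (min k k') - real l)"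
        unfolding \<rho>_def delta_power_powr by (simp add: powr_diff)
      then show ?thesis by (simp add: powr_powr mult.commute)
    qed
    finally have pk: "pker \<gamma> \<rho> x w \<le> \<delta> powr (\<gamma> / 2 * (real (min k k') - real l)) * pker (\<gamma> / 2) \<rho> x w" .
    have m: "0 \<le> real (min k k') - real l" "real k - real l \<le> D + (real (min k k') - real l)"
      using True assms(6) by (auto simp: D_def min_def)
    have D0: "0 \<le> D" by (simp add: D_def)
    have "\<kappa> * (real k - real l) \<le> \<kappa> * (D + (real (min k k') - real l))"
      using m e by (intro mult_left_mono) auto
    also have "\<dots> = \<kappa> * D + \<kappa> * (real (min k k') - real l)" by (rule distrib_left)
    also have "\<dots> \<le> e * D + \<gamma> / 2 * (real (min k k') - real l)"
      using m e D0 by (intro add_mono mult_right_mono) auto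
    finally have "\<kappa> * (real k - real l) \<le> e * D + \<gamma> / 2 * (real (min k k') - real l)" .
    moreover have "0 \<le> e * real N" using e by simp
    ultimately have le: "- (e * real N) + \<kappa> * (real k - real l) + e * D \<le> (e * D + e * D) + \<gamma> / 2 * (real (min k k') - real l)" by linarith
    have "dyw \<sigma> s k k' * pker \<gamma> \<rho> x w \<le> \<delta> powr ((e * D + e * D)) * (\<delta> powr (\<gamma> / 2 * (real (min k k') - real l)) * pker (\<gamma> / 2) \<rho> x w)"
      by (intro mult_mono dw pk) auto
    also have "\<dots> = \<delta> powr ((e * D + e * D) + \<gamma> / 2 * (real (min k k') - real l)) * pker (\<gamma> / 2) \<rho> x w"
      by (simp add: powr_add)
    also have "\<dots> \<le> \<delta> powr (- (e * real N) + \<kappa> * (real k - real l) + e * D) * pker (\<gamma> / 2) \<rho> x w"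
      by (intro mult_right_mono delta_powr_mono le) auto
    finally show ?thesis by (simp only: k'_def w_def e_def D_def \<rho>_def mult.assoc powr_add)
  qed
qed

text \<open>The factor \<delta>^(\<kappa>(k-l)) makes the contribution of these subcubes summable
  over k \<ge> l, although their coefficients are bounded only uniformly.\<close>

lemma dyw_sum_not_near_le:
  assumes "0 < \<gamma>" "\<bar>s\<bar> < \<sigma>"
  defines "\<kappa> \<equiv> min ((\<sigma> - \<bar>s\<bar>) / 2) (\<gamma> / 2)"
  shows "\<exists>C>0. \<forall>k x u l \<alpha>. sample_points u \<longrightarrow>
    \<alpha> \<in> A (int l) \<longrightarrow> x \<in> cube (int l) \<alpha> \<longrightarrow> l \<le> k \<longrightarrow>
    (\<integral>\<^sup>+p. ennreal (dyw \<sigma> s k (fst p) * (cm p *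
        pker \<gamma> (\<delta> ^ min k (fst p)) x (u (fst p) (snd p))) * indicator (- near N l \<alpha> u) p) \<partial>count_space all_idx)
      \<le> ennreal (C * \<delta> powr (\<kappa> * (real k - real l)))"
proof -
  obtain C1 where C1: "0 < C1" "\<forall>\<rho> x u (h :: nat \<Rightarrow> real). (\<forall>k. \<delta> ^ k \<le> \<rho> k) \<longrightarrow> (\<forall>k. 0 \<le> h k) \<longrightarrow>
    sample_points u \<longrightarrow>
    (\<integral>\<^sup>+p. ennreal (h (fst p) * (cm p * pker (\<gamma> / 2) (\<rho> (fst p)) x (u (fst p) (snd p)))) \<partial>count_space all_idx)
      \<le> ennreal C1 * (\<Sum>k. ennreal (h k))"
    using weighted_sum_pker_le[OF half_gt_zero[OF assms(1)]] by (elim exE conjE) (rule that)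
  have pos: "0 < (\<sigma> - \<bar>s\<bar>) / 2" using assms by simp
  obtain C2 where C2: "0 < C2" "\<And>l k'. (\<Sum>n. ennreal (\<delta> powr ((\<sigma> - \<bar>s\<bar>) / 2 * \<bar>real (l + n) - real k'\<bar>))) \<le> ennreal C2"
    by (rule sum_delta_powr_le[OF pos], rule that)
  define B where "B = \<delta> powr (- ((\<sigma> - \<bar>s\<bar>) / 2 * real N))"
  show ?thesis
  proof (intro exI[of _ "B * (C1 * C2)"] conjI allI impI)
    show "0 < B * (C1 * C2)" using C1(1) C2(1) delta_pos by (simp add: B_def)
    fix k x u l \<alpha>
    assume u: "sample_points u" and a: "\<alpha> \<in> A (int l)" "x \<in> cube (int l) \<alpha>" "l \<le> k"
    define h where "h k' = \<delta> powr ((\<sigma> - \<bar>s\<bar>) / 2 * \<bar>real (0 + k') - real k\<bar>)" for k'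
    define G where "G = B * \<delta> powr (\<kappa> * (real k - real l))"
    have G: "0 \<le> G" by (simp add: G_def B_def)
    have "(\<integral>\<^sup>+p. ennreal (dyw \<sigma> s k (fst p) * (cm p *
        pker \<gamma> (\<delta> ^ min k (fst p)) x (u (fst p) (snd p))) * indicator (- near N l \<alpha> u) p) \<partial>count_space all_idx)
      \<le> (\<integral>\<^sup>+p. ennreal G * ennreal (h (fst p) * (cm p * pker (\<gamma> / 2) (\<delta> ^ min k (fst p)) x (u (fst p) (snd p)))) \<partial>count_space all_idx)"
    proof (intro nn_integral_mono)
      fix p
      show "ennreal (dyw \<sigma> s k (fst p) * (cm p *
        pker \<gamma> (\<delta> ^ min k (fst p)) x (u (fst p) (snd p))) * indicator (- near N l \<alpha> u) p)
        \<le> ennreal G * ennreal (h (fst p) * (cm p * pker (\<gamma> / 2) (\<delta> ^ min k (fst p)) x (u (fst p) (snd p))))"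
      proof (cases "p \<in> near N l \<alpha> u")
        case False
        let ?m = "cm p"
        have "dyw \<sigma> s k (fst p) * pker \<gamma> (\<delta> ^ min k (fst p)) x (u (fst p) (snd p))
          \<le> G * (h (fst p) * pker (\<gamma> / 2) (\<delta> ^ min k (fst p)) x (u (fst p) (snd p)))"
          using dyw_pker_not_near_le[OF assms(1,2) a False] by (simp add: G_def B_def h_def \<kappa>_def abs_minus_commute)
        then have "?m * (dyw \<sigma> s k (fst p) * pker \<gamma> (\<delta> ^ min k (fst p)) x (u (fst p) (snd p)))
          \<le> ?m * (G * (h (fst p) * pker (\<gamma> / 2) (\<delta> ^ min k (fst p)) x (u (fst p) (snd p))))"
          by (rule mult_left_mono) simp
        then have "dyw \<sigma> s k (fst p) * (?m * pker \<gamma> (\<delta> ^ min k (fst p)) x (u (fst p) (snd p)))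
          \<le> G * (h (fst p) * (?m * pker (\<gamma> / 2) (\<delta> ^ min k (fst p)) x (u (fst p) (snd p))))"
          by (simp add: mult_ac)
        then show ?thesis
          using False G by (subst ennreal_mult'[symmetric]) (auto intro!: ennreal_leI)
      qed simp
    qed
    also have "\<dots> = ennreal G * (\<integral>\<^sup>+p. ennreal (h (fst p) * (cm p * pker (\<gamma> / 2) (\<delta> ^ min k (fst p)) x (u (fst p) (snd p)))) \<partial>count_space all_idx)"
      by (rule nn_integral_cmult) simp
    also have "\<dots> \<le> ennreal G * (ennreal C1 * (\<Sum>k'. ennreal (h k')))"
      using u delta_min
      by (intro mult_left_mono C1(2)[rule_format, where \<rho> = "\<lambda>k'. \<delta> ^ min k k'" and h = h and u = u and x = x]) (auto simp: h_def)
    also have "\<dots> \<le> ennreal G * (ennreal C1 * ennreal C2)"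
      unfolding h_def by (intro mult_left_mono C2) auto
    also have "\<dots> = ennreal (B * (C1 * C2) * \<delta> powr (\<kappa> * (real k - real l)))"
      using G C1(1) C2(1) by (simp add: G_def mult_ac flip: ennreal_mult)
    finally show "(\<integral>\<^sup>+p. ennreal (dyw \<sigma> s k (fst p) * (cm p *
        pker \<gamma> (\<delta> ^ min k (fst p)) x (u (fst p) (snd p))) * indicator (- near N l \<alpha> u) p) \<partial>count_space all_idx)
      \<le> ennreal (B * (C1 * C2) * \<delta> powr (\<kappa> * (real k - real l)))" .
  qed
qed

end

section \<open>The Carleson-type estimate\<close>

context dyadic_system
begin

text \<open>The weight of the subcube p in the estimate of \<delta>^(-ks)|Q_kf(x)| by the rescaled
  coefficients.\<close>

definition kmass :: "real \<Rightarrow> real \<Rightarrow> real \<Rightarrow> (nat \<Rightarrow> 'i \<times> nat \<Rightarrow> 'a) \<Rightarrow> nat \<Rightarrow> 'a \<Rightarrow> nat \<times> 'i \<times> nat \<Rightarrow> real" where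
  "kmass \<gamma> \<sigma> s u k x p = dyw \<sigma> s k (fst p) * (cm p * pker \<gamma> (\<delta> ^ min k (fst p)) x (u (fst p) (snd p)))"

lemma kmass_nonneg [simp]: "0 \<le> kmass \<gamma> \<sigma> s u k x p"
  by (simp add: kmass_def)

text \<open>Integrating the \<nu>-th power gives \<mu>(E)^\<nu> V^(1-\<nu>), where V is the volume
  at scale \<delta>^min(k,k'). For k \<ge> k' this is at most a multiple of \<mu>(E), and the rate
  of decay in k - k' is \<nu>(\<sigma>-s). For k < k' the ball may be much larger than E, which
  costs hdim (1-\<nu>) of the rate \<nu>(\<sigma>+s); what is left is positive by
  \<open>hdim < \<nu> * (hdim + \<sigma> + s)\<close>. The kernel is centred at the sample point, so
  that x is the variable in which it is measurable.\<close>

lemma kmass_powr_integral: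
  assumes "0 < \<nu>" "\<nu> \<le> 1" "0 < \<gamma>" "hdim < \<nu> * (hdim + \<gamma>)" "hdim < \<nu> * (hdim + \<sigma> + s)" "s < \<sigma>"
  shows "\<exists>C>0. \<forall>u l p B. sample_points u \<longrightarrow> p \<in> all_idx \<longrightarrow> B \<in> sets M \<longrightarrow>
     (\<Sum>n. \<integral>\<^sup>+x\<in>B. ennreal ((dyw \<sigma> s (l + n) (fst p) * (cm p *
        pker \<gamma> (\<delta> ^ min (l + n) (fst p)) (u (fst p) (snd p)) x)) powr \<nu>) \<partial>M) \<le> ennreal (C * cm p)"
proof -
  obtain C1 where C1: "0 < C1" "\<And>\<rho> x. 0 < \<rho> \<Longrightarrow>
    (\<integral>\<^sup>+y. ennreal (pker \<gamma> \<rho> x y powr \<nu>) \<partial>M) \<le> ennreal (C1 * V \<rho> x powr (1 - \<nu>))"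
    using pker_powr_integral[OF assms(1-4)] by metis
  obtain C2 where C2: "0 < C2" "\<And>k i u. i \<in> idx k \<Longrightarrow> u \<in> subc k i \<Longrightarrow> V (\<delta> ^ k) u \<le> C2 * measure M (subc k i)"
    using vol_le_subc by metis
  define \<kappa> where "\<kappa> = min (\<nu> * (\<sigma> - s)) (\<nu> * (\<sigma> + s) - hdim * (1 - \<nu>))"
  have \<kappa>: "0 < \<kappa>" "\<kappa> \<le> \<nu> * (\<sigma> - s)" "\<kappa> \<le> \<nu> * (\<sigma> + s) - hdim * (1 - \<nu>)"
    using assms by (auto simp: \<kappa>_def algebra_simps)
  obtain C3 where C3: "0 < C3" "\<And>l k'. (\<Sum>n. ennreal (\<delta> powr (\<kappa> * \<bar>real (l + n) - real k'\<bar>))) \<le> ennreal C3"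
    by (rule sum_delta_powr_le[OF \<kappa>(1)], rule that)
  define B1 where "B1 = C1 * (Cmu * C2) powr (1 - \<nu>)"
  have B1: "0 < B1" using C1(1) C2(1) Cmu_ge_1 by (simp add: B1_def)
  show ?thesis
  proof (intro exI[of _ "B1 * C3"] conjI allI impI)
    show "0 < B1 * C3" using B1 C3(1) by simp
    fix u l and p :: "nat \<times> 'i \<times> nat" and B
    assume u: "sample_points u" and p: "p \<in> all_idx" and B: "B \<in> sets M"
    define k' where "k' = fst p"
    define w where "w = u (fst p) (snd p)"
    have i: "snd p \<in> idx k'" "w \<in> subc k' (snd p)"
      using p u by (auto simp: all_idx_def k'_def w_def)
    have cmp: "0 < cm p" using subc_measure_pos[OF i(1)] by (simp add: k'_def)
    have one: "(\<integral>\<^sup>+x\<in>B. ennreal ((dyw \<sigma> s k k' * (cm p * pker \<gamma> (\<delta> ^ min k k') w x)) powr \<nu>) \<partial>M)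
      \<le> ennreal (B1 * cm p) * ennreal (\<delta> powr (\<kappa> * \<bar>real k - real k'\<bar>))" for k
    proof -
      define m where "m = min k k'"
      define D where "D = \<bar>real k - real k'\<bar>"
      define d0 where "d0 = dyw \<sigma> s k k'"
      have vm: "V (\<delta> ^ m) w \<le> (Cmu * C2) * \<delta> powr (- (hdim * (real k' - real m))) * cm p"
      proof -
        have "V (\<delta> ^ m) w \<le> Cmu * (\<delta> powr (real m - real k')) powr hdim * V (\<delta> ^ k') w"
        proof (rule vol_le_scale)
          show "1 \<le> \<delta> powr (real m - real k')"
            using delta_powr_mono[of "real m - real k'" 0] delta_pos by (simp add: m_def)
          show "\<delta> ^ m \<le> \<delta> powr (real m - real k') * \<delta> ^ k'"
            using delta_pos by (simp add: delta_power_powr flip: powr_add)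
        qed (use delta_pos in simp)
        also have "\<dots> \<le> Cmu * (\<delta> powr (real m - real k')) powr hdim * (C2 * cm p)"
          using C2(2)[OF i] Cmu_ge_1 by (intro mult_left_mono) (auto simp: k'_def)
        also have "(\<delta> powr (real m - real k')) powr hdim = \<delta> powr (- (hdim * (real k' - real m)))"
          by (simp add: powr_powr algebra_simps)
        finally show ?thesis by (simp add: mult_ac)
      qed
      have "(\<integral>\<^sup>+x\<in>B. ennreal ((d0 * (cm p * pker \<gamma> (\<delta> ^ m) w x)) powr \<nu>) \<partial>M)
        \<le> (\<integral>\<^sup>+x. ennreal (d0 powr \<nu> * cm p powr \<nu>) * ennreal (pker \<gamma> (\<delta> ^ m) w x powr \<nu>) \<partial>M)"
        by (intro nn_integral_mono) (auto simp: indicator_def powr_mult ennreal_mult mult.assoc)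
      also have "\<dots> \<le> ennreal (d0 powr \<nu> * cm p powr \<nu>) * ennreal (C1 * V (\<delta> ^ m) w powr (1 - \<nu>))"
        using delta_pos by (subst nn_integral_cmult) (auto intro!: mult_left_mono C1)
      also have "\<dots> = ennreal (d0 powr \<nu> * cm p powr \<nu> * (C1 * V (\<delta> ^ m) w powr (1 - \<nu>)))"
        using C1(1) by (simp flip: ennreal_mult)
      also have "\<dots> \<le> ennreal (B1 * cm p * \<delta> powr (\<kappa> * D))"
      proof (rule ennreal_leI)
        have "V (\<delta> ^ m) w powr (1 - \<nu>) \<le> ((Cmu * C2) * \<delta> powr (- (hdim * (real k' - real m))) * cm p) powr (1 - \<nu>)"
          using vm assms by (intro powr_mono2) auto
        also have "\<dots> = (Cmu * C2) powr (1 - \<nu>) * \<delta> powr (- (hdim * (real k' - real m) * (1 - \<nu>))) * cm p powr (1 - \<nu>)"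
          by (simp add: powr_mult powr_powr)
        finally have "d0 powr \<nu> * cm p powr \<nu> * (C1 * V (\<delta> ^ m) w powr (1 - \<nu>)) \<le> d0 powr \<nu> * cm p powr \<nu> *
           (C1 * ((Cmu * C2) powr (1 - \<nu>) * \<delta> powr (- (hdim * (real k' - real m) * (1 - \<nu>))) * cm p powr (1 - \<nu>)))"
          using C1(1) by (intro mult_left_mono) auto
        also have "\<dots> = B1 * (cm p powr \<nu> * cm p powr (1 - \<nu>)) * (d0 powr \<nu> * \<delta> powr (- (hdim * (real k' - real m) * (1 - \<nu>))))"
          by (simp add: B1_def mult_ac)
        also have "cm p powr \<nu> * cm p powr (1 - \<nu>) = cm p"
          using cmp by (simp flip: powr_add)
        also have "d0 powr \<nu> * \<delta> powr (- (hdim * (real k' - real m) * (1 - \<nu>)))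
          = \<delta> powr ((\<sigma> * D + s * (real k' - real k)) * \<nu> - hdim * (real k' - real m) * (1 - \<nu>))"
          by (simp add: d0_def dyw_def D_def powr_powr flip: powr_add)
        also have "\<dots> \<le> \<delta> powr (\<kappa> * D)"
        proof (rule delta_powr_mono)
          show "\<kappa> * D \<le> (\<sigma> * D + s * (real k' - real k)) * \<nu> - hdim * (real k' - real m) * (1 - \<nu>)"
          proof (cases "k' \<le> k")
            case True
            then have e: "D = real k - real k'" "real k' - real m = 0" by (auto simp: D_def m_def)
            have "\<kappa> * D \<le> \<nu> * (\<sigma> - s) * D" using \<kappa> by (intro mult_right_mono) (auto simp: D_def)
            also have "\<dots> = (\<sigma> * D + s * (real k' - real k)) * \<nu>"
              unfolding e by (simp add: algebra_simps)
            finally show ?thesis unfolding e(2) by simp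
          next
            case False
            then have e: "D = real k' - real k" "real k' - real m = real k' - real k" by (auto simp: D_def m_def)
            have "\<kappa> * D \<le> (\<nu> * (\<sigma> + s) - hdim * (1 - \<nu>)) * D" using \<kappa> by (intro mult_right_mono) (auto simp: D_def)
            also have "\<dots> = (\<sigma> * D + s * (real k' - real k)) * \<nu> - hdim * (real k' - real m) * (1 - \<nu>)"
              unfolding e by (simp add: algebra_simps)
            finally show ?thesis .
          qed
        qed
        finally show "d0 powr \<nu> * cm p powr \<nu> * (C1 * V (\<delta> ^ m) w powr (1 - \<nu>)) \<le> B1 * cm p * \<delta> powr (\<kappa> * D)"
          using B1 by (simp add: mult_left_mono)
      qed
      finally show ?thesis
        using B1 by (simp add: d0_def m_def D_def flip: ennreal_mult)
    qed
    have "(\<Sum>n. \<integral>\<^sup>+x\<in>B. ennreal ((dyw \<sigma> s (l + n) k' * (cm p * pker \<gamma> (\<delta> ^ min (l + n) k') w x)) powr \<nu>) \<partial>M)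
      \<le> (\<Sum>n. ennreal (B1 * cm p) * ennreal (\<delta> powr (\<kappa> * \<bar>real (l + n) - real k'\<bar>)))"
      by (intro suminf_le one) auto
    also have "\<dots> = ennreal (B1 * cm p) * (\<Sum>n. ennreal (\<delta> powr (\<kappa> * \<bar>real (l + n) - real k'\<bar>)))"
      by simp
    also have "\<dots> \<le> ennreal (B1 * cm p) * ennreal C3"
      by (intro mult_left_mono C3) auto
    also have "\<dots> = ennreal (B1 * C3 * cm p)"
      using B1 C3(1) by (simp add: mult_ac flip: ennreal_mult)
    finally show "(\<Sum>n. \<integral>\<^sup>+x\<in>B. ennreal ((dyw \<sigma> s (l + n) (fst p) * (cm p *
        pker \<gamma> (\<delta> ^ min (l + n) (fst p)) (u (fst p) (snd p)) x)) powr \<nu>) \<partial>M) \<le> ennreal (B1 * C3 * cm p)"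
      by (simp add: k'_def w_def)
  qed
qed

text \<open>Outside \<open>near\<close> the coefficients are replaced by their uniform bound and
  decay in k - l is gained, so the split precedes the r-th power. One of the two parts is at least
  y/2, and each alternative is raised to the power r on its own.\<close>

lemma kmass_split_bound:
  assumes "0 < \<gamma>" "\<bar>s\<bar> < \<sigma>" "0 < r"
  defines "\<kappa> \<equiv> min ((\<sigma> - \<bar>s\<bar>) / 2) (\<gamma> / 2)"
  shows "\<exists>C>0. \<forall>k x u l \<alpha> \<tau> a y. sample_points u \<longrightarrow>
    \<alpha> \<in> A (int l) \<longrightarrow> x \<in> cube (int l) \<alpha> \<longrightarrow> l \<le> k \<longrightarrow> 0 \<le> a \<longrightarrow> 0 \<le> y \<longrightarrow>
    (\<forall>p\<in>all_idx. 0 \<le> \<tau> p \<and> \<tau> p \<le> a) \<longrightarrow>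
    ennreal y \<le> (\<integral>\<^sup>+p. ennreal (kmass \<gamma> \<sigma> s u k x p * \<tau> p) \<partial>count_space all_idx) \<longrightarrow>
    ennreal (y powr r) \<le> ennreal C * (ennreal (a powr r * \<delta> powr (\<kappa> * r * (real k - real l))) +
      (\<integral>\<^sup>+p. ennreal (kmass \<gamma> \<sigma> s u k x p powr (min r 1) * \<tau> p powr r) * indicator (near N l \<alpha> u) p \<partial>count_space all_idx))"
proof -
  obtain C1 where C1: "0 < C1" "\<forall>k x u. sample_points u \<longrightarrow>
    (\<integral>\<^sup>+p. ennreal (dyw \<sigma> s k (fst p) * (cm p *
        pker \<gamma> (\<delta> ^ min k (fst p)) x (u (fst p) (snd p)))) \<partial>count_space all_idx) \<le> ennreal C1"
    using dyw_sum_pker_le[OF assms(1,2)] by (elim exE conjE) (rule that)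
  obtain C2 where C2: "0 < C2" "\<forall>k x u l \<alpha>. sample_points u \<longrightarrow>
    \<alpha> \<in> A (int l) \<longrightarrow> x \<in> cube (int l) \<alpha> \<longrightarrow> l \<le> k \<longrightarrow>
    (\<integral>\<^sup>+p. ennreal (dyw \<sigma> s k (fst p) * (cm p *
        pker \<gamma> (\<delta> ^ min k (fst p)) x (u (fst p) (snd p))) * indicator (- near N l \<alpha> u) p) \<partial>count_space all_idx)
      \<le> ennreal (C2 * \<delta> powr (min ((\<sigma> - \<bar>s\<bar>) / 2) (\<gamma> / 2) * (real k - real l)))"
    using dyw_sum_not_near_le[OF assms(1,2), of N] by (elim exE conjE) (rule that)
  define K where "K = 2 powr r * (1 + 2 powr r * C1 powr (r - 1))"
  define C where "C = K + (2 * C2) powr r"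
  have K: "0 < K" by (auto simp: K_def intro!: mult_pos_pos add_pos_nonneg)
  have C: "0 < C" "K \<le> C" "(2 * C2) powr r \<le> C" using K by (auto simp: C_def intro: add_pos_nonneg)
  show ?thesis
  proof (intro exI[of _ C] conjI allI impI)
    show "0 < C" by fact
    fix k x u l \<alpha> \<tau> a y
    assume u: "sample_points u" and al: "\<alpha> \<in> A (int l)" "x \<in> cube (int l) \<alpha>" "l \<le> k"
      and a: "0 \<le> (a::real)" and y: "0 \<le> (y::real)" and \<tau>: "\<forall>p\<in>all_idx. 0 \<le> \<tau> p \<and> \<tau> p \<le> a"
      and le: "ennreal y \<le> (\<integral>\<^sup>+p. ennreal (kmass \<gamma> \<sigma> s u k x p * \<tau> p) \<partial>count_space all_idx)"
    let ?c = "kmass \<gamma> \<sigma> s u k x"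
    let ?n = "near N l \<alpha> u"
    \<comment> \<open>Set to 0 off \<open>all_idx\<close> as well, since \<open>powr_sum_le\<close>
      wants nonnegative coefficients everywhere.\<close>
    define \<tau>' where "\<tau>' p = (if p \<in> all_idx \<inter> ?n then \<tau> p else 0)" for p
    define X where "X = (\<integral>\<^sup>+p. ennreal (?c p * \<tau>' p) \<partial>count_space all_idx)"
    define b where "b = a * (C2 * \<delta> powr (\<kappa> * (real k - real l)))"
    have b: "0 \<le> b" using a C2(1) by (simp add: b_def)
    have \<tau>'0: "0 \<le> \<tau>' p" for p using \<tau> by (simp add: \<tau>'_def)
    have "ennreal y \<le> (\<integral>\<^sup>+p. ennreal (?c p * \<tau>' p) + ennreal a * ennreal (?c p * indicator (- ?n) p) \<partial>count_space all_idx)"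
    proof (rule order_trans[OF le], rule nn_integral_mono)
      fix p assume "p \<in> space (count_space all_idx)"
      then have p: "p \<in> all_idx" by simp
      have "?c p * \<tau> p \<le> ?c p * \<tau>' p + a * (?c p * indicator (- ?n) p)"
        using \<tau> p mult_left_mono[of "\<tau> p" a "?c p"] by (auto simp: \<tau>'_def indicator_def mult.commute)
      then have "ennreal (?c p * \<tau> p) \<le> ennreal (?c p * \<tau>' p + a * (?c p * indicator (- ?n) p))"
        by (rule ennreal_leI)
      also have "\<dots> = ennreal (?c p * \<tau>' p) + ennreal a * ennreal (?c p * indicator (- ?n) p)"
        using a \<tau>'0[of p] by (simp add: ennreal_mult)
      finally show "ennreal (?c p * \<tau> p) \<le> ennreal (?c p * \<tau>' p) + ennreal a * ennreal (?c p * indicator (- ?n) p)" .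
    qed
    also have "\<dots> = X + ennreal a * (\<integral>\<^sup>+p. ennreal (?c p * indicator (- ?n) p) \<partial>count_space all_idx)"
      by (subst nn_integral_add) (auto simp: nn_integral_cmult X_def)
    also have "\<dots> \<le> X + ennreal a * ennreal (C2 * \<delta> powr (\<kappa> * (real k - real l)))"
      unfolding kmass_def \<kappa>_def using C2(2)[rule_format, where u = u and x = x and k = k and l = l and \<alpha> = \<alpha>] u al
      by (intro add_left_mono mult_left_mono) auto
    also have "\<dots> = X + ennreal b" using a C2(1) by (simp add: b_def ennreal_mult)
    finally have main: "ennreal y \<le> X + ennreal b" .
    show "ennreal (y powr r) \<le> ennreal C * (ennreal (a powr r * \<delta> powr (\<kappa> * r * (real k - real l))) +
      (\<integral>\<^sup>+p. ennreal (?c p powr (min r 1) * \<tau> p powr r) * indicator ?n p \<partial>count_space all_idx))"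
    proof (cases "y \<le> 2 * b")
      case True
      have "y powr r \<le> (2 * b) powr r" using True y assms(3) by (intro powr_mono2) auto
      also have "2 * b = (2 * C2) * (a * \<delta> powr (\<kappa> * (real k - real l)))" by (simp add: b_def)
      also have "\<dots> powr r = (2 * C2) powr r * (a powr r * \<delta> powr (\<kappa> * r * (real k - real l)))"
        by (simp add: powr_mult powr_powr mult_ac)
      also have "\<dots> \<le> C * (a powr r * \<delta> powr (\<kappa> * r * (real k - real l)))"
        using C by (intro mult_right_mono) auto
      finally have "ennreal (y powr r) \<le> ennreal C * ennreal (a powr r * \<delta> powr (\<kappa> * r * (real k - real l)))"
        using C by (simp add: ennreal_leI flip: ennreal_mult)
      also have "\<dots> \<le> ennreal C * (ennreal (a powr r * \<delta> powr (\<kappa> * r * (real k - real l))) +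
         (\<integral>\<^sup>+p. ennreal (?c p powr (min r 1) * \<tau> p powr r) * indicator ?n p \<partial>count_space all_idx))"
        by (intro mult_left_mono) auto
      finally show ?thesis .
    next
      case False
      have "ennreal (y / 2) \<le> X"
      proof (cases "X = \<infinity>")
        case False
        then obtain xr where xr: "0 \<le> xr" "X = ennreal xr" by (cases X) auto
        have "ennreal y \<le> ennreal (xr + b)" using main xr b by simp
        then have "y \<le> xr + b" using xr b by (subst (asm) ennreal_le_iff) auto
        then show ?thesis using xr \<open>\<not> y \<le> 2 * b\<close> by (simp add: ennreal_leI)
      qed simp
      then have "ennreal ((y / 2) powr r) \<le> ennreal (1 + 2 powr r * C1 powr (r - 1)) *
        (\<integral>\<^sup>+p. ennreal (?c p powr (min r 1) * \<tau>' p powr r) \<partial>count_space all_idx)"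
        unfolding X_def using C1(2)[rule_format, where u = u and k = k and x = x] u y \<tau>'0
        by (intro powr_sum_le[OF assms(3) C1(1)]) (auto simp: kmass_def[abs_def])
      also have "(\<integral>\<^sup>+p. ennreal (?c p powr (min r 1) * \<tau>' p powr r) \<partial>count_space all_idx)
        = (\<integral>\<^sup>+p. ennreal (?c p powr (min r 1) * \<tau> p powr r) * indicator ?n p \<partial>count_space all_idx)" (is "_ = ?Z")
        using assms(3) by (intro nn_integral_cong) (auto simp: \<tau>'_def indicator_def)
      finally have half: "ennreal ((y / 2) powr r) \<le> ennreal (1 + 2 powr r * C1 powr (r - 1)) * ?Z" .
      have "ennreal (y powr r) = ennreal (2 powr r) * ennreal ((y / 2) powr r)"
        by (simp add: powr_divide flip: ennreal_mult)
      also have "\<dots> \<le> ennreal (2 powr r) * (ennreal (1 + 2 powr r * C1 powr (r - 1)) * ?Z)"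
        using half by (rule mult_left_mono) simp
      also have "\<dots> = ennreal K * ?Z"
        unfolding K_def by (simp add: ennreal_mult mult.assoc)
      also have "\<dots> \<le> ennreal C * (ennreal (a powr r * \<delta> powr (\<kappa> * r * (real k - real l))) + ?Z)"
        using C by (intro mult_mono ennreal_leI) auto
      finally show ?thesis .
    qed
  qed
qed

text \<open>The part that is not near sums geometrically over the levels from l on, to a multiple of
  a^r times the measure of the cube. For the near part Tonelli's theorem moves the integral in x and
  the sum over the levels onto a single kernel, where \<open>kmass_powr_integral\<close> returns the
  measure of the subcube.\<close>

lemma carleson_estimate:
  assumes "0 < \<gamma>" "\<bar>s\<bar> < \<sigma>" "0 < r" "hdim < min r 1 * (hdim + \<gamma>)" "hdim < min r 1 * (hdim + \<sigma> + s)"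
  shows "\<exists>C>0. \<forall>u l \<alpha> \<tau> a y. sample_points u \<longrightarrow> \<alpha> \<in> A (int l) \<longrightarrow> 0 \<le> a \<longrightarrow>
    (\<forall>k x. 0 \<le> y k x) \<longrightarrow> (\<forall>p\<in>all_idx. 0 \<le> \<tau> p \<and> \<tau> p \<le> a) \<longrightarrow>
    (\<forall>k x. ennreal (y k x) \<le> (\<integral>\<^sup>+p. ennreal (kmass \<gamma> \<sigma> s u k x p * \<tau> p) \<partial>count_space all_idx)) \<longrightarrow>
    (\<integral>\<^sup>+x\<in>cube (int l) \<alpha>. (\<Sum>n. ennreal (y (l + n) x powr r)) \<partial>M) \<le> ennreal C * (ennreal (a powr r) * emeasure M (cube (int l) \<alpha>) +
      (\<integral>\<^sup>+p. ennreal (cm p * \<tau> p powr r) * indicator (near N l \<alpha> u) p \<partial>count_space all_idx))"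
proof -
  define \<kappa> where "\<kappa> = min ((\<sigma> - \<bar>s\<bar>) / 2) (\<gamma> / 2)"
  define \<nu> where "\<nu> = min r 1"
  have \<kappa>: "0 < \<kappa> * r" using assms by (auto simp: \<kappa>_def)
  have \<nu>: "0 < \<nu>" "\<nu> \<le> 1" using assms by (auto simp: \<nu>_def)
  obtain C1 where C1: "0 < C1" "\<forall>k x u l \<alpha> \<tau> a y. sample_points u \<longrightarrow>
    \<alpha> \<in> A (int l) \<longrightarrow> x \<in> cube (int l) \<alpha> \<longrightarrow> l \<le> k \<longrightarrow> 0 \<le> a \<longrightarrow> 0 \<le> y \<longrightarrow>
    (\<forall>p\<in>all_idx. 0 \<le> \<tau> p \<and> \<tau> p \<le> a) \<longrightarrow>
    ennreal y \<le> (\<integral>\<^sup>+p. ennreal (kmass \<gamma> \<sigma> s u k x p * \<tau> p) \<partial>count_space all_idx) \<longrightarrow>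
    ennreal (y powr r) \<le> ennreal C1 * (ennreal (a powr r * \<delta> powr (min ((\<sigma> - \<bar>s\<bar>) / 2) (\<gamma> / 2) * r * (real k - real l))) +
      (\<integral>\<^sup>+p. ennreal (kmass \<gamma> \<sigma> s u k x p powr (min r 1) * \<tau> p powr r) * indicator (near N l \<alpha> u) p \<partial>count_space all_idx))"
    using kmass_split_bound[OF assms(1-3), of N] by (elim exE conjE) (rule that)
  have ss: "s < \<sigma>" using assms by linarith
  obtain C2 where C2: "0 < C2" "\<forall>u l p B. sample_points u \<longrightarrow> p \<in> all_idx \<longrightarrow> B \<in> sets M \<longrightarrow>
     (\<Sum>n. \<integral>\<^sup>+x\<in>B. ennreal ((dyw \<sigma> s (l + n) (fst p) * (cm p *
        pker \<gamma> (\<delta> ^ min (l + n) (fst p)) (u (fst p) (snd p)) x)) powr \<nu>) \<partial>M) \<le> ennreal (C2 * cm p)"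
    using kmass_powr_integral[OF \<nu> assms(1) assms(4,5)[folded \<nu>_def] ss] by (elim exE conjE) (rule that)
  obtain C3 where C3: "0 < C3" "\<And>l k'. (\<Sum>n. ennreal (\<delta> powr (\<kappa> * r * \<bar>real (l + n) - real k'\<bar>))) \<le> ennreal C3"
    by (rule sum_delta_powr_le[OF \<kappa>], rule that)
  define S where "S = Cmu * (2 * A0) powr hdim"
  have S: "0 < S" using Cmu_ge_1 A0_pos by (simp add: S_def)
  define C where "C = C1 * (C3 + S powr \<nu> * C2)"
  have C: "C1 * C3 \<le> C" "C1 * (S powr \<nu> * C2) \<le> C" "0 < C"
    using C1(1) C2(1) C3(1) S by (auto simp: C_def distrib_left intro!: mult_pos_pos add_pos_pos)
  show ?thesis
  proof (intro exI[of _ C] conjI allI impI)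
    show "0 < C" by fact
    fix u l \<alpha> \<tau> a y
    assume u: "sample_points u" and al: "\<alpha> \<in> A (int l)" and a: "0 \<le> (a::real)"
      and y: "\<forall>k x. 0 \<le> (y k x::real)" and \<tau>: "\<forall>p\<in>all_idx. 0 \<le> \<tau> p \<and> \<tau> p \<le> a"
      and le: "\<forall>k x. ennreal (y k x) \<le> (\<integral>\<^sup>+p. ennreal (kmass \<gamma> \<sigma> s u k x p * \<tau> p) \<partial>count_space all_idx)"
    let ?Q = "cube (int l) \<alpha>"
    let ?n = "near N l \<alpha> u"
    have Q [measurable]: "?Q \<in> sets M" using cube_measurable[OF al] .
    \<comment> \<open>The arguments of the kernel are exchanged to make it measurable in x; the
      factor \<open>S powr \<nu>\<close> in \<open>h\<close> pays for this.\<close>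
    define g where "g n p x = (dyw \<sigma> s (l + n) (fst p) * (cm p * pker \<gamma> (\<delta> ^ min (l + n) (fst p)) (u (fst p) (snd p)) x)) powr \<nu>"
      for n x and p :: "nat \<times> 'i \<times> nat"
    have g [measurable]: "(\<lambda>x. g n p x) \<in> borel_measurable M" for n p unfolding g_def by measurable
    define h where "h p = S powr \<nu> * \<tau> p powr r" for p
    have h: "0 \<le> h p" for p by (simp add: h_def)
    have pt: "ennreal (y (l + n) x powr r) \<le> ennreal C1 * (ennreal (a powr r) * ennreal (\<delta> powr (\<kappa> * r * \<bar>real (l + n) - real l\<bar>)) +
       (\<integral>\<^sup>+p. ennreal (h p) * indicator ?n p * ennreal (g n p x) \<partial>count_space all_idx))" if "x \<in> ?Q" for n x
    proof -
      have "ennreal (y (l + n) x powr r) \<le> ennreal C1 * (ennreal (a powr r * \<delta> powr (\<kappa> * r * (real (l + n) - real l))) +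
      (\<integral>\<^sup>+p. ennreal (kmass \<gamma> \<sigma> s u (l + n) x p powr \<nu> * \<tau> p powr r) * indicator ?n p \<partial>count_space all_idx))"
        unfolding \<kappa>_def \<nu>_def
        by (rule C1(2)[rule_format, where u = u and l = l and \<alpha> = \<alpha> and x = x and k = "l + n" and a = a and y = "y (l + n) x" and \<tau> = \<tau>])
          (use u al that a y \<tau> le in simp_all)
      also have "\<dots> \<le> ennreal C1 * (ennreal (a powr r) * ennreal (\<delta> powr (\<kappa> * r * \<bar>real (l + n) - real l\<bar>)) +
       (\<integral>\<^sup>+p. ennreal (h p) * indicator ?n p * ennreal (g n p x) \<partial>count_space all_idx))"
      proof (intro mult_left_mono add_mono nn_integral_mono)
        fix p
        let ?w = "u (fst p) (snd p)"
        let ?\<rho> = "\<delta> ^ min (l + n) (fst p)"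
        have "kmass \<gamma> \<sigma> s u (l + n) x p \<le> dyw \<sigma> s (l + n) (fst p) * (cm p * (S * pker \<gamma> ?\<rho> ?w x))"
          unfolding kmass_def S_def using delta_pos by (intro mult_left_mono pker_sym) auto
        also have "\<dots> = S * (dyw \<sigma> s (l + n) (fst p) * (cm p * pker \<gamma> ?\<rho> ?w x))" by simp
        finally have "kmass \<gamma> \<sigma> s u (l + n) x p powr \<nu> \<le> (S * (dyw \<sigma> s (l + n) (fst p) * (cm p * pker \<gamma> ?\<rho> ?w x))) powr \<nu>"
          using \<nu> by (intro powr_mono2) auto
        also have "\<dots> = S powr \<nu> * g n p x"
          unfolding g_def by (rule powr_mult)
        finally have "kmass \<gamma> \<sigma> s u (l + n) x p powr \<nu> * \<tau> p powr r \<le> S powr \<nu> * g n p x * \<tau> p powr r"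
          by (rule mult_right_mono) simp
        also have "\<dots> = h p * g n p x" by (simp add: h_def)
        finally show "ennreal (kmass \<gamma> \<sigma> s u (l + n) x p powr \<nu> * \<tau> p powr r) * indicator ?n p \<le> ennreal (h p) * indicator ?n p * ennreal (g n p x)"
          using h[of p] by (auto simp: indicator_def ennreal_leI simp flip: ennreal_mult')
      qed (simp_all add: ennreal_mult)
      finally show ?thesis .
    qed
    \<comment> \<open>The integral over the countable set \<open>all_idx\<close> is rewritten as a
      series along an enumeration, whose sum is measurable term by term.\<close>
    have m1: "(\<lambda>x. \<integral>\<^sup>+p. ennreal (h p) * indicator ?n p * ennreal (g n p x) \<partial>count_space all_idx) \<in> borel_measurable M" for n
    proof -
      have "(\<integral>\<^sup>+p. ennreal (h p) * indicator ?n p * ennreal (g n p x) \<partial>count_space all_idx)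
        = (\<Sum>j. if j \<in> to_nat_on all_idx ` all_idx then ennreal (h (from_nat_into all_idx j)) * indicator ?n (from_nat_into all_idx j) * ennreal (g n (from_nat_into all_idx j) x) else 0)" for x
      proof -
        let ?f = "\<lambda>p. ennreal (h p) * indicator ?n p * ennreal (g n p x)"
        have "(\<integral>\<^sup>+p. ?f p \<partial>count_space all_idx) = (\<integral>\<^sup>+j. ?f (from_nat_into all_idx j) \<partial>count_space (to_nat_on all_idx ` all_idx))"
          using bij_betw_inv_into[OF inj_on_imp_bij_betw[OF inj_on_to_nat_on[OF countable_all_idx]]]
          by (subst nn_integral_bij_count_space[symmetric, where g = "from_nat_into all_idx" and A = "to_nat_on all_idx ` all_idx"])
             (auto intro!: bij_betwI[where g = "to_nat_on all_idx"] simp: countable_all_idx)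
        also have "\<dots> = (\<integral>\<^sup>+j. (if j \<in> to_nat_on all_idx ` all_idx then ?f (from_nat_into all_idx j) else 0) \<partial>count_space UNIV)"
          by (subst nn_integral_count_space_indicator) (auto intro!: nn_integral_cong simp: indicator_def)
        finally show ?thesis by (simp add: nn_integral_count_space_nat)
      qed
      then show ?thesis by simp
    qed
    have "(\<integral>\<^sup>+x\<in>?Q. (\<Sum>n. ennreal (y (l + n) x powr r)) \<partial>M)
      \<le> (\<integral>\<^sup>+x. (\<Sum>n. ennreal C1 * (ennreal (a powr r) * ennreal (\<delta> powr (\<kappa> * r * \<bar>real (l + n) - real l\<bar>)) * indicator ?Q x +
       (\<integral>\<^sup>+p. ennreal (h p) * indicator ?n p * ennreal (g n p x) \<partial>count_space all_idx) * indicator ?Q x)) \<partial>M)"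
    proof (intro nn_integral_mono)
      fix x
      show "(\<Sum>n. ennreal (y (l + n) x powr r)) * indicator ?Q x \<le> (\<Sum>n. ennreal C1 * (ennreal (a powr r) * ennreal (\<delta> powr (\<kappa> * r * \<bar>real (l + n) - real l\<bar>)) * indicator ?Q x +
       (\<integral>\<^sup>+p. ennreal (h p) * indicator ?n p * ennreal (g n p x) \<partial>count_space all_idx) * indicator ?Q x))"
      proof (cases "x \<in> ?Q")
        case True
        have "(\<Sum>n. ennreal (y (l + n) x powr r)) \<le> (\<Sum>n. ennreal C1 * (ennreal (a powr r) * ennreal (\<delta> powr (\<kappa> * r * \<bar>real (l + n) - real l\<bar>)) +
          (\<integral>\<^sup>+p. ennreal (h p) * indicator ?n p * ennreal (g n p x) \<partial>count_space all_idx)))"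
          by (rule suminf_le[OF pt[OF True]]) auto
        then show ?thesis using True by (simp only: indicator_simps mult_1_right)
      qed simp
    qed
    also have "\<dots> = (\<Sum>n. ennreal C1 * (ennreal (a powr r) * ennreal (\<delta> powr (\<kappa> * r * \<bar>real (l + n) - real l\<bar>)) * emeasure M ?Q +
       (\<integral>\<^sup>+x. (\<integral>\<^sup>+p. ennreal (h p) * indicator ?n p * ennreal (g n p x) \<partial>count_space all_idx) * indicator ?Q x \<partial>M)))"
    proof (subst nn_integral_suminf)
      let ?I = "\<lambda>n x. \<integral>\<^sup>+p. ennreal (h p) * indicator ?n p * ennreal (g n p x) \<partial>count_space all_idx"
      have m2: "(\<lambda>x. ?I n x * indicator ?Q x) \<in> borel_measurable M" for n
        by (rule borel_measurable_times_ennreal[OF m1 borel_measurable_indicator[OF Q]])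
      have m3: "(\<lambda>x. c * indicator ?Q x) \<in> borel_measurable M" for c :: ennreal
        by (rule borel_measurable_times_ennreal[OF borel_measurable_const borel_measurable_indicator[OF Q]])
      show "(\<lambda>x. ennreal C1 * (ennreal (a powr r) * ennreal (\<delta> powr (\<kappa> * r * \<bar>real (l + n) - real l\<bar>)) * indicator ?Q x + ?I n x * indicator ?Q x)) \<in> borel_measurable M" for n
        by (intro borel_measurable_times_ennreal borel_measurable_add m2 m3 borel_measurable_const)
      have "(\<integral>\<^sup>+x. ennreal C1 * (ennreal (a powr r) * ennreal (\<delta> powr (\<kappa> * r * \<bar>real (l + n) - real l\<bar>)) * indicator ?Q x + ?I n x * indicator ?Q x) \<partial>M)
        = ennreal C1 * (ennreal (a powr r) * ennreal (\<delta> powr (\<kappa> * r * \<bar>real (l + n) - real l\<bar>)) * emeasure M ?Q + (\<integral>\<^sup>+x. ?I n x * indicator ?Q x \<partial>M))" for n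
      proof -
        have "(\<integral>\<^sup>+x. ennreal C1 * (ennreal (a powr r) * ennreal (\<delta> powr (\<kappa> * r * \<bar>real (l + n) - real l\<bar>)) * indicator ?Q x + ?I n x * indicator ?Q x) \<partial>M)
          = ennreal C1 * (\<integral>\<^sup>+x. ennreal (a powr r) * ennreal (\<delta> powr (\<kappa> * r * \<bar>real (l + n) - real l\<bar>)) * indicator ?Q x + ?I n x * indicator ?Q x \<partial>M)"
          by (rule nn_integral_cmult[OF borel_measurable_add[OF m3 m2]])
        also have "(\<integral>\<^sup>+x. ennreal (a powr r) * ennreal (\<delta> powr (\<kappa> * r * \<bar>real (l + n) - real l\<bar>)) * indicator ?Q x + ?I n x * indicator ?Q x \<partial>M)
          = (\<integral>\<^sup>+x. ennreal (a powr r) * ennreal (\<delta> powr (\<kappa> * r * \<bar>real (l + n) - real l\<bar>)) * indicator ?Q x \<partial>M) + (\<integral>\<^sup>+x. ?I n x * indicator ?Q x \<partial>M)"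
          by (rule nn_integral_add[OF m3 m2])
        finally show ?thesis by (simp only: nn_integral_cmult_indicator[OF Q])
      qed
      then show "(\<Sum>n. \<integral>\<^sup>+x. ennreal C1 * (ennreal (a powr r) * ennreal (\<delta> powr (\<kappa> * r * \<bar>real (l + n) - real l\<bar>)) * indicator ?Q x + ?I n x * indicator ?Q x) \<partial>M)
        = (\<Sum>n. ennreal C1 * (ennreal (a powr r) * ennreal (\<delta> powr (\<kappa> * r * \<bar>real (l + n) - real l\<bar>)) * emeasure M ?Q + (\<integral>\<^sup>+x. ?I n x * indicator ?Q x \<partial>M)))"
        by (simp only:)
    qed
    also have "\<dots> = ennreal C1 * (ennreal (a powr r) * (\<Sum>n. ennreal (\<delta> powr (\<kappa> * r * \<bar>real (l + n) - real l\<bar>))) * emeasure M ?Q +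
       (\<Sum>n. \<integral>\<^sup>+x. (\<integral>\<^sup>+p. ennreal (h p) * indicator ?n p * ennreal (g n p x) \<partial>count_space all_idx) * indicator ?Q x \<partial>M))"
      by (simp only: ennreal_suminf_cmult ennreal_suminf_multc suminf_add[OF summableI summableI, symmetric])
    finally have E: "(\<integral>\<^sup>+x\<in>?Q. (\<Sum>n. ennreal (y (l + n) x powr r)) \<partial>M) \<le>
      ennreal C1 * (ennreal (a powr r) * (\<Sum>n. ennreal (\<delta> powr (\<kappa> * r * \<bar>real (l + n) - real l\<bar>))) * emeasure M ?Q +
       (\<Sum>n. \<integral>\<^sup>+x. (\<integral>\<^sup>+p. ennreal (h p) * indicator ?n p * ennreal (g n p x) \<partial>count_space all_idx) * indicator ?Q x \<partial>M))" .
    have E2: "(\<Sum>n. \<integral>\<^sup>+x. (\<integral>\<^sup>+p. ennreal (h p) * indicator ?n p * ennreal (g n p x) \<partial>count_space all_idx) * indicator ?Q x \<partial>M)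
      \<le> ennreal (S powr \<nu> * C2) * (\<integral>\<^sup>+p. ennreal (cm p * \<tau> p powr r) * indicator ?n p \<partial>count_space all_idx)"
    proof -
      have "(\<integral>\<^sup>+x. (\<integral>\<^sup>+p. ennreal (h p) * indicator ?n p * ennreal (g n p x) \<partial>count_space all_idx) * indicator ?Q x \<partial>M)
        = (\<integral>\<^sup>+p. ennreal (h p) * indicator ?n p * (\<integral>\<^sup>+x\<in>?Q. ennreal (g n p x) \<partial>M) \<partial>count_space all_idx)" for n
      proof -
        have "(\<integral>\<^sup>+x. (\<integral>\<^sup>+p. ennreal (h p) * indicator ?n p * ennreal (g n p x) \<partial>count_space all_idx) * indicator ?Q x \<partial>M)
          = (\<integral>\<^sup>+x. (\<integral>\<^sup>+p. ennreal (h p) * indicator ?n p * (ennreal (g n p x) * indicator ?Q x) \<partial>count_space all_idx) \<partial>M)"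
          by (intro nn_integral_cong, subst nn_integral_multc[symmetric]) (auto simp: mult.assoc)
        also have "\<dots> = (\<integral>\<^sup>+p. (\<integral>\<^sup>+x. ennreal (h p) * indicator ?n p * (ennreal (g n p x) * indicator ?Q x) \<partial>M) \<partial>count_space all_idx)"
          by (intro nn_integral_count_space_nn_integral countable_all_idx) measurable
        also have "\<dots> = (\<integral>\<^sup>+p. ennreal (h p) * indicator ?n p * (\<integral>\<^sup>+x\<in>?Q. ennreal (g n p x) \<partial>M) \<partial>count_space all_idx)"
          by (intro nn_integral_cong nn_integral_cmult) measurable
        finally show ?thesis .
      qed
      then have "(\<Sum>n. \<integral>\<^sup>+x. (\<integral>\<^sup>+p. ennreal (h p) * indicator ?n p * ennreal (g n p x) \<partial>count_space all_idx) * indicator ?Q x \<partial>M)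
        = (\<integral>\<^sup>+p. (\<Sum>n. ennreal (h p) * indicator ?n p * (\<integral>\<^sup>+x\<in>?Q. ennreal (g n p x) \<partial>M)) \<partial>count_space all_idx)"
        by (simp only:) (intro nn_integral_suminf[symmetric], simp)
      also have "\<dots> \<le> (\<integral>\<^sup>+p. ennreal (S powr \<nu> * C2) * (ennreal (cm p * \<tau> p powr r) * indicator ?n p) \<partial>count_space all_idx)"
      proof (intro nn_integral_mono)
        fix p assume "p \<in> space (count_space all_idx)"
        then have p: "p \<in> all_idx" by simp
        have "(\<Sum>n. \<integral>\<^sup>+x\<in>?Q. ennreal (g n p x) \<partial>M) \<le> ennreal (C2 * cm p)"
          unfolding g_def by (rule C2(2)[rule_format, where u = u and p = p and B = ?Q and l = l]) (use u p Q in simp_all)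
        then have "(\<Sum>n. ennreal (h p) * indicator ?n p * (\<integral>\<^sup>+x\<in>?Q. ennreal (g n p x) \<partial>M)) \<le> ennreal (h p) * indicator ?n p * ennreal (C2 * cm p)"
          by (simp add: mult_left_mono)
        also have "\<dots> = ennreal (S powr \<nu> * C2) * (ennreal (cm p * \<tau> p powr r) * indicator ?n p)"
          using C2(1) h[of p] by (simp add: h_def indicator_def mult_ac flip: ennreal_mult)
        finally show "(\<Sum>n. ennreal (h p) * indicator ?n p * (\<integral>\<^sup>+x\<in>?Q. ennreal (g n p x) \<partial>M))
          \<le> ennreal (S powr \<nu> * C2) * (ennreal (cm p * \<tau> p powr r) * indicator ?n p)" .
      qed
      also have "\<dots> = ennreal (S powr \<nu> * C2) * (\<integral>\<^sup>+p. ennreal (cm p * \<tau> p powr r) * indicator ?n p \<partial>count_space all_idx)"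
        by (rule nn_integral_cmult) simp
      finally show ?thesis .
    qed
    have "(\<integral>\<^sup>+x\<in>?Q. (\<Sum>n. ennreal (y (l + n) x powr r)) \<partial>M) \<le> ennreal C1 * (ennreal (a powr r) * ennreal C3 * emeasure M ?Q +
      ennreal (S powr \<nu> * C2) * (\<integral>\<^sup>+p. ennreal (cm p * \<tau> p powr r) * indicator ?n p \<partial>count_space all_idx))"
      by (rule order_trans[OF E]) (intro mult_left_mono add_mono mult_right_mono E2 C3(2), simp_all)
    also have "\<dots> = ennreal (C1 * C3) * (ennreal (a powr r) * emeasure M ?Q) +
      ennreal (C1 * (S powr \<nu> * C2)) * (\<integral>\<^sup>+p. ennreal (cm p * \<tau> p powr r) * indicator ?n p \<partial>count_space all_idx)"
      using C1(1) C2(1) C3(1) by (simp add: ennreal_mult distrib_left mult_ac)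
    also have "\<dots> \<le> ennreal C * (ennreal (a powr r) * emeasure M ?Q) + ennreal C * (\<integral>\<^sup>+p. ennreal (cm p * \<tau> p powr r) * indicator ?n p \<partial>count_space all_idx)"
      using C by (intro add_mono mult_right_mono ennreal_leI) auto
    finally show "(\<integral>\<^sup>+x\<in>?Q. (\<Sum>n. ennreal (y (l + n) x powr r)) \<partial>M) \<le> ennreal C * (ennreal (a powr r) * emeasure M ?Q +
      (\<integral>\<^sup>+p. ennreal (cm p * \<tau> p powr r) * indicator ?n p \<partial>count_space all_idx))"
      by (simp add: distrib_left)
  qed
qed

end

section \<open>Sums over nearby subcubes\<close>

lemma powr_add_le_two:
  fixes x y r :: real
  assumes "0 \<le> x" "0 \<le> y" "0 < r"
  shows "(x + y) powr r \<le> 2 powr r * (x powr r + y powr r)"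
proof -
  have "(x + y) powr r \<le> (2 * max x y) powr r"
    using assms by (intro powr_mono2) auto
  also have "\<dots> = 2 powr r * max x y powr r" by (rule powr_mult)
  also have "\<dots> \<le> 2 powr r * (x powr r + y powr r)"
    by (intro mult_left_mono) (auto simp: max_def)
  finally show ?thesis .
qed

lemma nn_integral_disjoint_emeasure_le:
  assumes "disjoint_family_on F I" "countable I" "\<And>i. i \<in> I \<Longrightarrow> F i \<in> sets M" "\<And>i. i \<in> I \<Longrightarrow> F i \<subseteq> B" "B \<in> sets M"
  shows "(\<integral>\<^sup>+i. emeasure M (F i) \<partial>count_space I) \<le> emeasure M B"
proof -
  have "(\<integral>\<^sup>+i. emeasure M (F i) \<partial>count_space I) = (\<integral>\<^sup>+i. (\<integral>\<^sup>+y. indicator (F i) y \<partial>M) \<partial>count_space I)"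
    using assms(3) by (intro nn_integral_cong) simp
  also have "\<dots> = (\<integral>\<^sup>+y. (\<integral>\<^sup>+i. indicator (F i) y \<partial>count_space I) \<partial>M)"
    using assms(2,3) by (intro nn_integral_count_space_nn_integral[symmetric] borel_measurable_indicator)
  also have "\<dots> \<le> (\<integral>\<^sup>+y. indicator B y \<partial>M)"
  proof (intro nn_integral_mono)
    fix y
    show "(\<integral>\<^sup>+i. indicator (F i) y \<partial>count_space I) \<le> indicator B y"
    proof (cases "y \<in> B")
      case True
      then show ?thesis using nn_integral_disjoint_indicator_le[OF assms(1), of 1 y] by simp
    next
      case False
      then have "(\<integral>\<^sup>+i. indicator (F i) y \<partial>count_space I) = (\<integral>\<^sup>+i. 0 \<partial>count_space I)"
        using assms(4) by (intro nn_integral_cong) (auto simp: indicator_def)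
      then show ?thesis by simp
    qed
  qed
  also have "\<dots> = emeasure M B" using assms(5) by simp
  finally show ?thesis .
qed

context dyadic_system
begin

text \<open>L is the first level that is at least l and at which the local part of the norm is
  available. The cube of this level through the sample point contains the whole subcube by nesting,
  and the sample point witnesses that it is close to the centre.\<close>

lemma near_cube_exists:
  assumes "p \<in> near N l \<alpha> u" "p \<in> all_idx" "sample_points u" "y \<in> subc (fst p) (snd p)"
  defines "L \<equiv> int (max l (Suc N))"
  obtains \<tau> where "\<tau> \<in> A L" "y \<in> cube L \<tau>" "\<exists>w\<in>cube L \<tau>. d (z (int l) \<alpha>) w \<le> near_const * \<delta> ^ l"
proof -
  let ?w = "u (fst p) (snd p)"
  have i: "snd p \<in> idx (fst p)" using assms(2) by (auto simp: all_idx_def)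
  have w: "?w \<in> subc (fst p) (snd p)" using assms(3) i by blast
  obtain \<tau>0 where t0: "subc (fst p) (snd p) \<subseteq> cube (int (fst p)) (fst (snd p))" "fst (snd p) \<in> A (int (fst p))"
    using subc_cube[OF i] .
  have "?w \<in> (\<Union>\<tau>\<in>A L. cube L \<tau>)" using cube_cover[of L] by blast
  then obtain \<tau> where t: "\<tau> \<in> A L" "?w \<in> cube L \<tau>" by blast
  have "L \<le> int (fst p)" using assms(1) by (simp add: near_def L_def)
  then have "cube (int (fst p)) (fst (snd p)) \<subseteq> cube L \<tau>"
    using cube_nested[OF _ t(1) t0(2)] w t0(1) t(2) by blast
  then have "y \<in> cube L \<tau>" using assms(4) t0(1) by blast
  moreover have "d (z (int l) \<alpha>) ?w \<le> near_const * \<delta> ^ l" using assms(1) by (simp add: near_def)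
  ultimately show ?thesis using that t by blast
qed

text \<open>No cubes are counted: those of level L in question are disjoint and lie in a ball of
  radius t \<delta>^l about the centre, whose measure is at most a multiple of that of the cube of
  level l.\<close>

lemma near_cubes_emeasure_le:
  shows "\<exists>C>0. \<forall>l L \<alpha>. \<alpha> \<in> A (int l) \<longrightarrow> l \<le> L \<longrightarrow>
    (\<integral>\<^sup>+\<tau>. emeasure M (cube (int L) \<tau>)
       \<partial>count_space {\<tau> \<in> A (int L). \<exists>w\<in>cube (int L) \<tau>. d (z (int l) \<alpha>) w \<le> near_const * \<delta> ^ l})
      \<le> ennreal C * emeasure M (cube (int l) \<alpha>)"
proof -
  \<comment> \<open>The ball has to hold all of a cube that contains a near point; the summand 1
    makes the inclusion strict and gives t \<ge> 1.\<close>
  define t where "t = A0 * (near_const + diam_const) + 1"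
  have nc: "0 < near_const" using A0_pos C0_pos by (simp add: near_const_def add_pos_pos)
  have t: "1 \<le> t" using A0_pos nc diam_const_pos by (simp add: t_def)
  obtain C where C: "0 < C" "\<And>l \<tau> u. \<tau> \<in> A l \<Longrightarrow> u \<in> cube l \<tau> \<Longrightarrow> V (\<delta> powi l) u \<le> C * measure M (cube l \<tau>)"
    using vol_le_cube by blast
  show ?thesis
  proof (intro exI[of _ "Cmu * t powr hdim * C"] conjI allI impI)
    show "0 < Cmu * t powr hdim * C" using t C(1) Cmu_ge_1 by simp
    fix l L \<alpha> assume al: "\<alpha> \<in> A (int l)" "l \<le> L"
    let ?I = "{\<tau> \<in> A (int L). \<exists>w\<in>cube (int L) \<tau>. d (z (int l) \<alpha>) w \<le> near_const * \<delta> ^ l}"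
    let ?B = "qball d (z (int l) \<alpha>) (t * \<delta> ^ l)"
    have "(\<integral>\<^sup>+\<tau>. emeasure M (cube (int L) \<tau>) \<partial>count_space ?I) \<le> emeasure M ?B"
    proof (rule nn_integral_disjoint_emeasure_le)
      show "disjoint_family_on (cube (int L)) ?I"
        using cube_disjoint[of "int L"] by (auto simp: disjoint_family_on_def)
      show "countable ?I" by (rule countable_subset[OF _ countable_A[of "int L"]]) auto
      fix \<tau> assume "\<tau> \<in> ?I"
      then obtain w where \<tau>: "\<tau> \<in> A (int L)" and w: "w \<in> cube (int L) \<tau>" "d (z (int l) \<alpha>) w \<le> near_const * \<delta> ^ l" by blast
      show "cube (int L) \<tau> \<in> sets M" using \<tau> by (rule cube_measurable)
      show "cube (int L) \<tau> \<subseteq> ?B"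
      proof
        fix y assume y: "y \<in> cube (int L) \<tau>"
        have "d w y \<le> diam_const * \<delta> ^ L" using cube_diam[OF \<tau> w(1) y] by (simp add: power_int_of_nat)
        also have "\<dots> \<le> diam_const * \<delta> ^ l"
          using al diam_const_pos delta_pos delta_less_1 by (intro mult_left_mono power_decreasing) auto
        finally have "d (z (int l) \<alpha>) w + d w y \<le> (near_const + diam_const) * \<delta> ^ l"
          using w by (simp add: distrib_right)
        then have "A0 * (d (z (int l) \<alpha>) w + d w y) \<le> A0 * ((near_const + diam_const) * \<delta> ^ l)"
          using A0_pos by (intro mult_left_mono) auto
        then have "d (z (int l) \<alpha>) y \<le> A0 * (near_const + diam_const) * \<delta> ^ l"
          using quasi_triangle[of "z (int l) \<alpha>" y w] by (simp add: mult.assoc)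
        also have "\<dots> < t * \<delta> ^ l" using delta_pos by (simp add: t_def)
        finally show "y \<in> ?B" by (simp add: qball_def)
      qed
    qed simp
    also have "\<dots> = ennreal (V (t * \<delta> ^ l) (z (int l) \<alpha>))" by (rule emeasure_qball)
    also have "\<dots> \<le> ennreal (Cmu * t powr hdim * C * measure M (cube (int l) \<alpha>))"
    proof (rule ennreal_leI)
      have "V (t * \<delta> ^ l) (z (int l) \<alpha>) \<le> Cmu * t powr hdim * V (\<delta> ^ l) (z (int l) \<alpha>)"
        using t delta_pos by (intro vol_scale) auto
      also have "\<dots> \<le> Cmu * t powr hdim * (C * measure M (cube (int l) \<alpha>))"
        using C(2)[OF al(1) cube_center[OF al(1)]] Cmu_ge_1 by (intro mult_left_mono) (auto simp: power_int_of_nat)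
      finally show "V (t * \<delta> ^ l) (z (int l) \<alpha>) \<le> Cmu * t powr hdim * C * measure M (cube (int l) \<alpha>)" by (simp add: mult.assoc)
    qed
    also have "\<dots> = ennreal (Cmu * t powr hdim * C) * emeasure M (cube (int l) \<alpha>)"
      using cube_emeasure[OF al(1)] by (simp add: ennreal_mult'')
    finally show "(\<integral>\<^sup>+\<tau>. emeasure M (cube (int L) \<tau>) \<partial>count_space ?I) \<le> ennreal (Cmu * t powr hdim * C) * emeasure M (cube (int l) \<alpha>)" .
  qed
qed

text \<open>The bound on \<tau> holds at every point of the subcube E, so \<mu>(E) \<tau>^r is at
  most an integral over E. Near subcubes are disjoint at each level and all lie in nearby cubes of
  level L, so the sum becomes the integral of a series over these cubes, to which the hypothesis on
  G applies cube by cube. The errors a 2^(-k) only add a geometric series.\<close>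

lemma near_sum_le:
  assumes "0 < r"
  shows "\<exists>C>0. \<forall>G u a \<tau> l \<alpha>. (\<forall>k. G k \<in> borel_measurable M) \<longrightarrow> (\<forall>k y. 0 \<le> G k y) \<longrightarrow>
    sample_points u \<longrightarrow> 0 < a \<longrightarrow> \<alpha> \<in> A (int l) \<longrightarrow> (\<forall>p\<in>all_idx. 0 \<le> \<tau> p) \<longrightarrow>
    (\<forall>k i y. N < k \<longrightarrow> i \<in> idx k \<longrightarrow> y \<in> subc k i \<longrightarrow> \<tau> (k, i) \<le> G k y + a * (1 / 2) ^ k) \<longrightarrow>
    (\<forall>l' \<alpha>'. N < l' \<longrightarrow> \<alpha>' \<in> A (int l') \<longrightarrow>
       (\<integral>\<^sup>+x\<in>cube (int l') \<alpha>'. (\<Sum>n. ennreal (G (l' + n) x powr r)) \<partial>M) \<le> ennreal (a powr r) * emeasure M (cube (int l') \<alpha>')) \<longrightarrow>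
    (\<integral>\<^sup>+p. ennreal (cm p * \<tau> p powr r) * indicator (near N l \<alpha> u) p \<partial>count_space all_idx)
      \<le> ennreal (C * a powr r) * emeasure M (cube (int l) \<alpha>)"
proof -
  obtain C1 where C1: "0 < C1" "\<forall>l L \<alpha>. \<alpha> \<in> A (int l) \<longrightarrow> l \<le> L \<longrightarrow>
    (\<integral>\<^sup>+\<tau>. emeasure M (cube (int L) \<tau>)
       \<partial>count_space {\<tau> \<in> A (int L). \<exists>w\<in>cube (int L) \<tau>. d (z (int l) \<alpha>) w \<le> near_const * \<delta> ^ l})
      \<le> ennreal C1 * emeasure M (cube (int l) \<alpha>)"
    using near_cubes_emeasure_le by (elim exE conjE) (rule that)
  define b where "b = (1 / 2 :: real) powr r"
  have b: "0 < b" "b < 1" using assms powr_less_mono2[of r "1 / 2" 1] by (auto simp: b_def)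
  \<comment> \<open>2^r comes from separating G from the error under the r-th power, 1 from the
    hypothesis on G, and 1/(1-b) from summing the errors.\<close>
  define K where "K = 2 powr r * (1 + 1 / (1 - b))"
  have K: "0 < K" using b by (auto simp: K_def intro!: mult_pos_pos add_pos_pos)
  show ?thesis
  proof (intro exI[of _ "K * C1"] conjI allI impI)
    show "0 < K * C1" using K C1(1) by simp
    fix G u a \<tau> l \<alpha>
    assume G: "\<forall>k. (G k :: 'a \<Rightarrow> real) \<in> borel_measurable M" and G0: "\<forall>k y. 0 \<le> G k y"
      and u: "sample_points u" and a: "0 < (a :: real)" and al: "\<alpha> \<in> A (int l)"
      and \<tau>0: "\<forall>p\<in>all_idx. 0 \<le> \<tau> p"
      and \<tau>: "\<forall>k i y. N < k \<longrightarrow> i \<in> idx k \<longrightarrow> y \<in> subc k i \<longrightarrow> \<tau> (k, i) \<le> G k y + a * (1 / 2) ^ k"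
      and F: "\<forall>l' \<alpha>'. N < l' \<longrightarrow> \<alpha>' \<in> A (int l') \<longrightarrow>
       (\<integral>\<^sup>+x\<in>cube (int l') \<alpha>'. (\<Sum>n. ennreal (G (l' + n) x powr r)) \<partial>M) \<le> ennreal (a powr r) * emeasure M (cube (int l') \<alpha>')"
    have [measurable]: "G k \<in> borel_measurable M" for k using G by blast
    define L where "L = max l (Suc N)"
    let ?n = "near N l \<alpha> u"
    let ?I = "{\<tau> \<in> A (int L). \<exists>w\<in>cube (int L) \<tau>. d (z (int l) \<alpha>) w \<le> near_const * \<delta> ^ l}"
    define H where "H k y = 2 powr r * (G k y powr r + (a * (1 / 2) ^ k) powr r)" for k y
    have H [measurable]: "H k \<in> borel_measurable M" for k unfolding H_def by measurable
    have H0: "0 \<le> H k y" for k y by (simp add: H_def)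
    have cubeL [measurable]: "cube (int L) \<alpha>' \<in> sets M" if "\<alpha>' \<in> ?I" for \<alpha>' using that cube_measurable by auto
    have step1: "ennreal (cm p * \<tau> p powr r) * indicator ?n p \<le>
       (\<integral>\<^sup>+y. ennreal (H (fst p) y) * indicator (subc (fst p) (snd p)) y * indicator ?n p \<partial>M)" if p: "p \<in> all_idx" for p
    proof (cases "p \<in> ?n")
      case True
      have i: "snd p \<in> idx (fst p)" using p by (auto simp: all_idx_def)
      have k: "N < fst p" using True by (auto simp: near_def)
      have "ennreal (cm p * \<tau> p powr r) = (\<integral>\<^sup>+y. ennreal (\<tau> p powr r) * indicator (subc (fst p) (snd p)) y \<partial>M)"
        using i by (subst nn_integral_cmult_indicator) (auto simp: subc_emeasure ennreal_mult mult.commute)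
      also have "\<dots> \<le> (\<integral>\<^sup>+y. ennreal (H (fst p) y) * indicator (subc (fst p) (snd p)) y \<partial>M)"
      proof (intro nn_integral_mono)
        fix y
        show "ennreal (\<tau> p powr r) * indicator (subc (fst p) (snd p)) y \<le> ennreal (H (fst p) y) * indicator (subc (fst p) (snd p)) y"
        proof (cases "y \<in> subc (fst p) (snd p)")
          case True
          have "\<tau> p \<le> G (fst p) y + a * (1 / 2) ^ fst p"
            using \<tau>[rule_format, OF k i True] by simp
          then have "\<tau> p powr r \<le> (G (fst p) y + a * (1 / 2) ^ fst p) powr r"
            using \<tau>0 p assms by (intro powr_mono2) auto
          also have "\<dots> \<le> H (fst p) y"
            unfolding H_def using G0 a assms by (intro powr_add_le_two) auto
          finally show ?thesis by (intro mult_right_mono ennreal_leI) auto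
        qed simp
      qed
      finally show ?thesis using True by simp
    qed simp
    have step2: "(\<integral>\<^sup>+p. ennreal (H (fst p) y) * indicator (subc (fst p) (snd p)) y * indicator ?n p \<partial>count_space all_idx)
      \<le> (\<integral>\<^sup>+\<alpha>'. (\<Sum>n. ennreal (H (L + n) y)) * indicator (cube (int L) \<alpha>') y \<partial>count_space ?I)" for y
    proof -
      \<comment> \<open>Near subcubes of all levels lie in this union. The levels are summed at a
        point of it before it is broken up into cubes.\<close>
      define U where "U = (\<Union>\<alpha>'\<in>?I. cube (int L) \<alpha>')"
      have "(\<integral>\<^sup>+p. ennreal (H (fst p) y) * indicator (subc (fst p) (snd p)) y * indicator ?n p \<partial>count_space all_idx)
        = (\<Sum>k. \<integral>\<^sup>+i. ennreal (H k y) * indicator (subc k i) y * indicator ?n (k, i) \<partial>count_space (idx k))"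
        by (subst suminf_idx_eq) simp
      also have "\<dots> \<le> (\<Sum>k. (if L \<le> k then ennreal (H k y) * indicator U y else 0))"
      proof (intro suminf_le)
        fix k
        show "(\<integral>\<^sup>+i. ennreal (H k y) * indicator (subc k i) y * indicator ?n (k, i) \<partial>count_space (idx k))
          \<le> (if L \<le> k then ennreal (H k y) * indicator U y else 0)"
        proof (cases "L \<le> k")
          case True
          have "(\<integral>\<^sup>+i. ennreal (H k y) * indicator (subc k i) y * indicator ?n (k, i) \<partial>count_space (idx k))
            \<le> (\<integral>\<^sup>+i. (ennreal (H k y) * indicator U y) * indicator (subc k i) y \<partial>count_space (idx k))"
          proof (intro nn_integral_mono)
            fix i assume "i \<in> space (count_space (idx k))"
            then have i: "i \<in> idx k" by simp
            show "ennreal (H k y) * indicator (subc k i) y * indicator ?n (k, i) \<le> (ennreal (H k y) * indicator U y) * indicator (subc k i) y"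
            proof (cases "y \<in> subc k i \<and> (k, i) \<in> ?n")
              case True
              have n: "(k, i) \<in> ?n" and ki: "(k, i) \<in> all_idx" and y: "y \<in> subc (fst (k, i)) (snd (k, i))"
                using True i by (auto simp: all_idx_def)
              obtain \<alpha>' where "\<alpha>' \<in> A (int L)" "y \<in> cube (int L) \<alpha>'" "\<exists>w\<in>cube (int L) \<alpha>'. d (z (int l) \<alpha>) w \<le> near_const * \<delta> ^ l"
                unfolding L_def by (rule near_cube_exists[OF n ki u y])
              then have "y \<in> U" unfolding U_def by blast
              then show ?thesis using True by simp
            qed (auto simp: indicator_def)
          qed
          also have "\<dots> \<le> ennreal (H k y) * indicator U y"
            by (rule nn_integral_disjoint_indicator_le[OF disjoint_subc])
          finally show ?thesis using True by simp
        next
          case False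
          then have "(\<integral>\<^sup>+i. ennreal (H k y) * indicator (subc k i) y * indicator ?n (k, i) \<partial>count_space (idx k))
            = (\<integral>\<^sup>+i. 0 \<partial>count_space (idx k))"
            by (intro nn_integral_cong) (auto simp: near_def L_def)
          then show ?thesis by simp
        qed
      qed auto
      also have "\<dots> = (\<Sum>n. ennreal (H (L + n) y) * indicator U y)"
        by (subst suminf_offset[where i = L]) (auto simp: add.commute)
      also have "\<dots> = (\<Sum>n. ennreal (H (L + n) y)) * indicator U y" by simp
      also have "\<dots> \<le> (\<integral>\<^sup>+\<alpha>'. (\<Sum>n. ennreal (H (L + n) y)) * indicator (cube (int L) \<alpha>') y \<partial>count_space ?I)"
      proof (cases "y \<in> U")
        case True
        then obtain \<alpha>' where \<alpha>': "\<alpha>' \<in> ?I" "y \<in> cube (int L) \<alpha>'" unfolding U_def by blast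
        then show ?thesis
          using nn_integral_ge_point[OF \<alpha>'(1), of "\<lambda>\<alpha>'. (\<Sum>n. ennreal (H (L + n) y)) * indicator (cube (int L) \<alpha>') y"] True by simp
      qed simp
      finally show ?thesis .
    qed
    have step3: "(\<integral>\<^sup>+y. (\<Sum>n. ennreal (H (L + n) y)) * indicator (cube (int L) \<alpha>') y \<partial>M)
      \<le> ennreal (K * a powr r) * emeasure M (cube (int L) \<alpha>')" if \<alpha>': "\<alpha>' \<in> ?I" for \<alpha>'
    proof -
      have e: "(\<Sum>n. ennreal ((a * (1 / 2) ^ (L + n)) powr r)) \<le> ennreal (a powr r * (1 / (1 - b)))"
      proof -
        have "(a * (1 / 2) ^ (L + n)) powr r \<le> a powr r * b ^ n" for n
        proof -
          have "(1 / 2 :: real) ^ (L + n) \<le> (1 / 2) ^ n" by (intro power_decreasing) auto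
          then have "(a * (1 / 2) ^ (L + n)) powr r \<le> (a * (1 / 2) ^ n) powr r"
            using a assms by (intro powr_mono2 mult_left_mono) auto
          also have "\<dots> = a powr r * ((1 / 2) powr real n) powr r"
            by (simp only: powr_mult) (simp add: powr_realpow)
          also have "((1 / 2 :: real) powr real n) powr r = b ^ n"
            by (simp add: b_def powr_powr mult.commute flip: powr_realpow)
          finally show ?thesis .
        qed
        then have "(\<Sum>n. ennreal ((a * (1 / 2) ^ (L + n)) powr r)) \<le> (\<Sum>n. ennreal (a powr r * b ^ n))"
          by (intro suminf_le ennreal_leI) auto
        also have "\<dots> = ennreal (\<Sum>n. a powr r * b ^ n)"
          using b by (intro suminf_ennreal2 summable_mult summable_geometric) auto
        also have "(\<Sum>n. a powr r * b ^ n) = a powr r * (1 / (1 - b))"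
          using b by (subst suminf_mult) (auto intro: summable_geometric simp: suminf_geometric)
        finally show ?thesis .
      qed
      have "(\<Sum>n. ennreal (H (L + n) y)) \<le> ennreal (2 powr r) * ((\<Sum>n. ennreal (G (L + n) y powr r)) + ennreal (a powr r * (1 / (1 - b))))" for y
      proof -
        have "(\<Sum>n. ennreal (H (L + n) y)) = ennreal (2 powr r) * ((\<Sum>n. ennreal (G (L + n) y powr r)) + (\<Sum>n. ennreal ((a * (1 / 2) ^ (L + n)) powr r)))"
          unfolding H_def by (subst suminf_add) (auto simp: ennreal_mult simp flip: ennreal_suminf_cmult)
        then show ?thesis using e by (simp add: mult_left_mono add_left_mono)
      qed
      then have "(\<integral>\<^sup>+y. (\<Sum>n. ennreal (H (L + n) y)) * indicator (cube (int L) \<alpha>') y \<partial>M)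
        \<le> (\<integral>\<^sup>+y. ennreal (2 powr r) * ((\<Sum>n. ennreal (G (L + n) y powr r)) * indicator (cube (int L) \<alpha>') y
           + ennreal (a powr r * (1 / (1 - b))) * indicator (cube (int L) \<alpha>') y) \<partial>M)"
        by (intro nn_integral_mono) (auto simp: indicator_def)
      also have "\<dots> = ennreal (2 powr r) * ((\<integral>\<^sup>+y\<in>cube (int L) \<alpha>'. (\<Sum>n. ennreal (G (L + n) y powr r)) \<partial>M)
           + ennreal (a powr r * (1 / (1 - b))) * emeasure M (cube (int L) \<alpha>'))"
      proof -
        note [measurable] = cubeL[OF \<alpha>']
        have m1: "(\<lambda>y. (\<Sum>n. ennreal (G (L + n) y powr r)) * indicator (cube (int L) \<alpha>') y) \<in> borel_measurable M" by measurable
        have m2: "(\<lambda>y. ennreal (a powr r * (1 / (1 - b))) * indicator (cube (int L) \<alpha>') y) \<in> borel_measurable M" by measurable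
        show ?thesis
          unfolding nn_integral_cmult[OF borel_measurable_add[OF m1 m2]] nn_integral_add[OF m1 m2]
            nn_integral_cmult_indicator[OF cubeL[OF \<alpha>']] ..
      qed
      also have "\<dots> \<le> ennreal (2 powr r) * (ennreal (a powr r) * emeasure M (cube (int L) \<alpha>') + ennreal (a powr r * (1 / (1 - b))) * emeasure M (cube (int L) \<alpha>'))"
      proof (intro mult_left_mono add_right_mono)
        have "N < L" "\<alpha>' \<in> A (int L)" using \<alpha>' by (auto simp: L_def)
        then show "(\<integral>\<^sup>+y\<in>cube (int L) \<alpha>'. (\<Sum>n. ennreal (G (L + n) y powr r)) \<partial>M) \<le> ennreal (a powr r) * emeasure M (cube (int L) \<alpha>')"
          by (rule F[rule_format])
      qed simp
      also have "\<dots> = (ennreal (2 powr r) * (ennreal (a powr r) + ennreal (a powr r * (1 / (1 - b))))) * emeasure M (cube (int L) \<alpha>')"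
        by (simp only: distrib_left distrib_right mult.assoc)
      also have "ennreal (2 powr r) * (ennreal (a powr r) + ennreal (a powr r * (1 / (1 - b)))) = ennreal (K * a powr r)"
      proof -
        have "ennreal (a powr r) + ennreal (a powr r * (1 / (1 - b))) = ennreal (a powr r * (1 + 1 / (1 - b)))"
          using b by (subst ennreal_plus[symmetric]) (auto simp: distrib_left)
        then show ?thesis
          using b by (simp add: K_def ennreal_mult'[symmetric] mult_ac)
      qed
      finally show ?thesis .
    qed
    have "(\<integral>\<^sup>+p. ennreal (cm p * \<tau> p powr r) * indicator ?n p \<partial>count_space all_idx)
      \<le> (\<integral>\<^sup>+p. (\<integral>\<^sup>+y. ennreal (H (fst p) y) * indicator (subc (fst p) (snd p)) y * indicator ?n p \<partial>M) \<partial>count_space all_idx)"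
      using step1 by (intro nn_integral_mono) simp
    also have "\<dots> = (\<integral>\<^sup>+y. (\<integral>\<^sup>+p. ennreal (H (fst p) y) * indicator (subc (fst p) (snd p)) y * indicator ?n p \<partial>count_space all_idx) \<partial>M)"
    proof (rule nn_integral_count_space_nn_integral[symmetric, OF countable_all_idx])
      fix p assume "p \<in> all_idx"
      then have [measurable]: "subc (fst p) (snd p) \<in> sets M" by (auto simp: all_idx_def)
      show "(\<lambda>y. ennreal (H (fst p) y) * indicator (subc (fst p) (snd p)) y * indicator ?n p) \<in> borel_measurable M" by measurable
    qed
    also have "\<dots> \<le> (\<integral>\<^sup>+y. (\<integral>\<^sup>+\<alpha>'. (\<Sum>n. ennreal (H (L + n) y)) * indicator (cube (int L) \<alpha>') y \<partial>count_space ?I) \<partial>M)"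
      by (intro nn_integral_mono step2)
    also have "\<dots> = (\<integral>\<^sup>+\<alpha>'. (\<integral>\<^sup>+y. (\<Sum>n. ennreal (H (L + n) y)) * indicator (cube (int L) \<alpha>') y \<partial>M) \<partial>count_space ?I)"
    proof (rule nn_integral_count_space_nn_integral)
      show "countable ?I" by (rule countable_subset[OF _ countable_A[of "int L"]]) auto
      fix \<alpha>' assume "\<alpha>' \<in> ?I"
      note [measurable] = cubeL[OF this]
      show "(\<lambda>y. (\<Sum>n. ennreal (H (L + n) y)) * indicator (cube (int L) \<alpha>') y) \<in> borel_measurable M" by measurable
    qed
    also have "\<dots> \<le> (\<integral>\<^sup>+\<alpha>'. ennreal (K * a powr r) * emeasure M (cube (int L) \<alpha>') \<partial>count_space ?I)"
      using step3 by (intro nn_integral_mono) simp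
    also have "\<dots> = ennreal (K * a powr r) * (\<integral>\<^sup>+\<alpha>'. emeasure M (cube (int L) \<alpha>') \<partial>count_space ?I)"
      by (rule nn_integral_cmult) simp
    also have "\<dots> \<le> ennreal (K * a powr r) * (ennreal C1 * emeasure M (cube (int l) \<alpha>))"
      using C1(2)[rule_format, OF al, of L] by (intro mult_left_mono) (auto simp: L_def)
    also have "\<dots> = ennreal (K * C1 * a powr r) * emeasure M (cube (int l) \<alpha>)"
      using K C1(1) by (simp add: ennreal_mult mult_ac)
    finally show "(\<integral>\<^sup>+p. ennreal (cm p * \<tau> p powr r) * indicator ?n p \<partial>count_space all_idx)
      \<le> ennreal (K * C1 * a powr r) * emeasure M (cube (int l) \<alpha>)" .
  qed
qed

end

section \<open>Comparison of the norms\<close>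

text \<open>Finiteness and positivity of m exclude degenerate quotients; an infinite X makes both
  sides false.\<close>

lemma ennreal_powr_le_iff:
  assumes "0 < r" "0 \<le> a" "0 < m"
  shows "ennreal_powr (X / ennreal m) (1 / r) \<le> ennreal a \<longleftrightarrow> X \<le> ennreal (a powr r) * ennreal m"
proof (cases X)
  case (real x)
  have "(x / m) powr (1 / r) \<le> a \<longleftrightarrow> x / m \<le> a powr r"
  proof
    assume "(x / m) powr (1 / r) \<le> a"
    then have "((x / m) powr (1 / r)) powr r \<le> a powr r" using assms by (intro powr_mono2) auto
    then show "x / m \<le> a powr r" using assms real by (simp add: powr_powr)
  next
    assume "x / m \<le> a powr r"
    then have "(x / m) powr (1 / r) \<le> (a powr r) powr (1 / r)" using assms real by (intro powr_mono2) auto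
    then show "(x / m) powr (1 / r) \<le> a" using assms by (simp add: powr_powr)
  qed
  moreover have "X / ennreal m = ennreal (x / m)" using real assms by (simp add: divide_ennreal)
  moreover have "x / m \<le> a powr r \<longleftrightarrow> x \<le> a powr r * m" using assms by (simp add: divide_le_eq)
  ultimately show ?thesis
    using assms real by (simp add: ennreal_powr_def flip: ennreal_mult)
next
  case top
  then show ?thesis
    using assms by (simp add: ennreal_powr_def ennreal_top_divide top_unique flip: ennreal_mult)
qed

lemma exists_approx_minimizer:
  fixes g :: "'b \<Rightarrow> real"
  assumes "S \<noteq> {}" "\<And>y. y \<in> S \<Longrightarrow> 0 \<le> g y" "0 < e"
  shows "\<exists>x\<in>S. \<forall>y\<in>S. g x \<le> g y + e"
proof -
  have "bdd_below (g ` S)" using assms(2) by (intro bdd_belowI2) auto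
  moreover have "Inf (g ` S) < Inf (g ` S) + e" using assms by simp
  ultimately obtain x where x: "x \<in> S" "g x < Inf (g ` S) + e"
    using cInf_lessD[of "g ` S" "Inf (g ` S) + e"] assms(1) by auto
  have "g x \<le> g y + e" if "y \<in> S" for y
    using x cInf_lower[of "g y" "g ` S"] that \<open>bdd_below (g ` S)\<close> by auto
  then show ?thesis using x by blast
qed

context dyadic_system
begin

section \<open>Norm bounds as integral inequalities\<close>

lemma local_norm_le_iff:
  assumes "0 < r" "0 \<le> a" "\<alpha> \<in> A (int l)"
  shows "local_norm M \<delta> s (ereal r) T l (cube (int l) \<alpha>) \<le> ennreal a \<longleftrightarrow>
    (\<integral>\<^sup>+x\<in>cube (int l) \<alpha>. (\<Sum>n. ennreal ((\<delta> powr (- (real (l + n) * s)) * cmod (T (l + n) x)) powr r)) \<partial>M)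
      \<le> ennreal (a powr r) * emeasure M (cube (int l) \<alpha>)"
proof -
  have "(\<delta> powr (- (real (l + n) * s)) * cmod (T (l + n) x)) powr r = \<delta> powr (- real (l + n) * s * r) * cmod (T (l + n) x) powr r" for n x
    by (simp only: powr_mult powr_powr mult_minus_left)
  then show ?thesis
    unfolding local_norm_def Let_def cube_emeasure[OF assms(3)]
    by (simp only: ereal.distinct if_False real_of_ereal.simps ennreal_powr_le_iff[OF assms(1,2) cube_measure_pos[OF assms(3)]] PInfty_neq_ereal)
qed

lemma F_infty_norm_le_iff:
  "F_infty_norm M \<delta> A cube cnt sub s q N T \<le> b \<longleftrightarrow>
    (\<forall>k\<le>N. \<forall>i\<in>idx k. (\<integral>\<^sup>+x\<in>subc k i. ennreal (cmod (T k x)) \<partial>M) / emeasure M (subc k i) \<le> b) \<and>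
    (\<forall>l>N. \<forall>\<alpha>\<in>A (int l). local_norm M \<delta> s q T l (cube (int l) \<alpha>) \<le> b)"
  by (auto simp: F_infty_norm_def SUP_le_iff idx_def subc_def)

lemma subc_mean_le_iff:
  assumes "i \<in> idx k" "0 \<le> a"
  shows "X / emeasure M (subc k i) \<le> ennreal a \<longleftrightarrow> X \<le> ennreal (a * measure M (subc k i))"
proof (cases X)
  case (real x)
  then show ?thesis
    using assms subc_measure_pos[OF assms(1)]
    by (simp add: subc_emeasure divide_ennreal divide_le_eq)
next
  case top
  then show ?thesis
    using assms by (simp add: subc_emeasure ennreal_top_divide top_unique)
qed

text \<open>The local part of the norm averages over cubes, whereas the coefficients live on their
  subcubes; the parent lies in a ball about any point of the subcube, of radius comparable to
  \<delta>^k.\<close>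

lemma cube_le_subc:
  shows "\<exists>C>0. \<forall>k. \<forall>i\<in>idx k. measure M (cube (int k) (fst i)) \<le> C * measure M (subc k i)"
proof -
  obtain C where C: "0 < C" "\<And>k i u. i \<in> idx k \<Longrightarrow> u \<in> subc k i \<Longrightarrow> V (\<delta> ^ k) u \<le> C * measure M (subc k i)"
    using vol_le_subc by blast
  define t where "t = diam_const + 1"
  have t: "1 \<le> t" using diam_const_pos by (simp add: t_def)
  show ?thesis
  proof (intro exI[of _ "Cmu * t powr hdim * C"] conjI allI ballI)
    show "0 < Cmu * t powr hdim * C" using C(1) t Cmu_ge_1 by simp
    fix k i assume i: "i \<in> idx k"
    obtain \<alpha> where sub: "subc k i \<subseteq> cube (int k) (fst i)" "fst i \<in> A (int k)" using subc_cube[OF i] .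
    obtain u where u: "u \<in> subc k i" using subc_nonempty[OF i] by blast
    have "cube (int k) (fst i) \<subseteq> qball d u (t * \<delta> ^ k)"
    proof
      fix y assume "y \<in> cube (int k) (fst i)"
      then have "d u y \<le> diam_const * \<delta> ^ k" using cube_diam[OF sub(2)] u sub(1) by (force simp: power_int_of_nat)
      also have "\<dots> < t * \<delta> ^ k" using delta_pos by (simp add: t_def)
      finally show "y \<in> qball d u (t * \<delta> ^ k)" by (simp add: qball_def)
    qed
    then have "emeasure M (cube (int k) (fst i)) \<le> emeasure M (qball d u (t * \<delta> ^ k))"
      by (intro emeasure_mono) auto
    then have "measure M (cube (int k) (fst i)) \<le> V (t * \<delta> ^ k) u"
      by (simp add: cube_emeasure[OF sub(2)] emeasure_qball)
    also have "\<dots> \<le> Cmu * t powr hdim * V (\<delta> ^ k) u"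
      using t delta_pos by (intro vol_scale) auto
    also have "\<dots> \<le> Cmu * t powr hdim * (C * measure M (subc k i))"
      using C(2)[OF i u] Cmu_ge_1 by (intro mult_left_mono) auto
    finally show "measure M (cube (int k) (fst i)) \<le> Cmu * t powr hdim * C * measure M (subc k i)"
      by (simp add: mult.assoc)
  qed
qed

lemma F_infty_norm_mean_le:
  assumes "F_infty_norm M \<delta> A cube cnt sub s q N T \<le> ennreal a" "0 < a" "k \<le> N" "i \<in> idx k"
  shows "cmod (mean M (subc k i) (T k)) \<le> a"
proof -
  have "(\<integral>\<^sup>+x\<in>subc k i. ennreal (cmod (T k x)) \<partial>M) / emeasure M (subc k i) \<le> ennreal a"
    using assms(1,3,4) unfolding F_infty_norm_le_iff by blast
  then have le: "(\<integral>\<^sup>+x\<in>subc k i. ennreal (cmod (T k x)) \<partial>M) \<le> ennreal (a * measure M (subc k i))"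
    using assms by (subst (asm) subc_mean_le_iff) auto
  have "cmod (LINT x:subc k i|M. T k x) \<le> a * measure M (subc k i)"
    unfolding set_lebesgue_integral_def
  proof (rule cmod_integral_le)
    have "(\<integral>\<^sup>+y. ennreal (cmod (indicator (subc k i) y *\<^sub>R T k y)) \<partial>M) = (\<integral>\<^sup>+x\<in>subc k i. ennreal (cmod (T k x)) \<partial>M)"
      by (intro nn_integral_cong) (auto simp: indicator_def)
    then show "(\<integral>\<^sup>+y. ennreal (cmod (indicator (subc k i) y *\<^sub>R T k y)) \<partial>M) \<le> ennreal (a * measure M (subc k i))"
      using le by simp
  qed (use assms in auto)
  then show ?thesis
    using subc_measure_pos[OF assms(4)] by (simp add: mean_def norm_divide divide_le_eq)
qed

text \<open>A bound at one point of the subcube suffices, because the value at a near minimiser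
  exceeds the value at any other point only by a small error. If all values were larger, the single
  term of level k would already push the local norm over the parent cube beyond a.\<close>

lemma F_infty_norm_witness:
  assumes "q = \<infinity> \<or> (\<exists>r>0. q = ereal r)"
  shows "\<exists>C>0. \<forall>T a k. \<forall>i\<in>idx k. F_infty_norm M \<delta> A cube cnt sub s q N T \<le> ennreal a \<longrightarrow> 0 < a \<longrightarrow> N < k \<longrightarrow>
    (\<exists>y\<in>subc k i. \<delta> powr (- (real k * s)) * cmod (T k y) \<le> C * a)"
proof (cases "q = \<infinity>")
  case True
  show ?thesis
  proof (intro exI[of _ 1] conjI allI ballI impI)
    fix T a k i
    assume i: "i \<in> idx k" and F: "F_infty_norm M \<delta> A cube cnt sub s q N T \<le> ennreal a" and a: "0 < (a::real)" and k: "N < k"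
    obtain \<tau> where sub: "subc k i \<subseteq> cube (int k) (fst i)" "fst i \<in> A (int k)" using subc_cube[OF i] .
    let ?E = "cube (int k) (fst i)"
    let ?f = "\<lambda>x. SUP k\<in>{k..}. ennreal (\<delta> powr (- real k * s) * cmod (T k x))"
    have E: "?E \<in> sets M" using sub(2) by (rule cube_measurable)
    have "local_norm M \<delta> s q T k ?E \<le> ennreal a"
      using F k sub(2) unfolding F_infty_norm_le_iff by blast
    then have es: "esssup (restrict_space M ?E) ?f \<le> ennreal a"
      using True by (simp add: local_norm_def)
    have "AE x in restrict_space M ?E. ?f x \<le> ennreal a"
      using esssup_AE[of ?f "restrict_space M ?E"] by eventually_elim (use es in auto)
    then have ae: "AE x in M. x \<in> ?E \<longrightarrow> ?f x \<le> ennreal a"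
      using E by (subst (asm) AE_restrict_space_iff) (auto simp: space_UNIV)
    show "\<exists>y\<in>subc k i. \<delta> powr (- (real k * s)) * cmod (T k y) \<le> 1 * a"
    proof (rule ccontr)
      assume no: "\<not> ?thesis"
      have "AE x in M. x \<notin> subc k i"
        using ae
      proof eventually_elim
        fix x assume x: "x \<in> ?E \<longrightarrow> ?f x \<le> ennreal a"
        show "x \<notin> subc k i"
        proof
          assume xs: "x \<in> subc k i"
          have "ennreal (\<delta> powr (- real k * s) * cmod (T k x)) \<le> ?f x" by (intro SUP_upper) auto
          also have "\<dots> \<le> ennreal a" using x xs sub(1) by blast
          finally have "\<delta> powr (- (real k * s)) * cmod (T k x) \<le> a" using a by simp
          then show False using no xs by auto
        qed
      qed
      then have "emeasure M (subc k i) = 0"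
        using subc_sets[OF i] by (subst (asm) AE_iff_measurable[of "subc k i"]) (auto simp: space_UNIV)
      then show False using subc_emeasure[OF i] subc_measure_pos[OF i] by simp
    qed
  qed simp
next
  case False
  then obtain r where r: "0 < r" "q = ereal r" using assms by blast
  obtain C where C: "0 < C" "\<forall>k. \<forall>i\<in>idx k. measure M (cube (int k) (fst i)) \<le> C * measure M (subc k i)"
    using cube_le_subc by (elim exE conjE) (rule that)
  \<comment> \<open>C compares the parent with the subcube; the extra 1 makes the contradiction
    strict.\<close>
  define B where "B = (C + 1) powr (1 / r)"
  have B: "0 < B" "B powr r = C + 1" using C(1) r by (auto simp: B_def powr_powr)
  show ?thesis
  proof (intro exI[of _ B] conjI allI ballI impI)
    show "0 < B" by fact
    fix T a k i
    assume i: "i \<in> idx k" and F: "F_infty_norm M \<delta> A cube cnt sub s q N T \<le> ennreal a" and a: "0 < (a::real)" and k: "N < k"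
    obtain \<tau> where sub: "subc k i \<subseteq> cube (int k) (fst i)" "fst i \<in> A (int k)" using subc_cube[OF i] .
    let ?E = "cube (int k) (fst i)"
    let ?g = "\<lambda>n x. \<delta> powr (- (real (k + n) * s)) * cmod (T (k + n) x)"
    have "local_norm M \<delta> s q T k ?E \<le> ennreal a"
      using F k sub(2) unfolding F_infty_norm_le_iff by blast
    then have le: "(\<integral>\<^sup>+x\<in>?E. (\<Sum>n. ennreal (?g n x powr r)) \<partial>M) \<le> ennreal (a powr r) * emeasure M ?E"
      using a r sub by (simp add: local_norm_le_iff)
    show "\<exists>y\<in>subc k i. \<delta> powr (- (real k * s)) * cmod (T k y) \<le> B * a"
    proof (rule ccontr)
      assume no: "\<not> ?thesis"
      have "ennreal ((B * a) powr r) * emeasure M (subc k i) = (\<integral>\<^sup>+x. ennreal ((B * a) powr r) * indicator (subc k i) x \<partial>M)"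
        using i by (simp add: nn_integral_cmult_indicator)
      also have "\<dots> \<le> (\<integral>\<^sup>+x\<in>?E. (\<Sum>n. ennreal (?g n x powr r)) \<partial>M)"
      proof (intro nn_integral_mono)
        fix x
        show "ennreal ((B * a) powr r) * indicator (subc k i) x \<le> (\<Sum>n. ennreal (?g n x powr r)) * indicator ?E x"
        proof (cases "x \<in> subc k i")
          case True
          have "B * a \<le> ?g 0 x" using no True by auto
          then have "(B * a) powr r \<le> ?g 0 x powr r" using B(1) a r by (intro powr_mono2) auto
          then have "ennreal ((B * a) powr r) \<le> ennreal (?g 0 x powr r)" by (rule ennreal_leI)
          also have "\<dots> \<le> (\<Sum>n. ennreal (?g n x powr r))"
            by (rule order_trans[OF _ sum_le_suminf[OF summableI, of "{0}"]]) simp_all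
          finally show ?thesis using True sub(1) by auto
        qed simp
      qed
      also have "\<dots> \<le> ennreal (a powr r) * emeasure M ?E" by (rule le)
      also have "\<dots> = ennreal (a powr r * measure M ?E)"
        by (simp add: cube_emeasure[OF sub(2)] ennreal_mult)
      finally have "ennreal ((B * a) powr r * measure M (subc k i)) \<le> ennreal (a powr r * measure M ?E)"
        by (simp add: subc_emeasure[OF i] ennreal_mult)
      then have "(B * a) powr r * measure M (subc k i) \<le> a powr r * measure M ?E" by simp
      also have "(B * a) powr r = a powr r * (C + 1)" by (simp only: powr_mult B(2)) simp
      also have "a powr r * measure M ?E \<le> a powr r * (C * measure M (subc k i))"
        using C(2) i by (intro mult_left_mono) auto
      finally have "(a powr r * measure M (subc k i)) * (C + 1) \<le> (a powr r * measure M (subc k i)) * C" by (simp add: mult_ac)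
      moreover have "0 < a powr r * measure M (subc k i)" using a subc_measure_pos[OF i] by simp
      ultimately show False by (simp add: mult_le_cancel_left)
    qed
  qed
qed

text \<open>Joins the pointwise estimate with the choice of points. D and B come before f and a,
  whereas \<open>u\<close> and \<tau> depend on both. The last clause is later used at every y of
  the subcube; the uniform bound on \<tau> needs it at one point only.\<close>

lemma dist_op_coefficients:
  assumes Q: "exp_IATI M d \<delta> Y \<eta> Q" and crf: "crf_integer M d A0 x0 \<delta> A cnt sub \<eta> \<beta> \<gamma> P N"
    and par: "0 < \<beta>" "\<beta> < \<eta>" "0 < \<gamma>" "\<gamma> < \<eta>" "\<eta> < 1" "0 < \<sigma>" "\<sigma> < \<beta>" "\<sigma> < \<gamma>"
    and q: "q = \<infinity> \<or> (\<exists>r>0. q = ereal r)"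
  shows "\<exists>D>0. \<exists>B>0. \<forall>f\<in>distributions M d A0 x0 \<eta> \<beta> \<gamma>. \<forall>a>0.
    F_infty_norm M \<delta> A cube cnt sub s q N (dist_op P f) \<le> ennreal a \<longrightarrow>
    (\<exists>u \<tau>. sample_points u \<and> (\<forall>p\<in>all_idx. 0 \<le> \<tau> p \<and> \<tau> p \<le> B * a) \<and>
      (\<forall>k x. ennreal (\<delta> powr (- (real k * s)) * cmod (dist_op Q f k x))
         \<le> (\<integral>\<^sup>+p. ennreal (kmass \<gamma> \<sigma> s u k x p * \<tau> p) \<partial>count_space all_idx)) \<and>
      (\<forall>k i y. N < k \<longrightarrow> i \<in> idx k \<longrightarrow> y \<in> subc k i \<longrightarrow>
         \<tau> (k, i) \<le> D * (\<delta> powr (- (real k * s)) * cmod (dist_op P f k y)) + D * a * (1 / 2) ^ k))"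
proof -
  obtain D where D: "0 < D" "\<And>f u k x. f \<in> distributions M d A0 x0 \<eta> \<beta> \<gamma> \<Longrightarrow> (\<And>k i. i \<in> idx k \<Longrightarrow> u k i \<in> subc k i) \<Longrightarrow>
       ennreal (cmod (dist_op Q f k x)) \<le> ennreal D * (\<Sum>k'. \<integral>\<^sup>+i. ennreal (\<delta> powr (\<sigma> * \<bar>real k - real k'\<bar>) *
         (measure M (subc k' i) * pker \<gamma> (\<delta> ^ min k k') x (u k' i)) * crf_coeff N (dist_op P f) u k' i) \<partial>count_space (idx k'))"
  proof (rule dist_op_pointwise[OF Q crf par], goal_cases)
    case (1 D)
    show thesis by (rule that[OF 1(2)]) (rule 1(3); simp)
  qed
  obtain C where C: "0 < C" "\<forall>T a k. \<forall>i\<in>idx k. F_infty_norm M \<delta> A cube cnt sub s q N T \<le> ennreal a \<longrightarrow> 0 < a \<longrightarrow> N < k \<longrightarrow>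
    (\<exists>y\<in>subc k i. \<delta> powr (- (real k * s)) * cmod (T k y) \<le> C * a)"
    using F_infty_norm_witness[where N = N and s = s, OF q] by (elim exE conjE) (rule that)
  \<comment> \<open>The summands serve, in this order, the means at levels up to N, the value at the
    point from \<open>F_infty_norm_witness\<close>, and the error of the near minimiser.\<close>
  define B where "B = D * (\<delta> powr (- (real N * \<bar>s\<bar>)) + C + 1)"
  have B: "0 < B" using D(1) C(1) by (auto simp: B_def intro!: mult_pos_pos add_nonneg_pos)
  show ?thesis
  proof (rule exI[of _ D], intro conjI D(1), rule exI[of _ B], intro conjI B ballI allI impI)
    fix f a
    assume f: "f \<in> distributions M d A0 x0 \<eta> \<beta> \<gamma>" and a: "0 < (a::real)"
      and F: "F_infty_norm M \<delta> A cube cnt sub s q N (dist_op P f) \<le> ennreal a"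
    let ?T = "dist_op P f"
    \<comment> \<open>The infimum over a subcube need not be attained; these errors stay summable after rescaling.\<close>
    define e where "e k = a * (1 / 2) ^ k * \<delta> powr (real k * s)" for k
    have e: "0 < e k" for k using a delta_pos by (simp add: e_def)
    have ex: "\<exists>w. i \<in> idx k \<longrightarrow> w \<in> subc k i \<and> (\<forall>y\<in>subc k i. cmod (?T k w) \<le> cmod (?T k y) + e k)" for k i
    proof (cases "i \<in> idx k")
      case True
      then show ?thesis
        using exists_approx_minimizer[OF subc_nonempty[OF True], of "\<lambda>y. cmod (?T k y)" "e k"] e by auto
    qed simp
    define u where "u k i = (SOME w. i \<in> idx k \<longrightarrow> w \<in> subc k i \<and> (\<forall>y\<in>subc k i. cmod (?T k w) \<le> cmod (?T k y) + e k))" for k i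
    have u: "u k i \<in> subc k i \<and> (\<forall>y\<in>subc k i. cmod (?T k (u k i)) \<le> cmod (?T k y) + e k)" if "i \<in> idx k" for k i
    proof -
      have "i \<in> idx k \<longrightarrow> u k i \<in> subc k i \<and> (\<forall>y\<in>subc k i. cmod (?T k (u k i)) \<le> cmod (?T k y) + e k)"
        unfolding u_def by (rule someI_ex[OF ex])
      then show ?thesis using that by blast
    qed
    \<comment> \<open>D is absorbed here, so that the pointwise estimate below has constant
      1.\<close>
    define \<tau> where "\<tau> p = D * (\<delta> powr (- (real (fst p) * s)) * crf_coeff N ?T u (fst p) (snd p))" for p :: "nat \<times> 'i \<times> nat"
    have \<tau>0: "0 \<le> \<tau> p" for p using D(1) by (simp add: \<tau>_def crf_coeff_def)
    have de: "\<delta> powr (- (real k * s)) * e k = a * (1 / 2) ^ k" for k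
      using delta_pos by (simp add: e_def powr_minus field_simps)
    have fine: "\<tau> (k, i) \<le> D * (\<delta> powr (- (real k * s)) * cmod (?T k y)) + D * a * (1 / 2) ^ k"
      if "N < k" "i \<in> idx k" "y \<in> subc k i" for k i y
    proof -
      have "\<tau> (k, i) = D * (\<delta> powr (- (real k * s)) * cmod (?T k (u k i)))"
        using that by (simp add: \<tau>_def crf_coeff_def)
      also have "\<dots> \<le> D * (\<delta> powr (- (real k * s)) * (cmod (?T k y) + e k))"
        using u that D(1) by (intro mult_left_mono) auto
      also have "\<dots> = D * (\<delta> powr (- (real k * s)) * cmod (?T k y)) + D * (\<delta> powr (- (real k * s)) * e k)"
        by (simp add: distrib_left)
      finally show ?thesis by (simp add: de mult.assoc)
    qed
    have unif: "\<tau> p \<le> B * a" if p: "p \<in> all_idx" for p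
    proof -
      obtain k i where ki: "p = (k, i)" "i \<in> idx k" using p by (auto simp: all_idx_def)
      show ?thesis
      proof (cases "k \<le> N")
        case True
        have "\<tau> p = D * (\<delta> powr (- (real k * s)) * cmod (mean M (subc k i) (?T k)))"
          using True by (simp add: \<tau>_def crf_coeff_def ki)
        also have "\<dots> \<le> D * (\<delta> powr (- (real N * \<bar>s\<bar>)) * a)"
        proof (intro mult_left_mono mult_mono delta_powr_mono)
          have "real k * s \<le> real k * \<bar>s\<bar>" by (intro mult_left_mono) auto
          moreover have "real k * \<bar>s\<bar> \<le> real N * \<bar>s\<bar>" using True by (intro mult_right_mono) auto
          ultimately show "- (real N * \<bar>s\<bar>) \<le> - (real k * s)" by simp
          show "cmod (mean M (subc k i) (?T k)) \<le> a" by (rule F_infty_norm_mean_le[OF F a True ki(2)])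
        qed (use D(1) in auto)
        also have "\<dots> \<le> D * ((\<delta> powr (- (real N * \<bar>s\<bar>)) + C + 1) * a)"
          using D(1) C(1) a by (intro mult_left_mono mult_right_mono) auto
        finally show ?thesis by (simp add: B_def mult.assoc)
      next
        case False
        then have k: "N < k" by simp
        obtain y where y: "y \<in> subc k i" "\<delta> powr (- (real k * s)) * cmod (?T k y) \<le> C * a"
          using C(2)[rule_format, OF ki(2) F a k] by blast
        have "\<tau> p \<le> D * (\<delta> powr (- (real k * s)) * cmod (?T k y)) + D * a * (1 / 2) ^ k"
          unfolding ki using k ki(2) y(1) by (rule fine)
        also have "\<dots> \<le> D * (C * a) + D * a * 1"
          using y(2) D(1) a by (intro add_mono mult_left_mono power_le_one) auto
        also have "\<dots> \<le> B * a"
          using D(1) a by (simp add: B_def algebra_simps)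
        finally show ?thesis .
      qed
    qed
    have pt: "ennreal (\<delta> powr (- (real k * s)) * cmod (dist_op Q f k x))
         \<le> (\<integral>\<^sup>+p. ennreal (kmass \<gamma> \<sigma> s u k x p * \<tau> p) \<partial>count_space all_idx)" for k x
    proof -
      let ?w = "\<lambda>k' i. \<delta> powr (\<sigma> * \<bar>real k - real k'\<bar>) * (measure M (subc k' i) * pker \<gamma> (\<delta> ^ min k k') x (u k' i)) * crf_coeff N ?T u k' i"
      have "ennreal (cmod (dist_op Q f k x)) \<le> ennreal D * (\<Sum>k'. \<integral>\<^sup>+i. ennreal (?w k' i) \<partial>count_space (idx k'))"
        using u by (intro D(2)[OF f]) auto
      also have "\<dots> = ennreal D * (\<integral>\<^sup>+p. ennreal (?w (fst p) (snd p)) \<partial>count_space all_idx)"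
        by (subst suminf_idx_eq) simp
      finally have "ennreal (\<delta> powr (- (real k * s))) * ennreal (cmod (dist_op Q f k x))
         \<le> ennreal (\<delta> powr (- (real k * s))) * (ennreal D * (\<integral>\<^sup>+p. ennreal (?w (fst p) (snd p)) \<partial>count_space all_idx))"
        by (rule mult_left_mono) simp
      also have "\<dots> = (\<integral>\<^sup>+p. ennreal (\<delta> powr (- (real k * s))) * (ennreal D * ennreal (?w (fst p) (snd p))) \<partial>count_space all_idx)"
        by (simp add: nn_integral_cmult)
      also have "\<dots> = (\<integral>\<^sup>+p. ennreal (kmass \<gamma> \<sigma> s u k x p * \<tau> p) \<partial>count_space all_idx)"
      proof (intro nn_integral_cong)
        fix p :: "nat \<times> 'i \<times> nat"
        \<comment> \<open>The origin of \<open>dyw\<close>: the rescaling at level k is exchanged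
          for the one at level k'.\<close>
        have "\<delta> powr (- (real k * s)) * \<delta> powr (\<sigma> * \<bar>real k - real (fst p)\<bar>) = dyw \<sigma> s k (fst p) * \<delta> powr (- (real (fst p) * s))"
          unfolding dyw_def powr_add[symmetric] by (simp add: algebra_simps)
        then have "\<delta> powr (- (real k * s)) * (D * ?w (fst p) (snd p)) = kmass \<gamma> \<sigma> s u k x p * \<tau> p"
          unfolding kmass_def \<tau>_def by (simp add: mult_ac)
        then show "ennreal (\<delta> powr (- (real k * s))) * (ennreal D * ennreal (?w (fst p) (snd p))) = ennreal (kmass \<gamma> \<sigma> s u k x p * \<tau> p)"
          using D(1) by (simp add: ennreal_mult'[symmetric])
      qed
      finally show ?thesis by (simp add: ennreal_mult)
    qed
    show "\<exists>u \<tau>. sample_points u \<and> (\<forall>p\<in>all_idx. 0 \<le> \<tau> p \<and> \<tau> p \<le> B * a) \<and>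
      (\<forall>k x. ennreal (\<delta> powr (- (real k * s)) * cmod (dist_op Q f k x))
         \<le> (\<integral>\<^sup>+p. ennreal (kmass \<gamma> \<sigma> s u k x p * \<tau> p) \<partial>count_space all_idx)) \<and>
      (\<forall>k i y. N < k \<longrightarrow> i \<in> idx k \<longrightarrow> y \<in> subc k i \<longrightarrow>
         \<tau> (k, i) \<le> D * (\<delta> powr (- (real k * s)) * cmod (?T k y)) + D * a * (1 / 2) ^ k)"
      using u \<tau>0 unif pt fine by (intro exI[of _ u] exI[of _ \<tau>]) blast
  qed
qed

end

text \<open>Reduces an inequality between possibly infinite norms to finite positive bounds a. X may
  be 0, hence the detour through X + e/C.\<close>

lemma ennreal_le_multI:
  fixes X Z :: ennreal
  assumes "0 < C" "\<And>a. 0 < a \<Longrightarrow> X \<le> ennreal a \<Longrightarrow> Z \<le> ennreal (C * a)"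
  shows "Z \<le> ennreal C * X"
proof (cases X)
  case (real b)
  show ?thesis
  proof (rule ennreal_le_epsilon)
    fix e :: real assume e: "0 < e"
    have "Z \<le> ennreal (C * (b + e / C))"
      using assms(1) real e by (intro assms(2)) (auto intro!: add_nonneg_pos ennreal_leI)
    also have "\<dots> = ennreal C * X + ennreal e"
      using assms(1) real e by (simp add: distrib_left ennreal_mult)
    finally show "Z \<le> ennreal C * X + ennreal e" .
  qed
next
  case top
  then show ?thesis using assms(1) by (simp add: ennreal_mult_top)
qed

text \<open>Clearing the denominators in the critical index gives the inequalities for r, and |s| <
  t gives them for 1, hence they hold for \<open>min r 1\<close>.\<close>

lemma crit_index_less_imp:
  assumes "crit_index w s t < r" "0 \<le> w" "\<bar>s\<bar> < t"
  shows "0 < r" "w < min r 1 * (w + t)" "w < min r 1 * (w + t + s)"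
proof -
  have p: "0 < w + t" "0 < w + t + s" using assms by auto
  have 1: "w / (w + t) < r" "w / (w + t + s) < r" using assms(1) by (auto simp: crit_index_def)
  moreover have "0 \<le> w / (w + t)" using assms p by simp
  ultimately show "0 < r" by linarith
  have "w < r * (w + t)" "w < r * (w + t + s)" using 1 p by (simp_all add: divide_less_eq)
  moreover have "w < 1 * (w + t)" "w < 1 * (w + t + s)" using assms by auto
  ultimately show "w < min r 1 * (w + t)" "w < min r 1 * (w + t + s)" by (simp_all only: min_def split: if_split) auto
qed

context dyadic_system
begin

text \<open>With \<nu> = min r 1 the inequality with s reads hdim/\<nu> - hdim - s < min \<beta>
  \<gamma>, which leaves a gap for \<sigma>, above |s| as well. The inequality without s concerns
  the spatial decay, whose exponent stays \<gamma>.\<close>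

lemma choose_exponent:
  assumes "\<bar>s\<bar> < min \<beta> \<gamma>" "ereal (crit_index hdim s (min \<beta> \<gamma>)) < q"
  obtains \<sigma> where "\<bar>s\<bar> < \<sigma>" "\<sigma> < min \<beta> \<gamma>"
    "q = \<infinity> \<or> (\<exists>r>0. q = ereal r \<and> hdim < min r 1 * (hdim + \<gamma>) \<and> hdim < min r 1 * (hdim + \<sigma> + s))"
proof (cases q)
  case (real r)
  note r = crit_index_less_imp[OF _ hdim_nonneg assms(1), of r]
  have r1: "0 < r" "hdim < min r 1 * (hdim + min \<beta> \<gamma>)" "hdim < min r 1 * (hdim + min \<beta> \<gamma> + s)"
    using r assms(2) real by auto
  define \<nu> where "\<nu> = min r 1"
  have \<nu>: "0 < \<nu>" using r1 by (simp add: \<nu>_def)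
  have "hdim / \<nu> - hdim - s < min \<beta> \<gamma>"
  proof -
    have "hdim / \<nu> < hdim + min \<beta> \<gamma> + s" using r1(3) \<nu> by (simp add: \<nu>_def[symmetric] divide_less_eq mult.commute)
    then show ?thesis by linarith
  qed
  then have "max \<bar>s\<bar> (hdim / \<nu> - hdim - s) < min \<beta> \<gamma>" using assms(1) by (simp only: max_less_iff_conj) 
  then obtain \<sigma> where \<sigma>: "max \<bar>s\<bar> (hdim / \<nu> - hdim - s) < \<sigma>" "\<sigma> < min \<beta> \<gamma>" using dense by blast
  have "hdim / \<nu> < hdim + \<sigma> + s" using \<sigma>(1) by simp
  then have "hdim < \<nu> * (hdim + \<sigma> + s)" using \<nu> by (simp add: divide_less_eq mult.commute)
  moreover have "hdim < \<nu> * (hdim + \<gamma>)"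
  proof -
    have "\<nu> * (hdim + min \<beta> \<gamma>) \<le> \<nu> * (hdim + \<gamma>)" using \<nu> by (intro mult_left_mono) auto
    then show ?thesis using r1(2) by (simp add: \<nu>_def)
  qed
  ultimately show ?thesis using that[of \<sigma>] \<sigma> r1(1) real by (auto simp: \<nu>_def)
next
  case PInf
  obtain \<sigma> where "\<bar>s\<bar> < \<sigma>" "\<sigma> < min \<beta> \<gamma>" using assms(1) dense by blast
  then show ?thesis using that PInf by auto
qed (use assms in auto)

text \<open>N' is arbitrary and only N is tied to a reproducing formula, that of P; Q enters through
  its kernels. Hence the statement can be used in both directions.\<close>

lemma F_infty_norm_comparison:
  assumes Q: "exp_IATI M d \<delta> Y \<eta> Q" and P: "exp_IATI M d \<delta> Y \<eta> P"
    and crf: "crf_integer M d A0 x0 \<delta> A cnt sub \<eta> \<beta> \<gamma> P N"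
    and par: "0 < \<beta>" "\<beta> < \<eta>" "0 < \<gamma>" "\<gamma> < \<eta>" "\<eta> < 1"
    and s: "\<bar>s\<bar> < min \<beta> \<gamma>" and q: "ereal (crit_index hdim s (min \<beta> \<gamma>)) < q"
  shows "\<exists>C>0. \<forall>f\<in>distributions M d A0 x0 \<eta> \<beta> \<gamma>.
    F_infty_norm M \<delta> A cube cnt sub s q N' (dist_op Q f)
      \<le> ennreal C * F_infty_norm M \<delta> A cube cnt sub s q N (dist_op P f)"
proof -
  obtain \<sigma> where \<sigma>: "\<bar>s\<bar> < \<sigma>" "\<sigma> < min \<beta> \<gamma>"
    and qr: "q = \<infinity> \<or> (\<exists>r>0. q = ereal r \<and> hdim < min r 1 * (hdim + \<gamma>) \<and> hdim < min r 1 * (hdim + \<sigma> + s))"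
    by (rule choose_exponent[OF s q])
  have \<sigma>': "0 < \<sigma>" "\<sigma> < \<beta>" "\<sigma> < \<gamma>" using \<sigma> by auto
  have q': "q = \<infinity> \<or> (\<exists>r>0. q = ereal r)" using qr by blast
  obtain D B where D: "0 < D" and B: "0 < B" and
    coeff: "\<forall>f\<in>distributions M d A0 x0 \<eta> \<beta> \<gamma>. \<forall>a>0.
    F_infty_norm M \<delta> A cube cnt sub s q N (dist_op P f) \<le> ennreal a \<longrightarrow>
    (\<exists>u \<tau>. sample_points u \<and> (\<forall>p\<in>all_idx. 0 \<le> \<tau> p \<and> \<tau> p \<le> B * a) \<and>
      (\<forall>k x. ennreal (\<delta> powr (- (real k * s)) * cmod (dist_op Q f k x))
         \<le> (\<integral>\<^sup>+p. ennreal (kmass \<gamma> \<sigma> s u k x p * \<tau> p) \<partial>count_space all_idx)) \<and>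
      (\<forall>k i y. N < k \<longrightarrow> i \<in> idx k \<longrightarrow> y \<in> subc k i \<longrightarrow>
         \<tau> (k, i) \<le> D * (\<delta> powr (- (real k * s)) * cmod (dist_op P f k y)) + D * a * (1 / 2) ^ k))"
    using dist_op_coefficients[where s = s, OF Q crf par \<sigma>' q'] by (elim exE conjE) (rule that)
  obtain C1 where C1: "0 < C1" "\<forall>k x u. sample_points u \<longrightarrow>
    (\<integral>\<^sup>+p. ennreal (dyw \<sigma> s k (fst p) * (cm p *
        pker \<gamma> (\<delta> ^ min k (fst p)) x (u (fst p) (snd p)))) \<partial>count_space all_idx) \<le> ennreal C1"
    using dyw_sum_pker_le[OF par(3) \<sigma>(1)] by (elim exE conjE) (rule that)
  have le1: "\<beta> \<le> \<eta>" "\<gamma> \<le> 1" "\<eta> \<le> 1" using par by auto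
  have meas: "dist_op Q f k \<in> borel_measurable M" "dist_op P f k \<in> borel_measurable M"
    if "f \<in> distributions M d A0 x0 \<eta> \<beta> \<gamma>" for f k
    using dist_op_measurable[OF Q crf that par(1) le1(1) par(3) le1(2,3)]
      dist_op_measurable[OF P crf that par(1) le1(1) par(3) le1(2,3)] by auto
  have local: "\<exists>E>0. \<forall>f\<in>distributions M d A0 x0 \<eta> \<beta> \<gamma>. \<forall>a>0.
    F_infty_norm M \<delta> A cube cnt sub s q N (dist_op P f) \<le> ennreal a \<longrightarrow>
    (\<forall>k x. \<delta> powr (- (real k * s)) * cmod (dist_op Q f k x) \<le> B * C1 * a) \<longrightarrow>
    (\<forall>l>N'. \<forall>\<alpha>\<in>A (int l). local_norm M \<delta> s q (dist_op Q f) l (cube (int l) \<alpha>) \<le> ennreal (E * a))"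
  proof (cases "q = \<infinity>")
    case True
    show ?thesis
    proof (intro exI[of _ "B * C1"] conjI ballI allI impI)
      show "0 < B * C1" using B C1(1) by simp
      fix f a l \<alpha>
      assume f: "f \<in> distributions M d A0 x0 \<eta> \<beta> \<gamma>"
        and unif: "\<forall>k x. \<delta> powr (- (real k * s)) * cmod (dist_op Q f k x) \<le> B * C1 * a"
      note [measurable] = meas(1)[OF f]
      have "esssup (restrict_space M (cube (int l) \<alpha>)) (\<lambda>x. SUP k\<in>{l..}. ennreal (\<delta> powr (- real k * s) * cmod (dist_op Q f k x))) \<le> ennreal (B * C1 * a)"
      proof (rule esssup_I)
        \<comment> \<open>The essential supremum of a nonmeasurable function is \<open>top\<close>
          by convention, so measurability of Q_k f is indispensable here.\<close>
        have "(\<lambda>x. SUP k\<in>{l..}. ennreal (\<delta> powr (- real k * s) * cmod (dist_op Q f k x))) \<in> borel_measurable M"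
          by (intro borel_measurable_SUP) auto
        then show "(\<lambda>x. SUP k\<in>{l..}. ennreal (\<delta> powr (- real k * s) * cmod (dist_op Q f k x))) \<in> borel_measurable (restrict_space M (cube (int l) \<alpha>))"
          by (rule measurable_restrict_space1)
        show "AE x in restrict_space M (cube (int l) \<alpha>). (SUP k\<in>{l..}. ennreal (\<delta> powr (- real k * s) * cmod (dist_op Q f k x))) \<le> ennreal (B * C1 * a)"
          using unif by (intro AE_I2 SUP_least ennreal_leI) simp
      qed
      then show "local_norm M \<delta> s q (dist_op Q f) l (cube (int l) \<alpha>) \<le> ennreal (B * C1 * a)"
        using True by (simp add: local_norm_def)
    qed
  next
    case False
    then obtain r where r: "0 < r" "q = ereal r" "hdim < min r 1 * (hdim + \<gamma>)" "hdim < min r 1 * (hdim + \<sigma> + s)"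
      using qr by blast
    obtain C2 where C2: "0 < C2" "\<forall>u l \<alpha> \<tau> a y. sample_points u \<longrightarrow> \<alpha> \<in> A (int l) \<longrightarrow> 0 \<le> a \<longrightarrow>
      (\<forall>k x. 0 \<le> y k x) \<longrightarrow> (\<forall>p\<in>all_idx. 0 \<le> \<tau> p \<and> \<tau> p \<le> a) \<longrightarrow>
      (\<forall>k x. ennreal (y k x) \<le> (\<integral>\<^sup>+p. ennreal (kmass \<gamma> \<sigma> s u k x p * \<tau> p) \<partial>count_space all_idx)) \<longrightarrow>
      (\<integral>\<^sup>+x\<in>cube (int l) \<alpha>. (\<Sum>n. ennreal (y (l + n) x powr r)) \<partial>M) \<le> ennreal C2 * (ennreal (a powr r) * emeasure M (cube (int l) \<alpha>) +
        (\<integral>\<^sup>+p. ennreal (cm p * \<tau> p powr r) * indicator (near N l \<alpha> u) p \<partial>count_space all_idx))"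
      using carleson_estimate[where N = N, OF par(3) \<sigma>(1) r(1,3,4)] by (elim exE conjE) (rule that)
    obtain C3 where C3: "0 < C3" "\<forall>G u a \<tau> l \<alpha>. (\<forall>k. G k \<in> borel_measurable M) \<longrightarrow> (\<forall>k y. 0 \<le> G k y) \<longrightarrow>
      sample_points u \<longrightarrow> 0 < a \<longrightarrow> \<alpha> \<in> A (int l) \<longrightarrow> (\<forall>p\<in>all_idx. 0 \<le> \<tau> p) \<longrightarrow>
      (\<forall>k i y. N < k \<longrightarrow> i \<in> idx k \<longrightarrow> y \<in> subc k i \<longrightarrow> \<tau> (k, i) \<le> G k y + a * (1 / 2) ^ k) \<longrightarrow>
      (\<forall>l' \<alpha>'. N < l' \<longrightarrow> \<alpha>' \<in> A (int l') \<longrightarrow>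
         (\<integral>\<^sup>+x\<in>cube (int l') \<alpha>'. (\<Sum>n. ennreal (G (l' + n) x powr r)) \<partial>M) \<le> ennreal (a powr r) * emeasure M (cube (int l') \<alpha>')) \<longrightarrow>
      (\<integral>\<^sup>+p. ennreal (cm p * \<tau> p powr r) * indicator (near N l \<alpha> u) p \<partial>count_space all_idx)
        \<le> ennreal (C3 * a powr r) * emeasure M (cube (int l) \<alpha>)"
      using near_sum_le[where N = N, OF r(1)] by (elim exE conjE) (rule that)
    \<comment> \<open>B comes from the uniform bound on the coefficients, D and C3 from the near
      subcubes; E is the r-th root, because the norm is homogeneous of degree 1.\<close>
    define H where "H = C2 * (B powr r + C3 * D powr r)"
    have H: "0 < H" using B C2(1) C3(1) by (auto simp: H_def intro!: mult_pos_pos add_pos_nonneg)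
    define E where "E = H powr (1 / r)"
    have E: "0 < E" "E powr r = H" using H r by (auto simp: E_def powr_powr)
    show ?thesis
    proof (intro exI[of _ E] conjI ballI allI impI)
      show "0 < E" by fact
      fix f a l \<alpha>
      assume f: "f \<in> distributions M d A0 x0 \<eta> \<beta> \<gamma>" and a: "0 < (a::real)"
        and F: "F_infty_norm M \<delta> A cube cnt sub s q N (dist_op P f) \<le> ennreal a"
        and al: "\<alpha> \<in> A (int l)"
      obtain u \<tau> where u: "sample_points u" and \<tau>: "\<forall>p\<in>all_idx. 0 \<le> \<tau> p \<and> \<tau> p \<le> B * a"
        and pt: "\<forall>k x. ennreal (\<delta> powr (- (real k * s)) * cmod (dist_op Q f k x))
         \<le> (\<integral>\<^sup>+p. ennreal (kmass \<gamma> \<sigma> s u k x p * \<tau> p) \<partial>count_space all_idx)"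
        and fine: "\<forall>k i y. N < k \<longrightarrow> i \<in> idx k \<longrightarrow> y \<in> subc k i \<longrightarrow>
         \<tau> (k, i) \<le> D * (\<delta> powr (- (real k * s)) * cmod (dist_op P f k y)) + D * a * (1 / 2) ^ k"
        using coeff[rule_format, OF f a F] by (elim exE conjE) (rule that)
      note [measurable] = meas[OF f]
      define G where "G k y = D * (\<delta> powr (- (real k * s)) * cmod (dist_op P f k y))" for k y
      have Gm: "G k \<in> borel_measurable M" for k unfolding G_def by measurable
      \<comment> \<open>\<open>near_sum_le\<close> is applied with \<open>D * a\<close> in place of
        a, since the coefficients carry the factor D.\<close>
      have near: "(\<integral>\<^sup>+p. ennreal (cm p * \<tau> p powr r) * indicator (near N l \<alpha> u) p \<partial>count_space all_idx)
        \<le> ennreal (C3 * (D * a) powr r) * emeasure M (cube (int l) \<alpha>)"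
      proof (rule C3(2)[rule_format, where G = G])
        show "G k \<in> borel_measurable M" for k by (rule Gm)
        show "0 \<le> G k y" for k y using D by (simp add: G_def)
        show "\<tau> (k, i) \<le> G k y + D * a * (1 / 2) ^ k" if "N < k" "i \<in> idx k" "y \<in> subc k i" for k i y
          unfolding G_def using fine that by blast
        fix l' \<alpha>' assume l': "N < l'" "\<alpha>' \<in> A (int l')"
        note [measurable] = cube_measurable[OF l'(2)]
        let ?h = "\<lambda>x. \<Sum>n. ennreal ((\<delta> powr (- (real (l' + n) * s)) * cmod (dist_op P f (l' + n) x)) powr r)"
        have "(\<Sum>n. ennreal (G (l' + n) x powr r)) = ennreal (D powr r) * ?h x" for x
          unfolding G_def powr_mult[of D] by (simp add: ennreal_mult)
        then have "(\<integral>\<^sup>+x\<in>cube (int l') \<alpha>'. (\<Sum>n. ennreal (G (l' + n) x powr r)) \<partial>M)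
          = (\<integral>\<^sup>+x. ennreal (D powr r) * (?h x * indicator (cube (int l') \<alpha>') x) \<partial>M)"
          by (simp only: mult.assoc)
        also have "\<dots> = ennreal (D powr r) * (\<integral>\<^sup>+x\<in>cube (int l') \<alpha>'. ?h x \<partial>M)"
          by (rule nn_integral_cmult) measurable
        also have "\<dots> \<le> ennreal (D powr r) * (ennreal (a powr r) * emeasure M (cube (int l') \<alpha>'))"
        proof (rule mult_left_mono)
          have "local_norm M \<delta> s q (dist_op P f) l' (cube (int l') \<alpha>') \<le> ennreal a"
            using F l' unfolding F_infty_norm_le_iff by blast
          then show "(\<integral>\<^sup>+x\<in>cube (int l') \<alpha>'. ?h x \<partial>M) \<le> ennreal (a powr r) * emeasure M (cube (int l') \<alpha>')"
            unfolding r(2) local_norm_le_iff[OF r(1) less_imp_le[OF a] l'(2)] .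
        qed simp
        also have "\<dots> = ennreal ((D * a) powr r) * emeasure M (cube (int l') \<alpha>')"
          by (simp add: powr_mult ennreal_mult mult.assoc)
        finally show "(\<integral>\<^sup>+x\<in>cube (int l') \<alpha>'. (\<Sum>n. ennreal (G (l' + n) x powr r)) \<partial>M) \<le> ennreal ((D * a) powr r) * emeasure M (cube (int l') \<alpha>')" .
      qed (use u D a al \<tau> in auto)
      have "(\<integral>\<^sup>+x\<in>cube (int l) \<alpha>. (\<Sum>n. ennreal ((\<delta> powr (- (real (l + n) * s)) * cmod (dist_op Q f (l + n) x)) powr r)) \<partial>M)
        \<le> ennreal C2 * (ennreal ((B * a) powr r) * emeasure M (cube (int l) \<alpha>) +
        (\<integral>\<^sup>+p. ennreal (cm p * \<tau> p powr r) * indicator (near N l \<alpha> u) p \<partial>count_space all_idx))"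
        by (rule C2(2)[rule_format, where y = "\<lambda>k x. \<delta> powr (- (real k * s)) * cmod (dist_op Q f k x)" and u = u and \<tau> = \<tau>])
          (use u al a B \<tau> pt in simp_all)
      also have "\<dots> \<le> ennreal C2 * (ennreal ((B * a) powr r) * emeasure M (cube (int l) \<alpha>) + ennreal (C3 * (D * a) powr r) * emeasure M (cube (int l) \<alpha>))"
        by (intro mult_left_mono add_left_mono near) simp
      also have "\<dots> = (ennreal C2 * (ennreal ((B * a) powr r) + ennreal (C3 * (D * a) powr r))) * emeasure M (cube (int l) \<alpha>)"
        by (simp only: distrib_right mult.assoc)
      also have "ennreal C2 * (ennreal ((B * a) powr r) + ennreal (C3 * (D * a) powr r)) = ennreal (C2 * ((B * a) powr r + C3 * (D * a) powr r))"
        using C2(1) C3(1) by (simp add: ennreal_mult)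
      also have "C2 * ((B * a) powr r + C3 * (D * a) powr r) = (E * a) powr r"
        by (simp add: powr_mult E(2)) (simp add: H_def algebra_simps)
      finally show "local_norm M \<delta> s q (dist_op Q f) l (cube (int l) \<alpha>) \<le> ennreal (E * a)"
        unfolding r(2) using a E(1) by (subst local_norm_le_iff[OF r(1) _ al]) auto
    qed
  qed
  then obtain E where E: "0 < E" and loc: "\<forall>f\<in>distributions M d A0 x0 \<eta> \<beta> \<gamma>. \<forall>a>0.
    F_infty_norm M \<delta> A cube cnt sub s q N (dist_op P f) \<le> ennreal a \<longrightarrow>
    (\<forall>k x. \<delta> powr (- (real k * s)) * cmod (dist_op Q f k x) \<le> B * C1 * a) \<longrightarrow>
    (\<forall>l>N'. \<forall>\<alpha>\<in>A (int l). local_norm M \<delta> s q (dist_op Q f) l (cube (int l) \<alpha>) \<le> ennreal (E * a))"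
    by (elim exE conjE) (rule that)
  \<comment> \<open>At levels k \<le> N' the rescaling by \<delta>^(-ks) is undone at a cost of at
    most \<delta>^(-N'|s|).\<close>
  define W where "W = \<delta> powr (- (real N' * \<bar>s\<bar>)) * (B * C1)"
  have W: "0 < W" using B C1(1) delta_pos by (simp add: W_def)
  show ?thesis
  proof (intro exI[of _ "W + E"] conjI ballI)
    show "0 < W + E" using W E by simp
    fix f assume f: "f \<in> distributions M d A0 x0 \<eta> \<beta> \<gamma>"
    show "F_infty_norm M \<delta> A cube cnt sub s q N' (dist_op Q f)
      \<le> ennreal (W + E) * F_infty_norm M \<delta> A cube cnt sub s q N (dist_op P f)"
    proof (rule ennreal_le_multI)
      show "0 < W + E" using W E by simp
      fix a :: real
      assume a: "0 < a" and F: "F_infty_norm M \<delta> A cube cnt sub s q N (dist_op P f) \<le> ennreal a"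
      obtain u \<tau> where u: "sample_points u" and \<tau>: "\<forall>p\<in>all_idx. 0 \<le> \<tau> p \<and> \<tau> p \<le> B * a"
        and pt: "\<forall>k x. ennreal (\<delta> powr (- (real k * s)) * cmod (dist_op Q f k x))
         \<le> (\<integral>\<^sup>+p. ennreal (kmass \<gamma> \<sigma> s u k x p * \<tau> p) \<partial>count_space all_idx)"
        using coeff[rule_format, OF f a F] by (elim exE conjE) (rule that)
      have unif: "\<delta> powr (- (real k * s)) * cmod (dist_op Q f k x) \<le> B * C1 * a" for k x
      proof -
        have "ennreal (\<delta> powr (- (real k * s)) * cmod (dist_op Q f k x)) \<le> (\<integral>\<^sup>+p. ennreal (kmass \<gamma> \<sigma> s u k x p * \<tau> p) \<partial>count_space all_idx)"
          using pt by blast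
        also have "\<dots> \<le> (\<integral>\<^sup>+p. ennreal (B * a) * ennreal (kmass \<gamma> \<sigma> s u k x p) \<partial>count_space all_idx)"
        proof (intro nn_integral_mono)
          fix p assume "p \<in> space (count_space all_idx)"
          then have "kmass \<gamma> \<sigma> s u k x p * \<tau> p \<le> kmass \<gamma> \<sigma> s u k x p * (B * a)"
            using \<tau> by (intro mult_left_mono) auto
          then show "ennreal (kmass \<gamma> \<sigma> s u k x p * \<tau> p) \<le> ennreal (B * a) * ennreal (kmass \<gamma> \<sigma> s u k x p)"
            using B a by (subst ennreal_mult[symmetric]) (auto simp: mult.commute intro!: ennreal_leI)
        qed
        also have "\<dots> = ennreal (B * a) * (\<integral>\<^sup>+p. ennreal (kmass \<gamma> \<sigma> s u k x p) \<partial>count_space all_idx)"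
          by (rule nn_integral_cmult) simp
        also have "\<dots> \<le> ennreal (B * a) * ennreal C1"
          unfolding kmass_def using u by (intro mult_left_mono C1(2)[rule_format]) auto
        also have "\<dots> = ennreal (B * C1 * a)"
          using B a C1(1) by (simp add: mult_ac flip: ennreal_mult)
        finally show ?thesis using B a C1(1) by simp
      qed
      have mean: "(\<integral>\<^sup>+x\<in>subc k i. ennreal (cmod (dist_op Q f k x)) \<partial>M) / emeasure M (subc k i) \<le> ennreal ((W + E) * a)"
        if k: "k \<le> N'" and i: "i \<in> idx k" for k i
      proof -
        have b: "cmod (dist_op Q f k x) \<le> W * a" for x
        proof -
          have "cmod (dist_op Q f k x) = \<delta> powr (real k * s) * (\<delta> powr (- (real k * s)) * cmod (dist_op Q f k x))"
            using delta_pos by (simp add: powr_minus)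
          also have "\<dots> \<le> \<delta> powr (- (real N' * \<bar>s\<bar>)) * (B * C1 * a)"
          proof (rule mult_mono[OF delta_powr_mono unif])
            have "real k * (- s) \<le> real k * \<bar>s\<bar>" by (intro mult_left_mono) auto
            moreover have "real k * \<bar>s\<bar> \<le> real N' * \<bar>s\<bar>" using k by (intro mult_right_mono) auto
            ultimately show "- (real N' * \<bar>s\<bar>) \<le> real k * s" by simp
          qed auto
          finally show ?thesis by (simp add: W_def mult.assoc)
        qed
        have "(\<integral>\<^sup>+x\<in>subc k i. ennreal (cmod (dist_op Q f k x)) \<partial>M) \<le> (\<integral>\<^sup>+x. ennreal (W * a) * indicator (subc k i) x \<partial>M)"
          using b by (intro nn_integral_mono mult_right_mono ennreal_leI) auto
        also have "\<dots> = ennreal (W * a * measure M (subc k i))"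
          using i a W by (simp add: nn_integral_cmult_indicator subc_emeasure ennreal_mult)
        also have "\<dots> \<le> ennreal ((W + E) * a * measure M (subc k i))"
          using E a by (intro ennreal_leI mult_right_mono) auto
        finally show ?thesis
          using a W E by (subst subc_mean_le_iff[OF i]) auto
      qed
      have loc': "local_norm M \<delta> s q (dist_op Q f) l (cube (int l) \<alpha>) \<le> ennreal ((W + E) * a)"
        if "N' < l" "\<alpha> \<in> A (int l)" for l \<alpha>
      proof -
        have "local_norm M \<delta> s q (dist_op Q f) l (cube (int l) \<alpha>) \<le> ennreal (E * a)"
          using loc[rule_format, OF f a F] unif that by blast
        also have "\<dots> \<le> ennreal ((W + E) * a)" using W a by (intro ennreal_leI mult_right_mono) auto
        finally show ?thesis .
      qed
      show "F_infty_norm M \<delta> A cube cnt sub s q N' (dist_op Q f) \<le> ennreal ((W + E) * a)"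
        unfolding F_infty_norm_le_iff using mean loc' by blast
    qed
  qed
qed

end

theorem proposition5p10:
  fixes M :: "'a measure" and d :: "'a \<Rightarrow> 'a \<Rightarrow> real" and A0 Cmu c0 C0 \<delta> :: real
    and A :: "int \<Rightarrow> 'i set" and z :: "int \<Rightarrow> 'i \<Rightarrow> 'a" and cube :: "int \<Rightarrow> 'i \<Rightarrow> 'a set"
    and j0 :: nat and cnt :: "int \<Rightarrow> 'i \<Rightarrow> nat" and sub :: "int \<Rightarrow> 'i \<Rightarrow> nat \<Rightarrow> 'a set"
    and x0 :: 'a and \<eta> \<beta> \<gamma> s :: real and q :: ereal
    and Q P :: "nat \<Rightarrow> 'a \<Rightarrow> 'a \<Rightarrow> complex" and N N' :: nat
  assumes "dyadic_system M d A0 Cmu c0 C0 \<delta> A z cube j0 cnt sub"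
    and "\<eta> \<in> {0<..<1}"
    and "exp_IATI M d \<delta> (new_points A z) \<eta> Q"
    and "exp_IATI M d \<delta> (new_points A z) \<eta> P"
    and "\<beta> \<in> {0<..<\<eta>}" and "\<gamma> \<in> {0<..<\<eta>}"
    and "s \<in> {- min \<beta> \<gamma><..<min \<beta> \<gamma>}"
    and "ereal (crit_index (log 2 Cmu) s (min \<beta> \<gamma>)) < q"
    and "crf_integer M d A0 x0 \<delta> A cnt sub \<eta> \<beta> \<gamma> Q N"
    and "crf_integer M d A0 x0 \<delta> A cnt sub \<eta> \<beta> \<gamma> P N'"
  shows "\<exists>C::real. 0 < C \<and> (\<forall>f \<in> distributions M d A0 x0 \<eta> \<beta> \<gamma>.
           F_infty_norm M \<delta> A cube cnt sub s q N (dist_op Q f)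
             \<le> ennreal C * F_infty_norm M \<delta> A cube cnt sub s q N' (dist_op P f) \<and>
           F_infty_norm M \<delta> A cube cnt sub s q N' (dist_op P f)
             \<le> ennreal C * F_infty_norm M \<delta> A cube cnt sub s q N (dist_op Q f))"
proof -
  interpret dyadic_system M d A0 Cmu c0 C0 \<delta> A z cube j0 cnt sub by fact
  have par: "0 < \<beta>" "\<beta> < \<eta>" "0 < \<gamma>" "\<gamma> < \<eta>" "\<eta> < 1" "\<bar>s\<bar> < min \<beta> \<gamma>"
    using assms(2,5-7) by auto
  have q: "ereal (crit_index hdim s (min \<beta> \<gamma>)) < q" using assms(8) by (simp add: hdim_def)
  let ?F = "\<lambda>N T. F_infty_norm M \<delta> A cube cnt sub s q N T"
  \<comment> \<open>One comparison for each direction, using the reproducing formula of the family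
    on the right-hand side.\<close>
  obtain C1 where C1: "0 < C1" "\<forall>f\<in>distributions M d A0 x0 \<eta> \<beta> \<gamma>. ?F N (dist_op Q f) \<le> ennreal C1 * ?F N' (dist_op P f)"
    using F_infty_norm_comparison[where N' = N, OF assms(3,4,10) par q] by (elim exE conjE) (rule that)
  obtain C2 where C2: "0 < C2" "\<forall>f\<in>distributions M d A0 x0 \<eta> \<beta> \<gamma>. ?F N' (dist_op P f) \<le> ennreal C2 * ?F N (dist_op Q f)"
    using F_infty_norm_comparison[where N' = N', OF assms(4,3,9) par q] by (elim exE conjE) (rule that)
  show ?thesis
  proof (intro exI[of _ "max C1 C2"] conjI ballI)
    show "0 < max C1 C2" using C1(1) by simp
    fix f assume f: "f \<in> distributions M d A0 x0 \<eta> \<beta> \<gamma>"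
    have m: "ennreal C1 * X \<le> ennreal (max C1 C2) * X" "ennreal C2 * X \<le> ennreal (max C1 C2) * X" for X
      by (auto intro!: mult_right_mono ennreal_leI)
    show "?F N (dist_op Q f) \<le> ennreal (max C1 C2) * ?F N' (dist_op P f)"
      using C1(2) f m(1) by (meson order_trans)
    show "?F N' (dist_op P f) \<le> ennreal (max C1 C2) * ?F N (dist_op Q f)"
      using C2(2) f m(2) by (meson order_trans)
  qed
qed

end
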